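(* Let $E,F$ be $AL$-spaces and let $T:E\to F$ be a bounded linear operator. Then $$\|T\|_w=\sup\{\|U\|^{-1}\|V\|^{-1}: U:F\to\ell_1,\ V:\ell_1\to E \text{ bounded linear operators with } UTV=I_{\ell_1}\}.$$
   Context: Scalars are real or complex. An $AL$-space is a Banach lattice $E$ such that $\|x+y\|=\|x\|+\|y\|$ for all $x,y$ in the positive cone $E^+$ (equivalently, up to isometric lattice isomorphism, an $L_1(X,\Sigma,\mu)$-space; complex $AL$-spaces are understood via complex Banach lattices and are likewise the complex $L_1$-spaces). An operator is weakly compact if the image of the unit ball is relatively weakly compact, and $\|T\|_w=\inf\{\|T-W\|: W:E\to F\text{ weakly compact}\}$. $I_{\ell_1}$ is the identity on $\ell_1=\ell_1(\mathbb{N})$. The supremum over the empty set is $0$ by convention. *)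

theory Defs
  imports "HOL-Analysis.Analysis" "HOL-Library.Lattice_Algebras"
begin

section \<open>Banach lattices and AL-spaces\<close>

class banach_lattice = banach + ordered_real_vector + lattice_ab_group_add_abs +
  assumes norm_lattice_mono: "\<bar>x\<bar> \<le> \<bar>y\<bar> \<Longrightarrow> norm x \<le> norm y"

class al_space = banach_lattice +
  assumes norm_add_pos: "0 \<le> x \<Longrightarrow> 0 \<le> y \<Longrightarrow> norm (x + y) = norm x + norm y"

lemma norm_abs_lattice: "norm \<bar>x\<bar> = norm (x::'a::banach_lattice)"
  by (intro antisym norm_lattice_mono) auto

lemma norm_pos_mono: "0 \<le> x \<Longrightarrow> x \<le> y \<Longrightarrow> norm x \<le> norm (y::'a::banach_lattice)"
  by (rule norm_lattice_mono) (metis abs_of_nonneg order_trans)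

lemma pos_cone_limit:
  fixes X :: "nat \<Rightarrow> 'a::banach_lattice"
  assumes lim: "X \<longlonglongrightarrow> x" and pos: "\<And>n. 0 \<le> X n"
  shows "0 \<le> x"
proof -
  have "norm (pprt (- x)) \<le> norm (X n - x)" for n
  proof -
    have "- x \<le> X n - x"
      using pos[of n] by simp
    also have "\<dots> \<le> \<bar>X n - x\<bar>"
      by (rule abs_ge_self)
    finally have "pprt (- x) \<le> \<bar>X n - x\<bar>"
      by (simp add: pprt_def)
    then have "norm (pprt (- x)) \<le> norm \<bar>X n - x\<bar>"
      by (intro norm_pos_mono) auto
    then show ?thesis
      by (simp add: norm_abs_lattice)
  qed
  moreover have "(\<lambda>n. norm (X n - x)) \<longlonglongrightarrow> 0"
    using lim by (simp add: LIM_zero tendsto_norm_zero)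
  ultimately have "norm (pprt (- x)) \<le> 0"
    by (intro LIMSEQ_le_const) auto
  then have "pprt (- x) = 0"
    by simp
  then show "0 \<le> x"
    using le_zero_iff_zero_pprt[of "- x"] by simp
qed

lemma le_limit:
  fixes X Y :: "nat \<Rightarrow> 'a::banach_lattice"
  assumes "X \<longlonglongrightarrow> x" "Y \<longlonglongrightarrow> y" "\<And>n. X n \<le> Y n"
  shows "x \<le> y"
  using pos_cone_limit[OF tendsto_diff[OF assms(2,1)]] assms(3) by simp

lemma scaleR_le_abs:
  fixes x :: "'a::banach_lattice"
  shows "a *\<^sub>R x \<le> \<bar>a\<bar> *\<^sub>R \<bar>x\<bar>"
proof (cases "0 \<le> a")
  case True
  then show ?thesis
    by (simp add: scaleR_left_mono abs_ge_self)
next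
  case False
  then have "(- a) *\<^sub>R (- x) \<le> (- a) *\<^sub>R \<bar>x\<bar>"
    by (intro scaleR_left_mono) (auto simp: abs_ge_minus_self)
  with False show ?thesis
    by simp
qed

lemma lub_compact_combination:
  fixes x y :: "'a::banach_lattice" and C :: "(real \<times> real) set"
  assumes C: "compact C" "C \<noteq> {}"
  shows "\<exists>s. (\<forall>p\<in>C. fst p *\<^sub>R x + snd p *\<^sub>R y \<le> s) \<and>
             (\<forall>b. (\<forall>p\<in>C. fst p *\<^sub>R x + snd p *\<^sub>R y \<le> b) \<longrightarrow> s \<le> b)"
proof -
  define v where "v = (\<lambda>p::real \<times> real. fst p *\<^sub>R x + snd p *\<^sub>R y)"
  define e where "e = \<bar>x\<bar> + \<bar>y\<bar>"
  have e0: "0 \<le> e"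
    by (simp add: e_def)
  have v_le: "v p \<le> v q + dist p q *\<^sub>R e" for p q
  proof -
    have "v p - v q = fst (p - q) *\<^sub>R x + snd (p - q) *\<^sub>R y"
      by (simp add: v_def algebra_simps)
    also have "\<dots> \<le> \<bar>fst (p - q)\<bar> *\<^sub>R \<bar>x\<bar> + \<bar>snd (p - q)\<bar> *\<^sub>R \<bar>y\<bar>"
      by (intro add_mono scaleR_le_abs)
    also have "\<dots> \<le> dist p q *\<^sub>R \<bar>x\<bar> + dist p q *\<^sub>R \<bar>y\<bar>"
      using norm_fst_le[of "fst (p - q)" "snd (p - q)"] norm_snd_le[of "snd (p - q)" "fst (p - q)"]
      by (intro add_mono scaleR_right_mono) (auto simp: dist_norm norm_prod_def)
    finally show ?thesis
      by (simp add: e_def algebra_simps)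
  qed
  have "\<exists>K. finite K \<and> K \<subseteq> C \<and> C \<subseteq> (\<Union>k\<in>K. ball k ((1/2)^n))" for n :: nat
  proof -
    have "0 < (1/2::real)^n"
      by simp
    then show ?thesis
      using seq_compact_imp_totally_bounded[OF compact_imp_seq_compact[OF C(1)]] by blast
  qed
  then obtain K where K: "\<And>n::nat. finite (K n)" "\<And>n. K n \<subseteq> C"
      "\<And>n. C \<subseteq> (\<Union>k\<in>K n. ball k ((1/2)^n))"
    by metis
  have K0: "K n \<noteq> {}" for n
    using K(3)[of n] C(2) by auto
  define s where "s = (\<lambda>n. Sup_fin (v ` K n))"
  have s_upper: "v p \<le> s n + (1/2)^n *\<^sub>R e" if "p \<in> C" for p n
  proof -
    obtain k where k: "k \<in> K n" "dist k p < (1/2)^n"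
      using K(3)[of n] \<open>p \<in> C\<close> by auto
    have "v p \<le> v k + dist p k *\<^sub>R e"
      by (rule v_le)
    also have "\<dots> \<le> s n + (1/2)^n *\<^sub>R e"
      using k K(1) e0 by (intro add_mono scaleR_right_mono)
        (auto simp: s_def dist_commute intro: Sup_fin.coboundedI)
    finally show ?thesis .
  qed
  have s_least: "s n \<le> b" if "\<And>p. p \<in> C \<Longrightarrow> v p \<le> b" for n b
  proof -
    have "v k \<le> b" if "k \<in> K n" for k
      using K(2)[of n] that \<open>\<And>p. p \<in> C \<Longrightarrow> v p \<le> b\<close> by blast
    then show ?thesis
      unfolding s_def using K(1) K0 by (intro Sup_fin.boundedI) auto
  qed
  have s_cmp: "s n \<le> s m + (1/2)^m *\<^sub>R e" for n m
    by (rule s_least) (rule s_upper)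
  have s_dist: "norm (s n - s m) \<le> (1/2)^N * norm e" if "N \<le> n" "N \<le> m" for n m N
  proof -
    have le: "(1/2)^k *\<^sub>R e \<le> (1/2)^N *\<^sub>R e" if "N \<le> k" for k
      using that e0 by (intro scaleR_right_mono power_decreasing) auto
    have "s n - s m \<le> (1/2)^N *\<^sub>R e" "- (s n - s m) \<le> (1/2)^N *\<^sub>R e"
      using order_trans[OF s_cmp[of n m] add_left_mono[OF le[OF that(2)]]]
        order_trans[OF s_cmp[of m n] add_left_mono[OF le[OF that(1)]]]
      by (simp_all add: algebra_simps)
    then have "\<bar>s n - s m\<bar> \<le> (1/2)^N *\<^sub>R e"
      by (simp add: abs_leI)
    then have "norm \<bar>s n - s m\<bar> \<le> norm ((1/2)^N *\<^sub>R e)"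
      by (intro norm_pos_mono) auto
    then show ?thesis
      by (simp add: norm_abs_lattice)
  qed
  have lim0: "(\<lambda>n. (1/2::real)^n) \<longlonglongrightarrow> 0"
    by (rule LIMSEQ_power_zero) simp
  have "Cauchy s"
  proof (rule CauchyI)
    fix \<epsilon> :: real
    assume "0 < \<epsilon>"
    have "(\<lambda>n. (1/2::real)^n * norm e) \<longlonglongrightarrow> 0"
      using tendsto_mult_right[OF lim0] by simp
    then obtain N where "(1/2::real)^N * norm e < \<epsilon>"
      using order_tendstoD(2)[OF _ \<open>0 < \<epsilon>\<close>] eventually_sequentially by (metis order_refl)
    then show "\<exists>M. \<forall>m\<ge>M. \<forall>n\<ge>M. norm (s m - s n) < \<epsilon>"
      using s_dist by (meson order_le_less_trans)
  qed
  then obtain l where l: "s \<longlonglongrightarrow> l"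
    using Cauchy_convergent convergent_def by blast
  have "(\<lambda>n. s n + (1/2)^n *\<^sub>R e) \<longlonglongrightarrow> l + 0 *\<^sub>R e"
    by (intro tendsto_intros l lim0)
  then have "v p \<le> l" if "p \<in> C" for p
    using le_limit[OF tendsto_const _ s_upper[OF that]] by simp
  moreover have "l \<le> b" if "\<forall>p\<in>C. v p \<le> b" for b
    using le_limit[OF l tendsto_const s_least] that by blast
  ultimately show ?thesis
    unfolding v_def by blast
qed


section \<open>Complex Banach lattices\<close>

text \<open>
  A complex Banach lattice is the complexification of a real Banach lattice, with
  modulus \<open>|x + iy| = sup {cos \<theta> x + sin \<theta> y | \<theta>}\<close> and norm \<open>\<parallel>z\<parallel> = \<parallel>|z|\<parallel>\<close>.
  A complex AL-space is the complexification of a real AL-space.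
\<close>

datatype 'a complexification = Complexify (re_part: 'a) (im_part: 'a)

definition modulus :: "'a::banach_lattice complexification \<Rightarrow> 'a" where
  "modulus z = (THE m.
     (\<forall>\<theta>. cos \<theta> *\<^sub>R re_part z + sin \<theta> *\<^sub>R im_part z \<le> m) \<and>
     (\<forall>b. (\<forall>\<theta>. cos \<theta> *\<^sub>R re_part z + sin \<theta> *\<^sub>R im_part z \<le> b) \<longrightarrow> m \<le> b))"

lemma modulus_ex1:
  fixes x y :: "'a::banach_lattice"
  shows "\<exists>!m. (\<forall>\<theta>. cos \<theta> *\<^sub>R x + sin \<theta> *\<^sub>R y \<le> m) \<and>
     (\<forall>b. (\<forall>\<theta>. cos \<theta> *\<^sub>R x + sin \<theta> *\<^sub>R y \<le> b) \<longrightarrow> m \<le> b)"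
proof -
  have sph: "(\<forall>p\<in>sphere (0::real \<times> real) 1. fst p *\<^sub>R x + snd p *\<^sub>R y \<le> b) \<longleftrightarrow>
      (\<forall>\<theta>. cos \<theta> *\<^sub>R x + sin \<theta> *\<^sub>R y \<le> b)" for b
  proof safe
    fix \<theta> :: real
    assume *: "\<forall>p\<in>sphere (0::real \<times> real) 1. fst p *\<^sub>R x + snd p *\<^sub>R y \<le> b"
    have "(cos \<theta>, sin \<theta>) \<in> sphere (0::real \<times> real) 1"
      by (simp add: norm_Pair dist_norm)
    with * show "cos \<theta> *\<^sub>R x + sin \<theta> *\<^sub>R y \<le> b"
      by (metis fst_conv snd_conv)
  next
    fix c d :: real
    assume *: "\<forall>\<theta>. cos \<theta> *\<^sub>R x + sin \<theta> *\<^sub>R y \<le> b" and "(c, d) \<in> sphere 0 1"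
    then have "c\<^sup>2 + d\<^sup>2 = 1"
      by (simp add: norm_Pair dist_norm)
    then obtain \<theta> where "c = cos \<theta>" "d = sin \<theta>"
      using sincos_total_2pi by blast
    with * show "fst (c, d) *\<^sub>R x + snd (c, d) *\<^sub>R y \<le> b"
      by simp
  qed
  have "(1, 0) \<in> sphere (0::real \<times> real) 1"
    by (simp add: norm_Pair dist_norm)
  then have "sphere (0::real \<times> real) 1 \<noteq> {}"
    by blast
  from lub_compact_combination[OF compact_sphere this, of x y]
  show ?thesis
    unfolding sph by (blast intro: order_antisym)
qed

lemma modulus_upper: "cos \<theta> *\<^sub>R re_part z + sin \<theta> *\<^sub>R im_part z \<le> modulus z"
  and modulus_least: "(\<And>\<theta>. cos \<theta> *\<^sub>R re_part z + sin \<theta> *\<^sub>R im_part z \<le> b) \<Longrightarrow> modulus z \<le> b"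
  using theI'[OF modulus_ex1[of "re_part z" "im_part z"]] unfolding modulus_def by blast+

lemma abs_re_le_modulus: "\<bar>re_part z\<bar> \<le> modulus z"
  using modulus_upper[of 0 z] modulus_upper[of pi z] by (simp add: abs_leI)

lemma abs_im_le_modulus: "\<bar>im_part z\<bar> \<le> modulus z"
  using modulus_upper[of "pi/2" z] modulus_upper[of "- (pi/2)" z] by (simp add: abs_leI)

lemma modulus_nonneg [simp]: "0 \<le> modulus z"
  using abs_re_le_modulus[of z] abs_ge_zero order_trans by blast

instantiation complexification :: (banach_lattice) real_vector
begin

definition "0 = Complexify 0 0"
definition "z + w = Complexify (re_part z + re_part w) (im_part z + im_part w)"
definition "- z = Complexify (- re_part z) (- im_part z)"
definition "z - w = Complexify (re_part z - re_part w) (im_part z - im_part w)"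
definition "r *\<^sub>R z = Complexify (r *\<^sub>R re_part z) (r *\<^sub>R im_part z)"

lemmas complexification_ops =
  zero_complexification_def plus_complexification_def uminus_complexification_def
  minus_complexification_def scaleR_complexification_def

instance
proof
  fix z w u :: "'a complexification" and r s :: real
  show "z + w + u = z + (w + u)" "z + w = w + z" "0 + z = z" "- z + z = 0" "z - w = z + - w"
    "r *\<^sub>R (z + w) = r *\<^sub>R z + r *\<^sub>R w" "(r + s) *\<^sub>R z = r *\<^sub>R z + s *\<^sub>R z"
    "r *\<^sub>R s *\<^sub>R z = (r * s) *\<^sub>R z" "1 *\<^sub>R z = z"
    by (simp_all add: complexification_ops algebra_simps)
qed

end

lemma modulus_scale_le:
  fixes z :: "'a::banach_lattice complexification"
  shows "modulus (r *\<^sub>R z) \<le> \<bar>r\<bar> *\<^sub>R modulus z"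
proof (rule modulus_least)
  fix \<theta>
  have *: "cos \<theta> *\<^sub>R re_part (r *\<^sub>R z) + sin \<theta> *\<^sub>R im_part (r *\<^sub>R z) =
      r *\<^sub>R (cos \<theta> *\<^sub>R re_part z + sin \<theta> *\<^sub>R im_part z)"
    by (simp add: complexification_ops algebra_simps)
  show "cos \<theta> *\<^sub>R re_part (r *\<^sub>R z) + sin \<theta> *\<^sub>R im_part (r *\<^sub>R z) \<le> \<bar>r\<bar> *\<^sub>R modulus z"
  proof (cases "0 \<le> r")
    case True
    then show ?thesis
      unfolding * using modulus_upper[of \<theta> z] by (simp add: scaleR_left_mono)
  next
    case False
    then have "(- r) *\<^sub>R (cos (\<theta> + pi) *\<^sub>R re_part z + sin (\<theta> + pi) *\<^sub>R im_part z) \<le> (- r) *\<^sub>R modulus z"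
      by (intro scaleR_left_mono modulus_upper) simp
    with False show ?thesis
      unfolding * by (simp add: algebra_simps)
  qed
qed

instantiation complexification :: (banach_lattice) real_normed_vector
begin

definition "norm z = norm (modulus z)"
definition "sgn z = inverse (norm z) *\<^sub>R (z :: 'a complexification)"
definition "dist z w = norm (z - w :: 'a complexification)"
definition "(uniformity :: ('a complexification \<times> 'a complexification) filter) =
  (INF e\<in>{0 <..}. principal {(x, y). dist x y < e})"
definition "open (U :: 'a complexification set) \<longleftrightarrow>
  (\<forall>x\<in>U. eventually (\<lambda>(x', y). x' = x \<longrightarrow> y \<in> U) uniformity)"

instance
proof
  fix z w u :: "'a complexification" and r s :: real
  show "dist z w = norm (z - w)" "sgn z = inverse (norm z) *\<^sub>R z"
    by (simp_all add: dist_complexification_def sgn_complexification_def)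
  show "(uniformity :: ('a complexification \<times> 'a complexification) filter) =
      (INF e\<in>{0 <..}. principal {(x, y). dist x y < e})"
    by (rule uniformity_complexification_def)
  show "open U \<longleftrightarrow> (\<forall>x\<in>U. \<forall>\<^sub>F (x', y) in uniformity. x' = x \<longrightarrow> y \<in> U)"
    for U :: "'a complexification set"
    by (rule open_complexification_def)
  show "norm z = 0 \<longleftrightarrow> z = 0"
  proof
    assume "norm z = 0"
    then have "modulus z = 0"
      by (simp add: norm_complexification_def)
    then have "re_part z = 0" "im_part z = 0"
      using abs_re_le_modulus[of z] abs_im_le_modulus[of z] by auto
    then show "z = 0"
      by (simp add: complexification_ops complexification.expand)
  next
    assume "z = 0"
    then have "modulus z \<le> 0"
      by (intro modulus_least) (simp add: complexification_ops)
    then show "norm z = 0"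
      using modulus_nonneg[of z] by (simp add: norm_complexification_def)
  qed
  have "modulus (z + w) \<le> modulus z + modulus w"
  proof (rule modulus_least)
    fix \<theta>
    show "cos \<theta> *\<^sub>R re_part (z + w) + sin \<theta> *\<^sub>R im_part (z + w) \<le> modulus z + modulus w"
      using add_mono[OF modulus_upper[of \<theta> z] modulus_upper[of \<theta> w]]
      by (simp add: complexification_ops algebra_simps)
  qed
  then have "norm (modulus (z + w)) \<le> norm (modulus z + modulus w)"
    by (intro norm_pos_mono) auto
  also have "\<dots> \<le> norm (modulus z) + norm (modulus w)"
    by (rule norm_triangle_ineq)
  finally show "norm (z + w) \<le> norm z + norm w"
    by (simp add: norm_complexification_def)
  have le: "norm (a *\<^sub>R v) \<le> \<bar>a\<bar> * norm v" for a and v :: "'a complexification"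
    using norm_pos_mono[OF modulus_nonneg modulus_scale_le[of a v]]
    by (simp add: norm_complexification_def)
  show "norm (r *\<^sub>R z) = \<bar>r\<bar> * norm z"
  proof (cases "r = 0")
    case True
    then show ?thesis
      using le[of 0 z] by (simp add: norm_complexification_def)
  next
    case False
    have "inverse r *\<^sub>R r *\<^sub>R z = z"
      using False by (simp add: complexification_ops)
    then have "norm z \<le> \<bar>inverse r\<bar> * norm (r *\<^sub>R z)"
      using le[of "inverse r" "r *\<^sub>R z"] by simp
    then have "\<bar>r\<bar> * norm z \<le> norm (r *\<^sub>R z)"
      using False by (simp add: field_simps)
    with le[of r z] show ?thesis
      by simp
  qed
qed

end

definition cscale :: "complex \<Rightarrow> 'a::banach_lattice complexification \<Rightarrow> 'a complexification" where
  "cscale c z = Complexify (Re c *\<^sub>R re_part z - Im c *\<^sub>R im_part z)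
                           (Re c *\<^sub>R im_part z + Im c *\<^sub>R re_part z)"

lemma vector_space_cscale: "vector_space cscale"
  by unfold_locales (simp_all add: cscale_def complexification_ops algebra_simps)

lemma cscale_of_real: "cscale (of_real r) z = r *\<^sub>R z"
  by (simp add: cscale_def complexification_ops)

lemma norm_cscale: "norm (cscale c z) = cmod c * norm z"
proof -
  have le: "norm (cscale c z) \<le> cmod c * norm z" for c and z :: "'a complexification"
  proof -
    obtain \<phi> where \<phi>: "Re c = cmod c * cos \<phi>" "Im c = cmod c * sin \<phi>"
      by (metis Re_rcis Im_rcis rcis_cmod_Arg)
    have "modulus (cscale c z) \<le> cmod c *\<^sub>R modulus z"
    proof (rule modulus_least)
      fix \<theta>
      have "cos \<theta> *\<^sub>R re_part (cscale c z) + sin \<theta> *\<^sub>R im_part (cscale c z) =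
          cmod c *\<^sub>R (cos (\<theta> - \<phi>) *\<^sub>R re_part z + sin (\<theta> - \<phi>) *\<^sub>R im_part z)"
        by (simp add: cscale_def \<phi> cos_diff sin_diff algebra_simps)
      also have "\<dots> \<le> cmod c *\<^sub>R modulus z"
        by (intro scaleR_left_mono modulus_upper) simp
      finally show "cos \<theta> *\<^sub>R re_part (cscale c z) + sin \<theta> *\<^sub>R im_part (cscale c z) \<le> cmod c *\<^sub>R modulus z" .
    qed
    from norm_pos_mono[OF modulus_nonneg this] show ?thesis
      by (simp add: norm_complexification_def)
  qed
  interpret vector_space cscale
    by (rule vector_space_cscale)
  show ?thesis
  proof (cases "c = 0")
    case False
    have "norm z \<le> cmod (inverse c) * norm (cscale c z)"
      using le[of "inverse c" "cscale c z"] False by simp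
    then have "cmod c * norm z \<le> cmod c * (cmod (inverse c) * norm (cscale c z))"
      by (rule mult_left_mono) simp
    also have "\<dots> = cmod (c * inverse c) * norm (cscale c z)"
      by (simp only: norm_mult mult.assoc)
    also have "\<dots> = norm (cscale c z)"
      using False by simp
    finally have "cmod c * norm z \<le> norm (cscale c z)" .
    with le[of c z] show ?thesis
      by simp
  qed simp
qed


section \<open>The space of absolutely summable sequences\<close>

typedef (overloaded) 'k ell1 = "{f :: nat \<Rightarrow> 'k::real_normed_field. summable (\<lambda>n. norm (f n))}"
  morphisms ell1_nth Abs_ell1
  by (intro exI[of _ "\<lambda>_. 0"]) simp

lemma summable_norm_add:
  fixes f g :: "nat \<Rightarrow> 'k::real_normed_vector"
  assumes "summable (\<lambda>n. norm (f n))" "summable (\<lambda>n. norm (g n))"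
  shows "summable (\<lambda>n. norm (f n + g n))" "summable (\<lambda>n. norm (f n - g n))"
  by (rule summable_comparison_test'[OF summable_add[OF assms], where N = 0],
      simp add: norm_triangle_ineq norm_triangle_ineq4)+

setup_lifting type_definition_ell1

lift_definition ell1_scale :: "'k::real_normed_field \<Rightarrow> 'k ell1 \<Rightarrow> 'k ell1" is "\<lambda>c f n. c * f n"
  by (simp only: norm_mult) (rule summable_mult)

instantiation ell1 :: (real_normed_field) real_vector
begin

lift_definition zero_ell1 :: "'a ell1" is "\<lambda>_. 0"
  by simp
lift_definition plus_ell1 :: "'a ell1 \<Rightarrow> 'a ell1 \<Rightarrow> 'a ell1" is "\<lambda>f g n. f n + g n"
  by (rule summable_norm_add)
lift_definition uminus_ell1 :: "'a ell1 \<Rightarrow> 'a ell1" is "\<lambda>f n. - f n"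
  by simp
lift_definition minus_ell1 :: "'a ell1 \<Rightarrow> 'a ell1 \<Rightarrow> 'a ell1" is "\<lambda>f g n. f n - g n"
  by (rule summable_norm_add)
lift_definition scaleR_ell1 :: "real \<Rightarrow> 'a ell1 \<Rightarrow> 'a ell1" is "\<lambda>r f n. r *\<^sub>R f n"
  by (simp only: norm_scaleR) (rule summable_mult)

instance
proof
  fix f g h :: "'a ell1" and r s :: real
  show "f + g + h = f + (g + h)" "f + g = g + f" "0 + f = f" "- f + f = 0" "f - g = f + - g"
    "r *\<^sub>R (f + g) = r *\<^sub>R f + r *\<^sub>R g" "(r + s) *\<^sub>R f = r *\<^sub>R f + s *\<^sub>R f"
    "r *\<^sub>R s *\<^sub>R f = (r * s) *\<^sub>R f" "1 *\<^sub>R f = f"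
    by (transfer; simp add: fun_eq_iff algebra_simps)+
qed

end

instantiation ell1 :: (real_normed_field) real_normed_vector
begin

lift_definition norm_ell1 :: "'a ell1 \<Rightarrow> real" is "\<lambda>f. \<Sum>n. norm (f n)" .
definition "sgn f = inverse (norm f) *\<^sub>R (f :: 'a ell1)"
definition "dist f g = norm (f - g :: 'a ell1)"
definition "(uniformity :: ('a ell1 \<times> 'a ell1) filter) =
  (INF e\<in>{0 <..}. principal {(x, y). dist x y < e})"
definition "open (U :: 'a ell1 set) \<longleftrightarrow>
  (\<forall>x\<in>U. eventually (\<lambda>(x', y). x' = x \<longrightarrow> y \<in> U) uniformity)"

instance
proof
  fix f g h :: "'a ell1" and r s :: real
  show "dist f g = norm (f - g)" "sgn f = inverse (norm f) *\<^sub>R f"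
    by (simp_all add: dist_ell1_def sgn_ell1_def)
  show "(uniformity :: ('a ell1 \<times> 'a ell1) filter) =
      (INF e\<in>{0 <..}. principal {(x, y). dist x y < e})"
    by (rule uniformity_ell1_def)
  show "open U \<longleftrightarrow> (\<forall>x\<in>U. \<forall>\<^sub>F (x', y) in uniformity. x' = x \<longrightarrow> y \<in> U)" for U :: "'a ell1 set"
    by (rule open_ell1_def)
  show "norm f = 0 \<longleftrightarrow> f = 0"
    by transfer (simp add: suminf_eq_zero_iff fun_eq_iff)
  show "norm (r *\<^sub>R f) = \<bar>r\<bar> * norm f"
    by transfer (simp add: suminf_mult)
  show "norm (f + g) \<le> norm f + norm g"
  proof transfer
    fix f g :: "nat \<Rightarrow> 'a"
    assume s: "summable (\<lambda>n. norm (f n))" "summable (\<lambda>n. norm (g n))"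
    have "(\<Sum>n. norm (f n + g n)) \<le> (\<Sum>n. norm (f n) + norm (g n))"
      by (intro suminf_le summable_norm_add summable_add s norm_triangle_ineq)
    then show "(\<Sum>n. norm (f n + g n)) \<le> (\<Sum>n. norm (f n)) + (\<Sum>n. norm (g n))"
      by (simp add: suminf_add[OF s])
  qed
qed

end

lemma vector_space_ell1_scale: "vector_space ell1_scale"
  by unfold_locales (transfer; simp add: fun_eq_iff algebra_simps)+

lemma ell1_scale_of_real: "ell1_scale (of_real r) f = r *\<^sub>R f"
  by transfer (simp add: scaleR_conv_of_real)


section \<open>Operators\<close>

text \<open>
  The scalar field \<open>'k\<close> is the type of reals or of complex numbers. Since a type carries only
  its real scalar multiplication \<open>scaleR\<close> through the class system, the scalar multiplications
  \<open>sE\<close> and \<open>sF\<close> of domain and codomain are explicit arguments.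
\<close>

definition bounded_operator ::
  "('k::real_normed_field \<Rightarrow> 'e::real_normed_vector \<Rightarrow> 'e) \<Rightarrow>
   ('k \<Rightarrow> 'f::real_normed_vector \<Rightarrow> 'f) \<Rightarrow> ('e \<Rightarrow> 'f) \<Rightarrow> bool" where
  "bounded_operator sE sF T \<longleftrightarrow> Vector_Spaces.linear sE sF T \<and> bounded_linear T"

definition weak_topology ::
  "('k::real_normed_field \<Rightarrow> 'f::real_normed_vector \<Rightarrow> 'f) \<Rightarrow> 'f topology" where
  "weak_topology sF = topology_generated_by
     {\<phi> -` U | \<phi> U. bounded_operator sF (*) \<phi> \<and> open U}"

definition weakly_compact_operator ::
  "('k::real_normed_field \<Rightarrow> 'e::real_normed_vector \<Rightarrow> 'e) \<Rightarrow>
   ('k \<Rightarrow> 'f::real_normed_vector \<Rightarrow> 'f) \<Rightarrow> ('e \<Rightarrow> 'f) \<Rightarrow> bool" where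
  "weakly_compact_operator sE sF W \<longleftrightarrow> bounded_operator sE sF W \<and>
     compactin (weak_topology sF) (weak_topology sF closure_of (W ` cball 0 1))"

definition weak_essential_norm ::
  "('k::real_normed_field \<Rightarrow> 'e::real_normed_vector \<Rightarrow> 'e) \<Rightarrow>
   ('k \<Rightarrow> 'f::real_normed_vector \<Rightarrow> 'f) \<Rightarrow> ('e \<Rightarrow> 'f) \<Rightarrow> real" where
  "weak_essential_norm sE sF T =
     (INF W\<in>{W. weakly_compact_operator sE sF W}. onorm (\<lambda>x. T x - W x))"

definition ell1_factorization_values ::
  "('k::real_normed_field \<Rightarrow> 'e::real_normed_vector \<Rightarrow> 'e) \<Rightarrow>
   ('k \<Rightarrow> 'f::real_normed_vector \<Rightarrow> 'f) \<Rightarrow> ('e \<Rightarrow> 'f) \<Rightarrow> real set" where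
  "ell1_factorization_values sE sF T =
     {inverse (onorm U) * inverse (onorm V) | U V.
        bounded_operator sF (ell1_scale :: 'k \<Rightarrow> 'k ell1 \<Rightarrow> 'k ell1) U \<and>
        bounded_operator (ell1_scale :: 'k \<Rightarrow> 'k ell1 \<Rightarrow> 'k ell1) sE V \<and>
        U \<circ> T \<circ> V = id}"

text \<open>The supremum with the convention \<open>sup \<emptyset> = 0\<close>; \<open>Sup {}\<close> is unspecified on the reals.\<close>

definition sup0 :: "real set \<Rightarrow> real" where
  "sup0 A = (if A = {} then 0 else Sup A)"

end

theory Submission
  imports Defs
begin

text \<open>
  One inequality is short. If \<open>U T V = I\<close> and \<open>W\<close> is weakly compact, then the images under \<open>W\<close> of the
  normalized vectors \<open>V e\<^sub>n\<close> have a weak cluster point \<open>y\<close>. The tail of the sequence \<open>U y\<close> is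
  small, so the functional that sums the coordinates of \<open>U\<close> from a large \<open>N\<close> on almost annihilates
  \<open>W (V e\<^sub>n)\<close> for some \<open>n \<ge> N\<close>, while it takes the value \<open>1\<close> at \<open>T (V e\<^sub>n)\<close>. Hence
  \<open>1 \<le> \<parallel>U\<parallel> \<parallel>T - W\<parallel> \<parallel>V\<parallel>\<close> (\<open>factorization_value_le\<close>).

  For the converse fix \<open>c > 0\<close>. Either there is a positive \<open>g\<close> such that \<open>\<parallel>(|T x| - g)\<^sup>+\<parallel> \<le> c\<close> on
  the unit ball, or \<open>T\<close> escapes from every order interval at the level \<open>c\<close>.

  In the first case \<open>T\<close> is within \<open>c\<close> of a weakly compact operator (\<open>truncated_operator\<close>). The
  identity of an AL-space is a pointwise limit of positive contractions of finite rank,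
  \<open>Q x = \<Sum> \<xi>\<^sub>i(x) u\<^sub>i\<close> with \<open>\<parallel>u\<^sub>i\<parallel> \<le> 1\<close>, positive functionals \<open>\<xi>\<^sub>i\<close>, and \<open>\<Sum> \<xi>\<^sub>i(x)\<close> equal to \<open>\<parallel>x\<parallel>\<close> for
  positive \<open>x\<close>. If \<open>\<tau>\<^sub>i\<close> is \<open>T u\<^sub>i\<close> cut down in modulus to \<open>g\<close>, then the operator \<open>\<Sum> \<xi>\<^sub>i(x) \<tau>\<^sub>i\<close>
  maps the unit ball into an order interval and is within \<open>c\<close> of \<open>T Q\<close>. Order intervals of an AL-space are
  weakly compact (\<open>compactin_order_interval\<close>), so by Tychonoff's theorem these operators
  accumulate at an operator with the same two properties, and the first of them makes it weakly
  compact.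

  In the second case choose \<open>x\<^sub>n\<close> in the unit ball successively such that the part of \<open>|T x\<^sub>n|\<close>
  above a large multiple of the earlier \<open>|T x\<^sub>j|\<close> has norm greater than \<open>c\<close>. These parts can be
  made disjoint at an arbitrarily small cost (\<open>disjoint_sequence\<close>). The Hahn-Banach theorem on the
  bands that they generate gives functionals \<open>\<phi>\<^sub>n\<close> with \<open>\<Sum> |\<phi>\<^sub>n(y)| \<le> \<parallel>y\<parallel>\<close> and \<open>|\<phi>\<^sub>n(T x\<^sub>n)|\<close> almost
  \<open>c\<close>, and Rosenthal's lemma gives a subsequence on which the terms off the diagonal of the
  matrix \<open>\<phi>\<^sub>n(T x\<^sub>m)\<close> are negligible. Mapping \<open>e\<^sub>m\<close> to \<open>x\<^sub>m\<close> and \<open>y\<close> to the rescaled \<open>(\<phi>\<^sub>n(y))\<close>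
  composes with \<open>T\<close> to a small perturbation of the identity, which is inverted by Banach's fixed
  point theorem (\<open>factorization_of_biorthogonal_bound\<close>).

  The tool behind the lattice arguments is a replacement for measurable partitions: finite
  families of positive operators with sum \<open>I\<close>, built from band projections, on each of which
  finitely many given vectors are almost proportional to one positive vector
  (\<open>exists_localizing_partition\<close>). They turn statements about AL-spaces into statements about
  finite sums, and give the modulus of a complexification a concrete meaning, without a
  representation of the spaces by integrable functions.

  The scalar field enters only through the properties of the scalar multiplication collected
  in the locales \<open>scaled_space\<close>, \<open>hahn_banach_space\<close> and \<open>lattice_normed_space\<close>, which hold for
  AL-spaces over the reals and for their complexifications.
\<close>

section \<open>The norm functional and band projections\<close>

lemma pprt_minus_pprt_neg: "x = pprt x - pprt (- x)" for x :: "'a::lattice_ab_group_add"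
  using prts[of x] by (simp add: pprt_neg)

lemma inf_pprt_pprt_neg: "inf (pprt x) (pprt (- x)) = 0" for x :: "'a::lattice_ab_group_add"
proof -
  have "inf (pprt x) (pprt (- x)) = pprt (- x) + inf (pprt x - pprt (- x)) 0"
    by (simp add: add_inf_distrib_left)
  also have "\<dots> = pprt (- x) + nprt x"
    using pprt_minus_pprt_neg[of x] by (simp add: nprt_def)
  finally show ?thesis
    by (simp add: pprt_neg)
qed

lemma pprt_add_le: "pprt (a + b) \<le> pprt a + pprt b" for a :: "'a::lattice_ab_group_add"
  unfolding pprt_def by (intro sup_least add_mono add_nonneg_nonneg) auto

lemma pprt_diff_ge: "0 \<le> b \<Longrightarrow> pprt a - b \<le> pprt (a - b)" for a :: "'a::lattice_ab_group_add"
  using pprt_add_le[of "a - b" b] by (simp add: diff_le_eq)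

lemma scaleR_inf:
  fixes x y :: "'a::{ordered_real_vector,lattice}"
  assumes "0 < t"
  shows "t *\<^sub>R inf x y = inf (t *\<^sub>R x) (t *\<^sub>R y)"
proof (rule antisym)
  show "t *\<^sub>R inf x y \<le> inf (t *\<^sub>R x) (t *\<^sub>R y)"
    using assms by (simp add: scaleR_left_mono)
  have "inverse t *\<^sub>R inf (t *\<^sub>R x) (t *\<^sub>R y) \<le> inverse t *\<^sub>R t *\<^sub>R x"
    "inverse t *\<^sub>R inf (t *\<^sub>R x) (t *\<^sub>R y) \<le> inverse t *\<^sub>R t *\<^sub>R y"
    using assms by (intro scaleR_left_mono; simp)+
  then have "inverse t *\<^sub>R inf (t *\<^sub>R x) (t *\<^sub>R y) \<le> inf x y"
    using assms by simp
  then have "t *\<^sub>R inverse t *\<^sub>R inf (t *\<^sub>R x) (t *\<^sub>R y) \<le> t *\<^sub>R inf x y"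
    using assms by (intro scaleR_left_mono) auto
  then show "inf (t *\<^sub>R x) (t *\<^sub>R y) \<le> t *\<^sub>R inf x y"
    using assms by simp
qed

lemma inf_add_le:
  fixes x y z :: "'a::lattice_ab_group_add"
  assumes "0 \<le> x" "0 \<le> y" "0 \<le> z"
  shows "inf z (x + y) \<le> inf z x + inf z y"
proof -
  have "inf z (x + y) \<le> inf z x + y"
    by (simp add: add_inf_distrib_right le_infI1 le_infI2 assms add_increasing2)
  moreover have "inf z (x + y) \<le> inf z x + z"
    using assms by (simp add: le_infI1 add_increasing)
  ultimately show ?thesis
    by (simp add: add_inf_distrib_left)
qed

text \<open>
  The value at \<open>x\<close> is read off from \<open>x = x\<^sup>+ - x\<^sup>-\<close>; additivity makes it the same for every
  decomposition of \<open>x\<close> into a difference of positive elements, and linearity follows. The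
  norm functional and the band projections are obtained this way.
\<close>

lemma linear_cone_extension:
  fixes f :: "'a::banach_lattice \<Rightarrow> 'b::real_vector"
  assumes add: "\<And>x y. 0 \<le> x \<Longrightarrow> 0 \<le> y \<Longrightarrow> f (x + y) = f x + f y"
    and scale: "\<And>t x. 0 < t \<Longrightarrow> 0 \<le> x \<Longrightarrow> f (t *\<^sub>R x) = t *\<^sub>R f x"
  shows "linear (\<lambda>x. f (pprt x) - f (pprt (- x)))"
    and "0 \<le> x \<Longrightarrow> f (pprt x) - f (pprt (- x)) = f x"
proof -
  have f0: "f 0 = 0"
    using add[of 0 0] by simp
  have diff: "f (pprt x) - f (pprt (- x)) = f a - f b" if "x = a - b" "0 \<le> a" "0 \<le> b" for x a b
  proof -
    have "pprt x + b = a + pprt (- x)"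
      using pprt_minus_pprt_neg[of x] that(1) by (metis add.commute diff_add_eq diff_eq_eq)
    then have "f (pprt x) + f b = f a + f (pprt (- x))"
      using add that(2,3) by (metis zero_le_pprt)
    then show ?thesis
      by (simp add: algebra_simps)
  qed
  show "linear (\<lambda>x. f (pprt x) - f (pprt (- x)))"
  proof (rule linearI)
    fix x y :: 'a
    have "x + y = (pprt x + pprt y) - (pprt (- x) + pprt (- y))"
      using pprt_minus_pprt_neg[of x] pprt_minus_pprt_neg[of y]
      by (metis add_diff_add)
    from diff[OF this] show "f (pprt (x + y)) - f (pprt (- (x + y))) =
        f (pprt x) - f (pprt (- x)) + (f (pprt y) - f (pprt (- y)))"
      by (simp add: add)
  next
    fix r :: real and x :: 'a
    have x: "x = pprt x - pprt (- x)"
      by (rule pprt_minus_pprt_neg)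
    consider "r = 0" | "0 < r" | "r < 0"
      by linarith
    then show "f (pprt (r *\<^sub>R x)) - f (pprt (- (r *\<^sub>R x))) = r *\<^sub>R (f (pprt x) - f (pprt (- x)))"
    proof cases
      case 1
      then show ?thesis by simp
    next
      case 2
      have "r *\<^sub>R x = r *\<^sub>R pprt x - r *\<^sub>R pprt (- x)"
        by (metis x scaleR_right_diff_distrib)
      from diff[OF this] 2 show ?thesis
        by (simp add: scale scaleR_right_diff_distrib scaleR_nonneg_nonneg)
    next
      case 3
      have "r *\<^sub>R x = (- r) *\<^sub>R pprt (- x) - (- r) *\<^sub>R pprt x"
        using arg_cong[OF x, of "scaleR r"] by (simp add: scaleR_right_diff_distrib)
      from diff[OF this] 3 have "f (pprt (r *\<^sub>R x)) - f (pprt (- (r *\<^sub>R x))) =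
          (- r) *\<^sub>R f (pprt (- x)) - (- r) *\<^sub>R f (pprt x)"
        using scale[of "- r"] by (simp add: scaleR_nonpos_nonneg)
      then show ?thesis
        by (simp add: scaleR_right_diff_distrib)
    qed
  qed
  show "0 \<le> x \<Longrightarrow> f (pprt x) - f (pprt (- x)) = f x"
    using diff[of x x 0] by (simp add: f0)
qed

text \<open>
  The functional \<open>x \<mapsto> \<integral> x\<close> of an \<open>L\<^sub>1\<close>-space.
\<close>

definition norm_functional :: "'a::al_space \<Rightarrow> real" where
  "norm_functional x = norm (pprt x) - norm (pprt (- x))"

lemma linear_norm_functional: "linear (norm_functional :: 'a::al_space \<Rightarrow> real)"
  unfolding norm_functional_def
  by (rule linear_cone_extension(1)[of "norm :: 'a \<Rightarrow> real"]) (simp_all add: norm_add_pos)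

lemmas norm_functional_simps =
  linear_add[OF linear_norm_functional] linear_diff[OF linear_norm_functional]
  linear_neg[OF linear_norm_functional] linear_scale[OF linear_norm_functional]
  linear_0[OF linear_norm_functional]

lemma norm_functional_pos: "0 \<le> x \<Longrightarrow> norm_functional x = norm x"
  by (simp add: norm_functional_def)

lemma norm_functional_mono: "x \<le> y \<Longrightarrow> norm_functional x \<le> norm_functional y"
  using norm_functional_pos[of "y - x"] norm_ge_zero[of "y - x"]
  by (simp add: norm_functional_simps del: norm_ge_zero)

lemma norm_functional_abs: "\<bar>norm_functional x\<bar> \<le> norm_functional \<bar>x\<bar>"
  using norm_functional_mono[of x "\<bar>x\<bar>"] norm_functional_mono[of "- x" "\<bar>x\<bar>"]
  by (simp add: norm_functional_simps abs_ge_self abs_ge_minus_self abs_le_iff)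

lemma norm_functional_of_abs: "norm_functional \<bar>x\<bar> = norm x"
  by (simp add: norm_functional_pos norm_abs_lattice)

lemma norm_le_of_abs_le: "\<bar>x\<bar> \<le> y \<Longrightarrow> norm x \<le> norm_functional (y::'a::al_space)"
  using norm_functional_mono[of "\<bar>x\<bar>" y] by (simp add: norm_functional_of_abs)

text \<open>
  On the cone the norm is additive, so \<open>norm (x m - x n) = norm (x m) - norm (x n)\<close> along an
  increasing sequence: it is Cauchy because the increasing real sequence of norms is.
\<close>

lemma incseq_bounded_convergent:
  fixes X :: "nat \<Rightarrow> 'a::al_space"
  assumes "\<And>n. X n \<le> X (Suc n)" "\<And>n. 0 \<le> X n" "\<And>n. norm (X n) \<le> B"
  shows "convergent X"
proof -
  have mono: "X m \<le> X n" if "m \<le> n" for m n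
    using lift_Suc_mono_le[of X, OF assms(1) that] .
  have diff: "norm (X n - X m) = norm (X n) - norm (X m)" if "m \<le> n" for m n
    using norm_add_pos[of "X n - X m" "X m"] mono[OF that] assms(2)[of m] by simp
  have "incseq (\<lambda>n. norm (X n))"
    by (intro monoI norm_pos_mono mono assms(2))
  then have "convergent (\<lambda>n. norm (X n))"
    by (intro Bseq_mono_convergent BseqI'[of _ B]) (use assms(3) in \<open>auto simp: incseq_def\<close>)
  then have "Cauchy (\<lambda>n. norm (X n))"
    by (simp add: convergent_Cauchy)
  then have "Cauchy X"
    unfolding Cauchy_altdef2 dist_norm by (simp add: diff) (meson abs_ge_self le_less_trans)
  then show ?thesis
    by (simp add: Cauchy_convergent_iff)
qed

text \<open>
  The projection onto the band generated by a positive \<open>v\<close>, in an \<open>L\<^sub>1\<close>-space the restriction to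
  the set where \<open>v\<close> is positive: the increasing limit of \<open>x \<sqinter> n v\<close> for positive \<open>x\<close>, and by linear
  extension for all \<open>x\<close>.
\<close>

definition band_proj_pos :: "'a::al_space \<Rightarrow> 'a \<Rightarrow> 'a" where
  "band_proj_pos v x = lim (\<lambda>n. inf x (real n *\<^sub>R v))"

definition band_proj :: "'a::al_space \<Rightarrow> 'a \<Rightarrow> 'a" where
  "band_proj v x = band_proj_pos v (pprt x) - band_proj_pos v (pprt (- x))"

lemma band_proj_pos_tendsto:
  fixes v x :: "'a::al_space"
  assumes "0 \<le> v" "0 \<le> x"
  shows "(\<lambda>n. inf x (real n *\<^sub>R v)) \<longlonglongrightarrow> band_proj_pos v x"
proof -
  have "convergent (\<lambda>n. inf x (real n *\<^sub>R v))"
  proof (rule incseq_bounded_convergent)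
    fix n
    show "inf x (real n *\<^sub>R v) \<le> inf x (real (Suc n) *\<^sub>R v)"
      using assms by (intro inf_mono order_refl scaleR_right_mono) auto
    show "0 \<le> inf x (real n *\<^sub>R v)"
      using assms by (simp add: scaleR_nonneg_nonneg)
    then show "norm (inf x (real n *\<^sub>R v)) \<le> norm x"
      by (rule norm_pos_mono) simp
  qed
  then show ?thesis
    by (simp add: band_proj_pos_def convergent_LIMSEQ_iff)
qed

text \<open>
  Only integral multiples of \<open>v\<close> enter the definition; real ones are needed for homogeneity.
\<close>

lemma inf_le_band_proj_pos:
  assumes "0 \<le> v" "0 \<le> x"
  shows "inf x (t *\<^sub>R v) \<le> band_proj_pos v x"
proof -
  obtain N :: nat where N: "t \<le> real N"
    using real_arch_simple by blast
  have "inf x (t *\<^sub>R v) \<le> inf x (real (n + N) *\<^sub>R v)" for n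
    using N assms by (intro inf_mono order_refl scaleR_right_mono) auto
  from le_limit[OF tendsto_const LIMSEQ_ignore_initial_segment[OF band_proj_pos_tendsto[OF assms], of N] this]
  show ?thesis .
qed

lemma band_proj_pos_le:
  assumes "0 \<le> v" "0 \<le> x" "\<And>n. inf x (real n *\<^sub>R v) \<le> b"
  shows "band_proj_pos v x \<le> b"
  by (rule le_limit[OF band_proj_pos_tendsto[OF assms(1,2)] tendsto_const]) (rule assms(3))

lemma band_proj_pos_add:
  fixes v :: "'a::al_space"
  assumes v: "0 \<le> v" and xy: "0 \<le> x" "0 \<le> y"
  shows "band_proj_pos v (x + y) = band_proj_pos v x + band_proj_pos v y"
proof (rule antisym)
  show "band_proj_pos v (x + y) \<le> band_proj_pos v x + band_proj_pos v y"
  proof (rule band_proj_pos_le)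
    fix n
    have "inf (x + y) (real n *\<^sub>R v) \<le> inf x (real n *\<^sub>R v) + inf y (real n *\<^sub>R v)"
      using inf_add_le[OF xy, of "real n *\<^sub>R v"] v by (simp add: scaleR_nonneg_nonneg inf_commute)
    also have "\<dots> \<le> band_proj_pos v x + band_proj_pos v y"
      by (intro add_mono inf_le_band_proj_pos v xy)
    finally show "inf (x + y) (real n *\<^sub>R v) \<le> band_proj_pos v x + band_proj_pos v y" .
  qed (use v xy in auto)
  \<comment> \<open>The left side lies below \<open>2 n v\<close>, so doubling \<open>n\<close> on the right makes up for the loss.\<close>
  have "inf x (real n *\<^sub>R v) + inf y (real n *\<^sub>R v) \<le> band_proj_pos v (x + y)" for n
  proof -
    have "inf x (real n *\<^sub>R v) + inf y (real n *\<^sub>R v) \<le> inf (x + y) ((2 * real n) *\<^sub>R v)"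
      by (intro le_infI add_mono inf_le1 order_trans[OF add_mono[OF inf_le2 inf_le2]])
        (simp add: scaleR_2 flip: scaleR_scaleR)
    also have "\<dots> \<le> band_proj_pos v (x + y)"
      by (intro inf_le_band_proj_pos v add_nonneg_nonneg xy)
    finally show ?thesis .
  qed
  from le_limit[OF tendsto_add[OF band_proj_pos_tendsto[OF v xy(1)] band_proj_pos_tendsto[OF v xy(2)]] tendsto_const this]
  show "band_proj_pos v x + band_proj_pos v y \<le> band_proj_pos v (x + y)" .
qed

lemma band_proj_pos_scale:
  fixes v :: "'a::al_space"
  assumes v: "0 \<le> v" and "0 < t" "0 \<le> x"
  shows "band_proj_pos v (t *\<^sub>R x) = t *\<^sub>R band_proj_pos v x"
proof -
  have le: "band_proj_pos v (t *\<^sub>R x) \<le> t *\<^sub>R band_proj_pos v x" if "0 < t" "0 \<le> x" for t x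
  proof (rule band_proj_pos_le)
    fix n
    have "inf (t *\<^sub>R x) (real n *\<^sub>R v) = t *\<^sub>R inf x ((real n / t) *\<^sub>R v)"
      using \<open>0 < t\<close> by (simp add: scaleR_inf)
    also have "\<dots> \<le> t *\<^sub>R band_proj_pos v x"
      using that v by (intro scaleR_left_mono inf_le_band_proj_pos) auto
    finally show "inf (t *\<^sub>R x) (real n *\<^sub>R v) \<le> t *\<^sub>R band_proj_pos v x" .
  qed (use that v in \<open>auto simp: scaleR_nonneg_nonneg\<close>)
  have "band_proj_pos v (inverse t *\<^sub>R t *\<^sub>R x) \<le> inverse t *\<^sub>R band_proj_pos v (t *\<^sub>R x)"
    using assms by (intro le) (auto simp: scaleR_nonneg_nonneg)
  then have "t *\<^sub>R band_proj_pos v x \<le> t *\<^sub>R inverse t *\<^sub>R band_proj_pos v (t *\<^sub>R x)"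
    using assms by (intro scaleR_left_mono) auto
  then show ?thesis
    using le[OF assms(2,3)] assms by (intro antisym) auto
qed

lemma band_proj_cone:
  fixes v :: "'a::al_space"
  assumes "0 \<le> v" "0 \<le> x"
  shows "band_proj v x = band_proj_pos v x"
  unfolding band_proj_def
  by (rule linear_cone_extension(2)) (use assms band_proj_pos_add band_proj_pos_scale in auto)

lemma linear_band_proj: "0 \<le> v \<Longrightarrow> linear (band_proj (v::'a::al_space))"
  unfolding band_proj_def
  by (rule linear_cone_extension(1)) (use band_proj_pos_add band_proj_pos_scale in auto)

lemma band_proj_tendsto:
  "0 \<le> v \<Longrightarrow> 0 \<le> x \<Longrightarrow> (\<lambda>n. inf x (real n *\<^sub>R v)) \<longlonglongrightarrow> band_proj v x" for v :: "'a::al_space"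
  by (simp add: band_proj_cone band_proj_pos_tendsto)

lemma band_proj_nonneg: "0 \<le> v \<Longrightarrow> 0 \<le> x \<Longrightarrow> 0 \<le> band_proj v (x::'a::al_space)"
  using inf_le_band_proj_pos[of v x 0] by (simp add: band_proj_cone inf.absorb2)

lemma band_proj_le: "0 \<le> v \<Longrightarrow> 0 \<le> x \<Longrightarrow> band_proj v x \<le> (x::'a::al_space)"
  using band_proj_pos_le[of v x x] by (simp add: band_proj_cone)

lemma band_proj_self: "0 \<le> v \<Longrightarrow> band_proj v v = (v::'a::al_space)"
  using inf_le_band_proj_pos[of v v 1] band_proj_le[of v v]
  by (intro antisym) (simp_all add: band_proj_cone)

lemma band_proj_disjoint:
  fixes v w :: "'a::al_space"
  assumes "0 \<le> v" "0 \<le> w" "inf w v = 0"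
  shows "band_proj v w = 0"
proof -
  have "inf w (real n *\<^sub>R v) = 0" for n
  proof (induction n)
    case (Suc n)
    have "inf w (real (Suc n) *\<^sub>R v) = inf w (real n *\<^sub>R v + v)"
      by (simp add: algebra_simps)
    also have "\<dots> \<le> inf w (real n *\<^sub>R v) + inf w v"
      using assms by (intro inf_add_le) (auto simp: scaleR_nonneg_nonneg)
    finally have "inf w (real (Suc n) *\<^sub>R v) \<le> 0"
      using Suc assms by simp
    then show ?case
      using assms by (intro antisym le_infI scaleR_nonneg_nonneg) auto
  qed (use assms in \<open>simp add: inf.absorb2\<close>)
  then show ?thesis
    using band_proj_tendsto[OF assms(1,2)] LIMSEQ_unique[OF _ tendsto_const] by fastforce
qed

section \<open>Positive partitions of the identity\<close>

text \<open>
  A positive partition of the identity plays the role of a finite measurable partition \<open>(A\<^sub>i)\<close>, with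
  \<open>x \<mapsto> x 1\<^bsub>A\<^sub>i\<^esub>\<close> as its operators. The operators of a partition are allowed to depend on a piece
  of another one in \<open>refinement\<close>, since a piece is split according to vectors that are first
  localized to it.
\<close>

definition positive_map :: "('a::banach_lattice \<Rightarrow> 'a) \<Rightarrow> bool" where
  "positive_map P \<longleftrightarrow> linear P \<and> (\<forall>x\<ge>0. 0 \<le> P x)"

definition positive_partition :: "('a::banach_lattice \<Rightarrow> 'a) list \<Rightarrow> bool" where
  "positive_partition Ps \<longleftrightarrow> (\<forall>P\<in>set Ps. positive_map P) \<and> (\<forall>x. (\<Sum>P\<leftarrow>Ps. P x) = x)"

definition refinement :: "(('a \<Rightarrow> 'a) \<Rightarrow> ('a \<Rightarrow> 'a) list) \<Rightarrow> ('a \<Rightarrow> 'a) list \<Rightarrow> ('a \<Rightarrow> 'a) list" where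
  "refinement R Ps = concat (map (\<lambda>P. map (\<lambda>Q. Q \<circ> P) (R P)) Ps)"

definition sign_split :: "'a::al_space \<Rightarrow> ('a \<Rightarrow> 'a) list" where
  "sign_split w = [band_proj (pprt w), \<lambda>x. x - band_proj (pprt w) x]"

lemma positive_map_mono: "positive_map P \<Longrightarrow> x \<le> y \<Longrightarrow> P x \<le> P y"
  unfolding positive_map_def by (metis diff_ge_0_iff_ge linear_diff)

lemma positive_map_abs_le:
  assumes "positive_map P" "\<bar>x\<bar> \<le> y"
  shows "\<bar>P x\<bar> \<le> P y"
proof (rule abs_leI)
  show "P x \<le> P y"
    using assms by (meson positive_map_mono abs_le_D1)
  have "P (- x) \<le> P y"
    using assms by (meson positive_map_mono abs_le_D2)
  then show "- P x \<le> P y"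
    using assms(1) by (simp add: positive_map_def linear_neg)
qed

lemma sum_list_refinement: "(\<Sum>S\<leftarrow>refinement R Ps. f S) = (\<Sum>P\<leftarrow>Ps. \<Sum>Q\<leftarrow>R P. f (Q \<circ> P))"
  for f :: "_ \<Rightarrow> 'b::comm_monoid_add"
  by (induction Ps) (simp_all add: refinement_def o_def)

lemma positive_partition_refinement:
  assumes "positive_partition Ps" "\<And>P. positive_partition (R P)"
  shows "positive_partition (refinement R Ps)"
proof -
  have "positive_map (Q \<circ> P)" if "P \<in> set Ps" "Q \<in> set (R P)" for P Q
    using assms that unfolding positive_partition_def positive_map_def by (auto intro: linear_compose)
  moreover have "(\<Sum>S\<leftarrow>refinement R Ps. S x) = x" for x
    using assms unfolding sum_list_refinement positive_partition_def by simp
  ultimately show ?thesis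
    unfolding positive_partition_def by (auto simp: refinement_def)
qed

lemma positive_partition_sign_split: "positive_partition (sign_split w)"
proof -
  have "positive_map (band_proj (pprt w))"
    by (simp add: positive_map_def linear_band_proj band_proj_nonneg)
  moreover have "positive_map (\<lambda>x. x - band_proj (pprt w) x)"
    by (simp add: positive_map_def linear_band_proj band_proj_le linear_compose_sub linear_ident)
  ultimately show ?thesis
    by (simp add: positive_partition_def sign_split_def)
qed

text \<open>
  The band projection for \<open>w\<^sup>+\<close> fixes \<open>w\<^sup>+\<close> and kills \<open>w\<^sup>-\<close>, so it maps \<open>w\<close> to \<open>w\<^sup>+\<close> and its
  complement maps \<open>w\<close> to \<open>- w\<^sup>-\<close>.
\<close>

lemma sign_split_definite:
  assumes "Q \<in> set (sign_split w)"
  shows "0 \<le> Q w \<or> Q w \<le> 0"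
proof -
  have "band_proj (pprt w) w = band_proj (pprt w) (pprt w) - band_proj (pprt w) (pprt (- w))"
    by (metis linear_band_proj linear_diff pprt_minus_pprt_neg zero_le_pprt)
  also have "\<dots> = pprt w"
    using inf_pprt_pprt_neg[of w] by (simp add: band_proj_self band_proj_disjoint inf_commute)
  finally have eq: "band_proj (pprt w) w = pprt w" .
  then have "w - band_proj (pprt w) w = - pprt (- w)"
    using pprt_minus_pprt_neg[of w] by (simp add: algebra_simps)
  with eq show ?thesis
    using assms by (auto simp: sign_split_def)
qed

text \<open>
  Refining by one vector after the other is possible because a positive operator preserves the
  signs that have already been made definite.
\<close>

lemma exists_sign_partition:
  "\<exists>Ps. positive_partition Ps \<and> (\<forall>P\<in>set Ps. \<forall>w\<in>set ws. 0 \<le> P w \<or> P w \<le> (0::'a::al_space))"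
proof (induction ws)
  case Nil
  have "positive_partition [\<lambda>x::'a. x]"
    by (simp add: positive_partition_def positive_map_def linear_ident)
  then show ?case
    by auto
next
  case (Cons w ws)
  then obtain Ps where Ps: "positive_partition Ps"
      "\<forall>P\<in>set Ps. \<forall>v\<in>set ws. 0 \<le> P v \<or> P v \<le> 0"
    by blast
  let ?Rs = "refinement (\<lambda>P. sign_split (P w)) Ps"
  have "0 \<le> S v \<or> S v \<le> 0" if "S \<in> set ?Rs" "v \<in> set (w # ws)" for S v
  proof -
    obtain P Q where PQ: "P \<in> set Ps" "Q \<in> set (sign_split (P w))" "S = Q \<circ> P"
      using \<open>S \<in> set ?Rs\<close> by (auto simp: refinement_def)
    have "positive_map Q"
      using PQ(2) positive_partition_sign_split[of "P w"] by (simp add: positive_partition_def)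
    then have "0 \<le> Q u \<or> Q u \<le> 0" if "0 \<le> u \<or> u \<le> 0" for u
      using that positive_map_mono[of Q 0 u] positive_map_mono[of Q u 0]
      by (auto simp: positive_map_def linear_0)
    then show ?thesis
      using PQ sign_split_definite[OF PQ(2)] Ps(2) \<open>v \<in> set (w # ws)\<close> by auto
  qed
  then show ?case
    using positive_partition_refinement[OF Ps(1) positive_partition_sign_split]
    by (intro exI[of _ ?Rs] conjI ballI)
qed

text \<open>
  Freudenthal's spectral theorem in the form used here: on the pieces of a partition, finitely many
  vectors are almost multiples of \<open>e\<close>. It suffices to make the signs of \<open>x - t e\<close> definite for
  all \<open>t\<close> in a fine grid of \<open>[-1, 1]\<close>; on each piece the sign changes at one grid point, which is
  the coefficient.
\<close>

lemma exists_localizing_partition: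
  fixes e :: "'a::al_space"
  assumes A: "finite A" "\<And>x. x \<in> A \<Longrightarrow> \<bar>x\<bar> \<le> e" and "0 < \<eta>"
  obtains Ps a where "positive_partition Ps"
    "\<And>P x. P \<in> set Ps \<Longrightarrow> x \<in> A \<Longrightarrow> \<bar>P x - a P x *\<^sub>R P e\<bar> \<le> \<eta> *\<^sub>R P e"
proof -
  obtain N :: nat where N: "0 < N" "inverse (real N) \<le> \<eta>"
    using \<open>0 < \<eta>\<close> by (metis ex_inverse_of_nat_less less_eq_real_def)
  \<comment> \<open>The grid \<open>-1 = t 0 < \<dots> < t (2 N) = 1\<close> has mesh \<open>1 / N\<close>.\<close>
  define t where "t i = (real i - real N) / real N" for i :: nat
  have t_Suc: "t (Suc i) = t i + inverse (real N)" for i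
    using N by (simp add: t_def field_simps)
  have "finite ((\<lambda>(x, i). x - t i *\<^sub>R e) ` (A \<times> {..2*N}))"
    using A by auto
  then obtain ws where ws: "set ws = (\<lambda>(x, i). x - t i *\<^sub>R e) ` (A \<times> {..2*N})"
    using finite_list by blast
  obtain Ps where Ps: "positive_partition Ps"
      "\<And>P w. P \<in> set Ps \<Longrightarrow> w \<in> set ws \<Longrightarrow> 0 \<le> P w \<or> P w \<le> 0"
    using exists_sign_partition by metis
  have "\<exists>a. \<bar>P x - a *\<^sub>R P e\<bar> \<le> \<eta> *\<^sub>R P e" if P: "P \<in> set Ps" and x: "x \<in> A" for P x
  proof -
    have pos: "positive_map P" and lin: "linear P"
      using P Ps(1) by (auto simp: positive_partition_def positive_map_def)
    define f where "f i = P x - t i *\<^sub>R P e" for i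
    have f: "f i = P (x - t i *\<^sub>R e)" for i
      by (simp add: f_def linear_diff[OF lin] linear_scale[OF lin])
    have sgn: "0 \<le> f i \<or> f i \<le> 0" if "i \<le> 2 * N" for i
      unfolding f by (rule Ps(2)[OF P]) (use x that in \<open>force simp: ws\<close>)
    have e0: "0 \<le> e"
      using A(2)[OF x] abs_ge_zero order_trans by blast
    have xe: "x \<le> e" "- x \<le> e"
      using A(2)[OF x] by (auto dest: abs_le_D1 abs_le_D2)
    have "0 \<le> x - t 0 *\<^sub>R e" "x - t (2*N) *\<^sub>R e \<le> 0"
      using add_left_mono[OF xe(2), of x] xe(1) N by (simp_all add: t_def)
    then have f0: "0 \<le> f 0" "f (2*N) \<le> 0"
      unfolding f using positive_map_mono[OF pos, of 0] positive_map_mono[OF pos, of _ 0]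
      by (auto simp: linear_0[OF lin])
    have "\<exists>i<2*N. 0 \<le> f i \<and> f (Suc i) \<le> 0"
    proof (rule ccontr)
      assume "\<not> ?thesis"
      then have step: "i < 2*N \<Longrightarrow> 0 \<le> f i \<Longrightarrow> \<not> f (Suc i) \<le> 0" for i
        by blast
      have "0 \<le> f i" if "i \<le> 2*N" for i
        using that
      proof (induction i)
        case (Suc i)
        then show ?case
          using step[of i] sgn[of "Suc i"] by auto
      qed (rule f0)
      then have "0 \<le> f (2*N - 1)"
        by simp
      then show False
        using step[of "2*N - 1"] N f0(2) by simp
    qed
    then obtain i where i: "0 \<le> f i" "f (Suc i) \<le> 0"
      by blast
    have "f i \<le> inverse (real N) *\<^sub>R P e"
      using i(2) by (simp add: f_def t_Suc scaleR_left_distrib algebra_simps)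
    also have "\<dots> \<le> \<eta> *\<^sub>R P e"
      using N(2) pos e0 by (intro scaleR_right_mono) (auto simp: positive_map_def)
    finally have "\<bar>P x - t i *\<^sub>R P e\<bar> \<le> \<eta> *\<^sub>R P e"
      using i(1) by (simp add: f_def)
    then show ?thesis ..
  qed
  then have "\<bar>P x - (SOME a. \<bar>P x - a *\<^sub>R P e\<bar> \<le> \<eta> *\<^sub>R P e) *\<^sub>R P e\<bar> \<le> \<eta> *\<^sub>R P e"
    if "P \<in> set Ps" "x \<in> A" for P x
    using that by (intro someI_ex[where P = "\<lambda>a. \<bar>P x - a *\<^sub>R P e\<bar> \<le> \<eta> *\<^sub>R P e"])
  with Ps(1) show ?thesis
    by (rule that)
qed

lemma sum_list_norm_functional_partition:
  "positive_partition Ps \<Longrightarrow> (\<Sum>P\<leftarrow>Ps. norm_functional (P x)) = norm_functional x"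
proof -
  have "(\<Sum>P\<leftarrow>Ps. norm_functional (P x)) = norm_functional (\<Sum>P\<leftarrow>Ps. P x)"
    by (induction Ps) (simp_all add: norm_functional_simps)
  then show "positive_partition Ps \<Longrightarrow> (\<Sum>P\<leftarrow>Ps. norm_functional (P x)) = norm_functional x"
    by (simp add: positive_partition_def)
qed

lemma norm_sum_list_le: "norm (\<Sum>i\<leftarrow>xs. f i) \<le> (\<Sum>i\<leftarrow>xs. norm (f i))"
  for f :: "_ \<Rightarrow> 'b::real_normed_vector"
  by (induction xs) (auto intro: norm_triangle_le)

lemma norm_le_sum_list_partition:
  "positive_partition Ps \<Longrightarrow> norm x \<le> (\<Sum>P\<leftarrow>Ps. norm (P x))"
  using norm_sum_list_le[of "\<lambda>P. P x" Ps] by (simp add: positive_partition_def)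

section \<open>Order intervals are weakly compact\<close>

text \<open>
  In an \<open>L\<^sub>1\<close>-space the energy of \<open>y\<close> is \<open>\<integral> y\<^sup>2 / g\<close>, the square of an \<open>L\<^sub>2\<close>-norm of \<open>y / g\<close>. A partition
  approximates it from below by integrating \<open>y\<close> and \<open>g\<close> over its pieces. A term with vanishing
  denominator also has vanishing numerator when \<open>\<bar>y\<bar> \<le> g\<close>, in agreement with \<open>0 / 0 = 0\<close>.
\<close>

definition partition_energy :: "'a::al_space \<Rightarrow> ('a \<Rightarrow> 'a) list \<Rightarrow> 'a \<Rightarrow> real" where
  "partition_energy g Ps y = (\<Sum>P\<leftarrow>Ps. (norm_functional (P y))\<^sup>2 / norm_functional (P g))"

definition energy :: "'a::al_space \<Rightarrow> 'a \<Rightarrow> real" where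
  "energy g y = (SUP Ps\<in>{Ps. positive_partition Ps}. partition_energy g Ps y)"

text \<open>
  The Cauchy-Schwarz inequality for sums of fractions. The second conjunct lets the induction
  handle zero denominators.
\<close>

lemma sedrakyan_list:
  fixes a b :: "'i \<Rightarrow> real"
  assumes "\<And>i. i \<in> set xs \<Longrightarrow> \<bar>a i\<bar> \<le> b i"
  shows "(\<Sum>i\<leftarrow>xs. a i)\<^sup>2 / (\<Sum>i\<leftarrow>xs. b i) \<le> (\<Sum>i\<leftarrow>xs. (a i)\<^sup>2 / b i) \<and>
    \<bar>\<Sum>i\<leftarrow>xs. a i\<bar> \<le> (\<Sum>i\<leftarrow>xs. b i)"
  using assms
proof (induction xs)
  case (Cons i xs)
  have two: "(a + c)\<^sup>2 / (b + d) \<le> a\<^sup>2 / b + c\<^sup>2 / d" if "\<bar>a\<bar> \<le> b" "\<bar>c\<bar> \<le> d" for a b c d :: real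
  proof (cases "b = 0 \<or> d = 0")
    case True
    then show ?thesis
      using that by auto
  next
    case False
    then have "0 < b" "0 < d"
      using that by auto
    moreover have "2 * (a * d) * (c * b) \<le> (a * d)\<^sup>2 + (c * b)\<^sup>2"
      by (rule sum_squares_bound)
    ultimately show ?thesis
      by (simp add: divide_simps) (simp add: power2_eq_square algebra_simps)
  qed
  have IH: "(\<Sum>i\<leftarrow>xs. a i)\<^sup>2 / (\<Sum>i\<leftarrow>xs. b i) \<le> (\<Sum>i\<leftarrow>xs. (a i)\<^sup>2 / b i)"
    "\<bar>\<Sum>i\<leftarrow>xs. a i\<bar> \<le> (\<Sum>i\<leftarrow>xs. b i)" "\<bar>a i\<bar> \<le> b i"
    using Cons by auto
  show ?case
    using two[OF IH(3,2)] IH by simp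
qed auto

lemma positive_map_norm_functional_le:
  "positive_map P \<Longrightarrow> \<bar>y\<bar> \<le> g \<Longrightarrow> \<bar>norm_functional (P y)\<bar> \<le> norm_functional (P g)"
  using norm_functional_abs norm_functional_mono positive_map_abs_le order_trans by metis

lemma partition_energy_le:
  assumes "positive_partition Ps" "\<bar>y\<bar> \<le> g"
  shows "partition_energy g Ps y \<le> norm_functional g"
proof -
  have "partition_energy g Ps y \<le> (\<Sum>P\<leftarrow>Ps. norm_functional (P g))"
    unfolding partition_energy_def
  proof (rule sum_list_mono)
    fix P assume "P \<in> set Ps"
    then have *: "\<bar>norm_functional (P y)\<bar> \<le> norm_functional (P g)"
      using assms by (intro positive_map_norm_functional_le) (auto simp: positive_partition_def)
    then have "(norm_functional (P y))\<^sup>2 \<le> (norm_functional (P g))\<^sup>2"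
      by (simp add: abs_le_square_iff[symmetric])
    then show "(norm_functional (P y))\<^sup>2 / norm_functional (P g) \<le> norm_functional (P g)"
      using * by (cases "norm_functional (P g) = 0") (auto simp: divide_simps power2_eq_square)
  qed
  then show ?thesis
    using sum_list_norm_functional_partition[OF assms(1)] by simp
qed

lemma partition_energy_le_energy:
  assumes "positive_partition Ps" "\<bar>y\<bar> \<le> g"
  shows "partition_energy g Ps y \<le> energy g y"
  unfolding energy_def using assms partition_energy_le[OF _ assms(2)]
  by (intro cSUP_upper bdd_aboveI2[of _ _ "norm_functional g"]) auto

lemma energy_bounds:
  assumes "\<bar>y\<bar> \<le> g"
  shows "0 \<le> energy g y" "energy g y \<le> norm g"
proof -
  have id: "positive_partition [\<lambda>x::'a. x]"
    by (simp add: positive_partition_def positive_map_def linear_ident)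
  have g: "0 \<le> g"
    using assms abs_ge_zero order_trans by blast
  have "0 \<le> partition_energy g [\<lambda>x. x] y"
    using g by (simp add: partition_energy_def norm_functional_pos)
  then show "0 \<le> energy g y"
    using partition_energy_le_energy[OF id assms] by simp
  show "energy g y \<le> norm g"
    unfolding energy_def using id partition_energy_le[OF _ assms] g
    by (intro cSUP_least) (auto simp: norm_functional_pos)
qed

lemma partition_energy_refinement:
  assumes "positive_partition Ps" "\<And>P. positive_partition (R P)" "\<bar>y\<bar> \<le> g"
  shows "partition_energy g Ps y \<le> partition_energy g (refinement R Ps) y"
  unfolding partition_energy_def sum_list_refinement
proof (rule sum_list_mono)
  fix P assume P: "P \<in> set Ps"
  have "\<bar>norm_functional ((Q \<circ> P) y)\<bar> \<le> norm_functional ((Q \<circ> P) g)" if "Q \<in> set (R P)" for Q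
    using positive_map_norm_functional_le[of Q "P y" "P g"] assms P that positive_map_abs_le[of P y g]
    by (simp add: positive_partition_def)
  from sedrakyan_list[OF this, THEN conjunct1, of "R P" "\<lambda>Q. Q"]
  show "(norm_functional (P y))\<^sup>2 / norm_functional (P g) \<le>
      (\<Sum>Q\<leftarrow>R P. (norm_functional ((Q \<circ> P) y))\<^sup>2 / norm_functional ((Q \<circ> P) g))"
    using sum_list_norm_functional_partition[OF assms(2)] by simp
qed

text \<open>
  Uniform convexity of the energy. For a fixed partition the energy is a quadratic form and the
  parallelogram law holds. Choose a partition that is almost optimal for the midpoint and refine it
  so that the sign of \<open>x - y\<close> is definite on each piece: refinement only increases the
  energy, so it stays almost optimal for the midpoint, and by the Cauchy-Schwarz inequality the energy of
  \<open>x - y\<close> on the refined partition is at least \<open>\<parallel>x - y\<parallel>\<^sup>2 / \<parallel>g\<parallel>\<close>.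
\<close>

lemma energy_midpoint:
  fixes x y g :: "'a::al_space"
  assumes "\<bar>x\<bar> \<le> g" "\<bar>y\<bar> \<le> g"
  shows "(norm (x - y))\<^sup>2 \<le> 4 * norm g * ((energy g x + energy g y) / 2 - energy g ((1/2) *\<^sub>R (x + y)))"
proof -
  let ?m = "(1/2) *\<^sub>R (x + y)" and ?d = "(1/2) *\<^sub>R (x - y)"
  have half: "\<bar>(1/2) *\<^sub>R (u + v)\<bar> \<le> g" if "\<bar>u\<bar> \<le> g" "\<bar>v\<bar> \<le> g" for u v
  proof -
    have *: "(1/2) *\<^sub>R (u + v) \<le> (1/2) *\<^sub>R (g + g)" if "u \<le> g" "v \<le> g" for u v
      using that by (intro scaleR_left_mono add_mono) auto
    have gg: "(1/2) *\<^sub>R (g + g) = g"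
      by (simp flip: scaleR_2)
    show ?thesis
      using *[of u v] *[of "- u" "- v"] that unfolding gg
      by (intro abs_leI) (auto dest: abs_le_D1 abs_le_D2 simp: scaleR_right_distrib scaleR_right_diff_distrib)
  qed
  have m: "\<bar>?m\<bar> \<le> g" and d: "\<bar>?d\<bar> \<le> g"
    using half[OF assms] half[OF assms(1), of "- y"] assms(2) by auto
  have g: "0 \<le> g"
    using assms abs_ge_zero order_trans by blast
  have "(norm (x - y))\<^sup>2 / (4 * norm g) + energy g ?m - \<epsilon> \<le> (energy g x + energy g y) / 2"
    if "0 < \<epsilon>" for \<epsilon>
  proof -
    have ne: "{Ps. positive_partition (Ps :: ('a \<Rightarrow> 'a) list)} \<noteq> {}"
      using exists_sign_partition[of "[]"] by blast
    have bdd: "bdd_above ((\<lambda>Ps. partition_energy g Ps ?m) ` {Ps. positive_partition Ps})"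
      using partition_energy_le[OF _ m] by (intro bdd_aboveI2) blast
    have "energy g ?m - \<epsilon> < (SUP Ps\<in>{Ps. positive_partition Ps}. partition_energy g Ps ?m)"
      using \<open>0 < \<epsilon>\<close> by (simp add: energy_def)
    then obtain Ps where Ps: "positive_partition Ps" "energy g ?m - \<epsilon> < partition_energy g Ps ?m"
      unfolding less_cSUP_iff[OF ne bdd] by blast
    define Rs where "Rs = refinement (\<lambda>P. sign_split (P ?d)) Ps"
    have Rs: "positive_partition Rs"
      unfolding Rs_def by (intro positive_partition_refinement Ps(1) positive_partition_sign_split)
    have le_m: "energy g ?m - \<epsilon> < partition_energy g Rs ?m"
      using partition_energy_refinement[OF Ps(1) positive_partition_sign_split m] Ps(2)
      unfolding Rs_def by (rule less_le_trans[rotated])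
    have definite: "\<bar>norm_functional (S ?d)\<bar> = norm (S ?d)" if "S \<in> set Rs" for S
    proof -
      have "0 \<le> S ?d \<or> S ?d \<le> 0"
        using that sign_split_definite by (auto simp: Rs_def refinement_def dest!: sign_split_definite)
      then show ?thesis
        using norm_functional_pos[of "S ?d"] norm_functional_pos[of "- S ?d"]
        by (auto simp: norm_functional_simps) (metis abs_minus_cancel abs_norm_cancel)
    qed
    have "norm ?d \<le> (\<Sum>S\<leftarrow>Rs. norm (S ?d))"
      by (rule norm_le_sum_list_partition[OF Rs])
    also have "\<dots> = (\<Sum>S\<leftarrow>Rs. \<bar>norm_functional (S ?d)\<bar>)"
      using definite by (intro arg_cong[where f = sum_list] map_cong) auto
    finally have "(norm ?d)\<^sup>2 / norm g \<le> (\<Sum>S\<leftarrow>Rs. \<bar>norm_functional (S ?d)\<bar>)\<^sup>2 / norm g"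
      by (intro divide_right_mono power_mono) auto
    also have "\<dots> = (\<Sum>S\<leftarrow>Rs. \<bar>norm_functional (S ?d)\<bar>)\<^sup>2 / (\<Sum>S\<leftarrow>Rs. norm_functional (S g))"
      using sum_list_norm_functional_partition[OF Rs] g by (simp add: norm_functional_pos)
    also have "\<dots> \<le> partition_energy g Rs ?d"
    proof -
      have "\<bar>\<bar>norm_functional (S ?d)\<bar>\<bar> \<le> norm_functional (S g)" if "S \<in> set Rs" for S
        using that Rs positive_map_norm_functional_le[OF _ d, of S] by (auto simp: positive_partition_def)
      from sedrakyan_list[OF this, THEN conjunct1, of Rs "\<lambda>S. S"] show ?thesis
        by (simp add: partition_energy_def)
    qed
    finally have "(norm ?d)\<^sup>2 / norm g \<le> partition_energy g Rs ?d" .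
    moreover have "(norm ?d)\<^sup>2 / norm g = (norm (x - y))\<^sup>2 / (4 * norm g)"
      by (simp only: norm_scaleR) (simp add: power2_eq_square)
    ultimately have le_d: "(norm (x - y))\<^sup>2 / (4 * norm g) \<le> partition_energy g Rs ?d"
      by simp
    have "partition_energy g Ss ?m + partition_energy g Ss ?d =
        (partition_energy g Ss x + partition_energy g Ss y) / 2" if "\<forall>S\<in>set Ss. linear S" for Ss
      using that
    proof (induction Ss)
      case (Cons S Ss)
      then have lin: "linear S"
        by simp
      have "((a + b) / 2)\<^sup>2 / c + ((a - b) / 2)\<^sup>2 / c = (a\<^sup>2 / c + b\<^sup>2 / c) / 2" for a b c :: real
        by (cases "c = 0") (simp_all add: field_simps power2_eq_square)
      note parallelogram = this
      have cons: "partition_energy g (S # Ss) u =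
          (norm_functional (S u))\<^sup>2 / norm_functional (S g) + partition_energy g Ss u" for u
        by (simp add: partition_energy_def)
      from parallelogram[of "norm_functional (S x)" "norm_functional (S y)" "norm_functional (S g)"]
      have "(norm_functional (S ?m))\<^sup>2 / norm_functional (S g) + (norm_functional (S ?d))\<^sup>2 / norm_functional (S g) =
          ((norm_functional (S x))\<^sup>2 / norm_functional (S g) + (norm_functional (S y))\<^sup>2 / norm_functional (S g)) / 2"
        by (simp only: linear_scale[OF lin] linear_add[OF lin] linear_diff[OF lin] norm_functional_simps) simp
      moreover have "partition_energy g Ss ?m + partition_energy g Ss ?d =
          (partition_energy g Ss x + partition_energy g Ss y) / 2"
        using Cons by simp
      ultimately show ?case
        unfolding cons by argo
    qed (simp add: partition_energy_def)
    then have "partition_energy g Rs ?m + partition_energy g Rs ?d =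
        (partition_energy g Rs x + partition_energy g Rs y) / 2"
      using Rs by (simp add: positive_partition_def positive_map_def)
    then show ?thesis
      using le_m le_d partition_energy_le_energy[OF Rs assms(1)] partition_energy_le_energy[OF Rs assms(2)]
      by argo
  qed
  note approx = this
  have "(norm (x - y))\<^sup>2 / (4 * norm g) + energy g ?m \<le> (energy g x + energy g y) / 2"
  proof (rule field_le_epsilon)
    fix \<epsilon> :: real
    assume "0 < \<epsilon>"
    from approx[OF this] show "(norm (x - y))\<^sup>2 / (4 * norm g) + energy g ?m \<le> (energy g x + energy g y) / 2 + \<epsilon>"
      by argo
  qed
  then have le: "(norm (x - y))\<^sup>2 / (4 * norm g) \<le> (energy g x + energy g y) / 2 - energy g ?m"
    by argo
  show ?thesis
  proof (cases "norm g = 0")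
    case True
    then show ?thesis
      using assms by simp
  next
    case False
    then have "0 < 4 * norm g"
      by simp
    from le[unfolded pos_divide_le_eq[OF this]] show ?thesis
      by (simp only: mult.commute)
  qed
qed

lemma closed_order_interval: "closed {y::'a::banach_lattice. \<bar>y\<bar> \<le> g}"
proof (unfold closed_sequential_limits, intro allI impI)
  fix X and y :: 'a
  assume "(\<forall>n. X n \<in> {y. \<bar>y\<bar> \<le> g}) \<and> X \<longlonglongrightarrow> y"
  then have X: "X n \<le> g" "- X n \<le> g" "X \<longlonglongrightarrow> y" for n
    by (auto dest: abs_le_D1 abs_le_D2)
  show "y \<in> {y. \<bar>y\<bar> \<le> g}"
    using le_limit[OF X(3) tendsto_const X(1)] le_limit[OF tendsto_minus[OF X(3)] tendsto_const X(2)]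
    by (simp add: abs_leI)
qed

lemma convex_order_interval: "convex {y::'a::banach_lattice. \<bar>y\<bar> \<le> g}"
proof (rule convexI)
  fix x y :: 'a and u v :: real
  assume *: "x \<in> {y. \<bar>y\<bar> \<le> g}" "y \<in> {y. \<bar>y\<bar> \<le> g}" "0 \<le> u" "0 \<le> v" "u + v = 1"
  have le: "u *\<^sub>R a + v *\<^sub>R b \<le> g" if "a \<le> g" "b \<le> g" for a b
  proof -
    have "u *\<^sub>R a + v *\<^sub>R b \<le> u *\<^sub>R g + v *\<^sub>R g"
      using that * by (intro add_mono scaleR_left_mono) auto
    then show ?thesis
      using * by (simp flip: scaleR_left_distrib)
  qed
  show "u *\<^sub>R x + v *\<^sub>R y \<in> {y. \<bar>y\<bar> \<le> g}"
    using le[of x y] le[of "- x" "- y"] * abs_le_D1[of x g] abs_le_D1[of y g] abs_le_D2[of x g] abs_le_D2[of y g]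
    by (auto intro!: abs_leI)
qed

text \<open>
  The classical argument for minimizing a uniformly convex functional. Along finite subfamilies
  the minimal energy increases to a finite limit \<open>D\<close>; almost minimizers over a sequence of
  subfamilies that exhausts \<open>D\<close> form a Cauchy sequence, because their midpoints are not
  better than the minimum. Adding one more set to these subfamilies does not change the limit
  of the almost minimizers, so the limit lies in every set of the family.
\<close>

lemma order_interval_fip:
  fixes g :: "'a::al_space"
  defines "I \<equiv> {y. \<bar>y\<bar> \<le> g}"
  assumes cl: "\<And>C. C \<in> \<C> \<Longrightarrow> closed C" and cv: "\<And>C. C \<in> \<C> \<Longrightarrow> convex C"
    and fin: "\<And>\<D>. finite \<D> \<Longrightarrow> \<D> \<subseteq> \<C> \<Longrightarrow> I \<inter> \<Inter>\<D> \<noteq> {}"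
  shows "I \<inter> \<Inter>\<C> \<noteq> {}"
proof -
  define d where "d \<D> = (INF y\<in>I \<inter> \<Inter>\<D>. energy g y)" for \<D>
  let ?F = "{\<D>. finite \<D> \<and> \<D> \<subseteq> \<C>}"
  define D where "D = (SUP \<D>\<in>?F. d \<D>)"
  have d_le: "d \<D> \<le> energy g y" if "y \<in> I" "y \<in> \<Inter>\<D>" for y \<D>
    unfolding d_def using that energy_bounds(1)
    by (intro cINF_lower bdd_belowI2[of _ 0]) (auto simp: I_def)
  have bdd: "bdd_above (d ` ?F)"
  proof (rule bdd_aboveI2)
    fix \<D> assume "\<D> \<in> ?F"
    then obtain y where "y \<in> I" "y \<in> \<Inter>\<D>"
      using fin by blast
    then show "d \<D> \<le> norm g"
      using d_le energy_bounds(2) order_trans by (metis I_def mem_Collect_eq)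
  qed
  have d_mono: "d \<D> \<le> d \<D>'" if "\<D> \<subseteq> \<D>'" "\<D>' \<in> ?F" for \<D> \<D>'
    unfolding d_def using that fin energy_bounds(1)
    by (intro cINF_superset_mono bdd_belowI2[of _ 0]) (auto simp: I_def)
  define q where "q n = inverse (real (Suc n))" for n
  have q: "0 < q n" for n
    by (simp add: q_def)
  have "\<exists>\<D>\<in>?F. D - q n < d \<D>" for n
    using less_cSUP_iff[OF _ bdd, of "D - q n"] q[of n] by (force simp: D_def)
  then obtain \<D> where \<D>: "\<And>n. \<D> n \<in> ?F" "\<And>n. D - q n < d (\<D> n)"
    by metis
  define \<A> where "\<A> n = (\<Union>k\<le>n. \<D> k)" for n
  have \<A>: "\<A> n \<in> ?F" for n
    using \<D>(1) by (auto simp: \<A>_def)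
  have \<A>_mono: "\<A> m \<subseteq> \<A> n" if "m \<le> n" for m n
    using that by (force simp: \<A>_def)
  have D_le: "D - q n < d (\<A> n)" for n
    using \<D>(2)[of n] d_mono[of "\<D> n" "\<A> n"] \<A>[of n] by (fastforce simp: \<A>_def)
  have close: "norm (y - z) \<le> sqrt (8 * norm g * q n)"
    if "y \<in> I" "y \<in> \<Inter>(\<A> n)" "energy g y < D + q n" "z \<in> I" "z \<in> \<Inter>(\<A> n)" "energy g z < D + q n"
    for y z n
  proof -
    have "(1/2) *\<^sub>R (y + z) \<in> C" if "convex C" "y \<in> C" "z \<in> C" for C
      using convexD[OF that, of "1/2" "1/2"] by (simp add: scaleR_right_distrib)
    note mid_in = this
    have "(1/2) *\<^sub>R (y + z) \<in> I"
      using that(1,4) unfolding I_def by (rule mid_in[OF convex_order_interval])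
    moreover have "(1/2) *\<^sub>R (y + z) \<in> \<Inter>(\<A> n)"
      using that(2,5) cv \<A>[of n] by (intro InterI mid_in) auto
    ultimately have mid: "D - q n < energy g ((1/2) *\<^sub>R (y + z))"
      using d_le D_le[of n] by (meson less_le_trans)
    have "(norm (y - z))\<^sup>2 \<le> 4 * norm g * ((energy g y + energy g z) / 2 - energy g ((1/2) *\<^sub>R (y + z)))"
      using that by (intro energy_midpoint) (auto simp: I_def)
    also have "\<dots> \<le> 4 * norm g * (2 * q n)"
      using that mid by (intro mult_left_mono) (simp_all add: field_simps)
    finally have "(norm (y - z))\<^sup>2 \<le> 8 * norm g * q n"
      by simp
    then show ?thesis
      by (rule real_le_rsqrt)
  qed
  have select: "\<exists>y\<in>I \<inter> \<Inter>\<D>'. energy g y < D + q n" if "\<D>' \<in> ?F" for \<D>' n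
  proof -
    have "d \<D>' \<le> D"
      unfolding D_def by (rule cSUP_upper[OF that bdd])
    then have "(INF y\<in>I \<inter> \<Inter>\<D>'. energy g y) < D + q n"
      using q[of n] by (simp add: d_def)
    note lt = this
    have ne: "I \<inter> \<Inter>\<D>' \<noteq> {}"
      using fin that by blast
    have bb: "bdd_below (energy g ` (I \<inter> \<Inter>\<D>'))"
      using energy_bounds(1) by (intro bdd_belowI2[of _ 0]) (auto simp: I_def)
    from lt show ?thesis
      unfolding cINF_less_iff[OF ne bb] .
  qed
  have "\<exists>y\<in>I \<inter> \<Inter>(\<A> n). energy g y < D + q n" for n
    by (rule select) (rule \<A>)
  then obtain y where y: "\<And>n. y n \<in> I" "\<And>n. y n \<in> \<Inter>(\<A> n)" "\<And>n. energy g (y n) < D + q n"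
    by (metis IntD1 IntD2)
  have q_mono: "q m \<le> q n" if "n \<le> m" for m n
    using that by (simp add: q_def field_simps)
  have "q \<longlonglongrightarrow> 0"
    unfolding q_def by (rule LIMSEQ_inverse_real_of_nat)
  then have "(\<lambda>n. sqrt (8 * norm g * q n)) \<longlonglongrightarrow> sqrt (8 * norm g * 0)"
    by (intro tendsto_intros)
  then have lim: "(\<lambda>n. sqrt (8 * norm g * q n)) \<longlonglongrightarrow> 0"
    by simp
  have y_close: "norm (y m - y n) \<le> sqrt (8 * norm g * q n)" if "n \<le> m" for m n
    using that y(1,2,3)[of m] y(1,2,3)[of n] \<A>_mono[OF that] q_mono[OF that] by (intro close) auto
  have "Cauchy y"
    unfolding Cauchy_altdef2 dist_norm
  proof (intro allI impI)
    fix e :: real assume "0 < e"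
    then obtain N where "sqrt (8 * norm g * q N) < e"
      using order_tendstoD(2)[OF lim] eventually_sequentially by (metis order_refl)
    then show "\<exists>N. \<forall>n\<ge>N. norm (y n - y N) < e"
      using y_close by (meson order_le_less_trans)
  qed
  then obtain l where l: "y \<longlonglongrightarrow> l"
    using Cauchy_convergent convergent_def by blast
  have "l \<in> C" if "C \<in> \<C>" for C
  proof -
    have "insert C (\<A> n) \<in> ?F" for n
      using \<A>[of n] that by auto
    then have "\<exists>z\<in>I \<inter> \<Inter>(insert C (\<A> n)). energy g z < D + q n" for n
      by (rule select)
    then obtain z where z: "\<And>n. z n \<in> I \<inter> \<Inter>(insert C (\<A> n))" "\<And>n. energy g (z n) < D + q n"
      by metis
    have "norm (z n - y n) \<le> sqrt (8 * norm g * q n)" for n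
      using y(1,2,3)[of n] z[of n] by (intro close) auto
    then have "(\<lambda>n. z n - y n) \<longlonglongrightarrow> 0"
      by (intro Lim_null_comparison[OF _ lim]) simp
    from tendsto_add[OF this l] have "z \<longlonglongrightarrow> l"
      by simp
    moreover have "z n \<in> C" for n
      using z(1)[of n] by blast
    ultimately show ?thesis
      using cl[OF that] closed_sequential_limits by blast
  qed
  moreover have "l \<in> I"
    using closed_order_interval[of g] l y(1) unfolding I_def closed_sequential_limits by blast
  ultimately show ?thesis
    by blast
qed

lemma bounded_operator_real_functional:
  "bounded_operator scaleR (*) \<phi> \<longleftrightarrow> bounded_linear (\<phi> :: 'a::real_normed_vector \<Rightarrow> real)"
proof -
  have "((*) :: real \<Rightarrow> real \<Rightarrow> real) = scaleR"
    by (simp add: fun_eq_iff)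
  then show ?thesis
    using bounded_linear.linear unfolding bounded_operator_def linear_def by auto
qed

text \<open>
  By Alexander's subbase theorem a covering by open half-spaces is all that needs to be considered, and
  the complements of open half-spaces are closed half-spaces.
\<close>

lemma compactin_weak_topology_real:
  fixes K :: "'a::real_normed_vector set"
  assumes fip: "\<And>\<C>. (\<And>C. C \<in> \<C> \<Longrightarrow> \<exists>\<phi> a. bounded_linear \<phi> \<and> C = {y. \<phi> y \<le> (a::real)}) \<Longrightarrow>
      (\<And>\<D>. finite \<D> \<Longrightarrow> \<D> \<subseteq> \<C> \<Longrightarrow> K \<inter> \<Inter>\<D> \<noteq> {}) \<Longrightarrow> K \<inter> \<Inter>\<C> \<noteq> {}"
  shows "compactin (weak_topology scaleR) K"
proof -
  define \<B> where "\<B> = {{y. a < \<phi> y} | \<phi> a. bounded_linear (\<phi> :: 'a \<Rightarrow> real)}"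
  have halfspace: "{y. a < \<phi> y} \<in> \<B>" if "bounded_linear \<phi>" for \<phi> :: "'a \<Rightarrow> real" and a
    unfolding \<B>_def using that by (intro CollectI exI[of _ \<phi>] exI[of _ a] conjI refl)
  define X where "X = topology (arbitrary union_of (finite intersection_of (\<lambda>x. x \<in> \<B>) relative_to K))"
  have open_X: "openin X = arbitrary union_of (finite intersection_of (\<lambda>x. x \<in> \<B>) relative_to K)"
    unfolding X_def by (simp add: istopology_subbase)
  have "compact_space X"
  proof (rule Alexander_subbase_alt[of K \<B>])
    have "UNIV \<in> \<B>"
      using halfspace[OF bounded_linear_zero, of "- 1"] by simp
    then show "K \<subseteq> \<Union>\<B>"
      by auto
    fix \<C> assume \<C>: "\<C> \<subseteq> \<B>" "K \<subseteq> \<Union>\<C>"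
    show "\<exists>\<C>'. finite \<C>' \<and> \<C>' \<subseteq> \<C> \<and> K \<subseteq> \<Union>\<C>'"
    proof (rule ccontr)
      assume no: "\<not> ?thesis"
      have "K \<inter> \<Inter>(uminus ` \<C>) \<noteq> {}"
      proof (rule fip)
        fix C assume "C \<in> uminus ` \<C>"
        then obtain B where B: "B \<in> \<B>" "C = - B"
          using \<C>(1) by blast
        then obtain \<phi> a where "bounded_linear (\<phi> :: 'a \<Rightarrow> real)" "B = {y. a < \<phi> y}"
          unfolding \<B>_def by blast
        moreover from this B(2) have "C = {y. \<phi> y \<le> a}"
          by auto
        ultimately show "\<exists>\<phi> a. bounded_linear \<phi> \<and> C = {y. \<phi> y \<le> (a::real)}"
          by blast
      next
        fix \<D> assume "finite \<D>" "\<D> \<subseteq> uminus ` \<C>"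
        then obtain \<C>' where "finite \<C>'" "\<C>' \<subseteq> \<C>" "\<D> = uminus ` \<C>'"
          by (meson finite_subset_image)
        moreover have "\<not> K \<subseteq> \<Union>\<C>'"
          using no \<open>finite \<C>'\<close> \<open>\<C>' \<subseteq> \<C>\<close> by blast
        ultimately show "K \<inter> \<Inter>\<D> \<noteq> {}"
          by blast
      qed
      with \<C>(2) show False
        by blast
    qed
  qed (simp add: X_def)
  moreover have top: "topspace X = K"
  proof
    show "K \<subseteq> topspace X"
      using istopology_subbase openin_topspace[of X] unfolding X_def by (simp add: topspace_subbase)
    show "topspace X \<subseteq> K"
      unfolding X_def by (simp add: topspace_subbase)
  qed
  moreover have "continuous_map X (weak_topology scaleR) (\<lambda>x. x)"
    unfolding weak_topology_def
  proof (rule continuous_on_generated_topo)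
    fix V assume "V \<in> {\<phi> -` U | \<phi> U. bounded_operator scaleR (*) (\<phi> :: 'a \<Rightarrow> real) \<and> open U}"
    then obtain \<phi> U where V: "V = \<phi> -` U" "bounded_linear (\<phi> :: 'a \<Rightarrow> real)" "open U"
      by (auto simp: bounded_operator_real_functional)
    have half: "openin X (K \<inter> {y. a < \<psi> y})" if "bounded_linear \<psi>" for \<psi> :: "'a \<Rightarrow> real" and a
      unfolding open_X
    proof (intro union_of_inc arbitrary_union_of_inc relative_to_inc finite_intersection_of_inc)
      show "{y. a < \<psi> y} \<in> \<B>"
        using that by (rule halfspace)
    qed (simp add: arbitrary_def)
    show "openin X ((\<lambda>x. x) -` V \<inter> topspace X)"
    proof (subst openin_subopen, intro ballI)
      fix y assume y: "y \<in> (\<lambda>x. x) -` V \<inter> topspace X"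
      then obtain e where e: "0 < e" "ball (\<phi> y) e \<subseteq> U"
        using V open_contains_ball by (metis Int_iff vimage_eq)
      let ?W = "(K \<inter> {z. \<phi> y - e < \<phi> z}) \<inter> (K \<inter> {z. - \<phi> y - e < - \<phi> z})"
      have "openin X ?W"
        using V(2) by (intro openin_Int half bounded_linear_minus)
      moreover have "y \<in> ?W"
        using y e(1) top by auto
      moreover have "?W \<subseteq> (\<lambda>x. x) -` V \<inter> topspace X"
      proof
        fix z assume "z \<in> ?W"
        then have "\<bar>\<phi> y - \<phi> z\<bar> < e" "z \<in> K"
          by auto
        then show "z \<in> (\<lambda>x. x) -` V \<inter> topspace X"
          using e(2) V(1) top by (auto simp: dist_real_def)
      qed
      ultimately show "\<exists>T. openin X T \<and> y \<in> T \<and> T \<subseteq> (\<lambda>x. x) -` V \<inter> topspace X"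
        by blast
    qed
  next
    have "bounded_operator scaleR (*) (\<lambda>x::'a. 0::real)"
      by (simp add: bounded_operator_real_functional bounded_linear_zero)
    then have "(\<lambda>x::'a. 0::real) -` UNIV \<in> {\<phi> -` U | \<phi> U. bounded_operator scaleR (*) (\<phi> :: 'a \<Rightarrow> real) \<and> open U}"
      by (intro CollectI exI[of _ "\<lambda>x. 0"] exI[of _ UNIV] conjI refl open_UNIV)
    then show "(\<lambda>x. x) ` topspace X \<subseteq> \<Union> {\<phi> -` U | \<phi> U. bounded_operator scaleR (*) (\<phi> :: 'a \<Rightarrow> real) \<and> open U}"
      by auto
  qed
  ultimately show ?thesis
    using image_compactin[of X K "weak_topology scaleR" "\<lambda>x. x"] by (simp add: compact_space_def)
qed

lemma compactin_order_interval:
  "compactin (weak_topology scaleR) {y::'a::al_space. \<bar>y\<bar> \<le> g}"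
proof (rule compactin_weak_topology_real)
  fix \<C> :: "'a set set"
  assume half: "\<And>C. C \<in> \<C> \<Longrightarrow> \<exists>\<phi> a. bounded_linear \<phi> \<and> C = {y. \<phi> y \<le> (a::real)}"
    and fin: "\<And>\<D>. finite \<D> \<Longrightarrow> \<D> \<subseteq> \<C> \<Longrightarrow> {y. \<bar>y\<bar> \<le> g} \<inter> \<Inter>\<D> \<noteq> {}"
  show "{y. \<bar>y\<bar> \<le> g} \<inter> \<Inter>\<C> \<noteq> {}"
  proof (rule order_interval_fip)
    fix C assume "C \<in> \<C>"
    then obtain \<phi> and a :: real where \<phi>: "bounded_linear \<phi>" "C = {y. \<phi> y \<le> a}"
      using half by blast
    then show "closed C"
      by (simp add: closed_Collect_le bounded_linear.continuous_on[OF _ continuous_on_id])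
    show "convex C"
    proof (rule convexI)
      fix x y and u v :: real
      assume "x \<in> C" "y \<in> C" and uv: "0 \<le> u" "0 \<le> v" "u + v = 1"
      then have "u * \<phi> x + v * \<phi> y \<le> u * a + v * a"
        by (intro add_mono mult_left_mono) (auto simp: \<phi>(2))
      then show "u *\<^sub>R x + v *\<^sub>R y \<in> C"
        using uv \<phi> bounded_linear.linear[OF \<phi>(1)]
        by (simp add: linear_add linear_scale flip: distrib_right)
    qed
  qed (rule fin)
qed

section \<open>The Hahn-Banach theorem\<close>

definition sublinear :: "('a::real_vector \<Rightarrow> real) \<Rightarrow> bool" where
  "sublinear p \<longleftrightarrow> (\<forall>x y. p (x + y) \<le> p x + p y) \<and> (\<forall>t\<ge>0. \<forall>x. p (t *\<^sub>R x) = t * p x)"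

lemma sublinearI:
  assumes "\<And>x y. p (x + y) \<le> p x + p y" "\<And>t x. 0 < t \<Longrightarrow> p (t *\<^sub>R x) \<le> t * p x" "p 0 = 0"
  shows "sublinear p"
  unfolding sublinear_def
proof (intro conjI allI impI)
  fix t :: real and x
  assume "0 \<le> t"
  show "p (t *\<^sub>R x) = t * p x"
  proof (cases "t = 0")
    case False
    then have "0 < t"
      using \<open>0 \<le> t\<close> by simp
    have "p (inverse t *\<^sub>R t *\<^sub>R x) \<le> inverse t * p (t *\<^sub>R x)"
      using \<open>0 < t\<close> by (intro assms(2)) auto
    then have "t * p x \<le> p (t *\<^sub>R x)"
      using \<open>0 < t\<close> by (simp add: field_simps)
    with \<open>0 < t\<close> assms(2)[of t x] show ?thesis
      by simp
  qed (use assms in simp)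
qed (rule assms(1))

lemma sublinear_minus: "sublinear p \<Longrightarrow> - p (- x) \<le> p x"
proof -
  assume "sublinear p"
  then have "p (x + - x) \<le> p x + p (- x)" "p (0 *\<^sub>R x) = 0 * p x"
    unfolding sublinear_def by blast+
  then show ?thesis
    by simp
qed

text \<open>
  The infimum of \<open>p (x + t y) - t p(y)\<close> over \<open>t \<ge> 0\<close> lowers \<open>p\<close> to a sublinear function that
  is linear along \<open>y\<close>. It serves twice: for \<open>y = f\<close> it preserves the value at \<open>f\<close>, and it shows
  that a minimal sublinear function is linear.
\<close>

lemma sublinear_straighten:
  assumes p: "sublinear p"
  shows "\<exists>r. sublinear r \<and> (\<forall>x. r x \<le> p x) \<and> r (- y) \<le> - p y"
proof -
  have tri: "p (a + b) \<le> p a + p b" and hom: "0 \<le> t \<Longrightarrow> p (t *\<^sub>R a) = t * p a" for a b t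
    using p unfolding sublinear_def by blast+
  define r where "r x = (INF t\<in>{0..}. p (x + t *\<^sub>R y) - t * p y)" for x
  have bdd: "bdd_below ((\<lambda>t. p (x + t *\<^sub>R y) - t * p y) ` {0..})" for x
  proof (rule bdd_belowI2)
    fix t :: real assume "t \<in> {0..}"
    then show "- p (- x) \<le> p (x + t *\<^sub>R y) - t * p y"
      using tri[of "x + t *\<^sub>R y" "- x"] hom[of t y] by simp
  qed
  have le: "r x \<le> p (x + t *\<^sub>R y) - t * p y" if "0 \<le> t" for x t
    unfolding r_def using that by (intro cINF_lower bdd) auto
  have ge: "b \<le> r x" if "\<And>t. 0 \<le> t \<Longrightarrow> b \<le> p (x + t *\<^sub>R y) - t * p y" for x b
    unfolding r_def using that by (intro cINF_greatest) auto
  have "sublinear r"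
  proof (rule sublinearI)
    fix x z
    have "r (x + z) - (p (z + s *\<^sub>R y) - s * p y) \<le> r x" if "0 \<le> s" for s
    proof (rule ge)
      fix t :: real assume "0 \<le> t"
      have "r (x + z) \<le> p ((x + z) + (t + s) *\<^sub>R y) - (t + s) * p y"
        using \<open>0 \<le> s\<close> \<open>0 \<le> t\<close> by (intro le) simp
      moreover have "(x + z) + (t + s) *\<^sub>R y = (x + t *\<^sub>R y) + (z + s *\<^sub>R y)"
        by (simp add: scaleR_left_distrib)
      ultimately show "r (x + z) - (p (z + s *\<^sub>R y) - s * p y) \<le> p (x + t *\<^sub>R y) - t * p y"
        using tri[of "x + t *\<^sub>R y" "z + s *\<^sub>R y"] by (simp add: distrib_right)
    qed
    then have "r (x + z) - r x \<le> r z"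
      by (intro ge) (simp add: algebra_simps)
    then show "r (x + z) \<le> r x + r z"
      by simp
  next
    fix u :: real and x
    assume "0 < u"
    have "inverse u * r (u *\<^sub>R x) \<le> r x"
    proof (rule ge)
      fix t :: real assume "0 \<le> t"
      then have "r (u *\<^sub>R x) \<le> p (u *\<^sub>R x + (u * t) *\<^sub>R y) - (u * t) * p y"
        using \<open>0 < u\<close> by (intro le) simp
      also have "u *\<^sub>R x + (u * t) *\<^sub>R y = u *\<^sub>R (x + t *\<^sub>R y)"
        by (simp add: scaleR_right_distrib)
      finally have "r (u *\<^sub>R x) \<le> u * (p (x + t *\<^sub>R y) - t * p y)"
        using hom[of u "x + t *\<^sub>R y"] \<open>0 < u\<close> by (simp add: right_diff_distrib)
      then show "inverse u * r (u *\<^sub>R x) \<le> p (x + t *\<^sub>R y) - t * p y"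
        using \<open>0 < u\<close> by (simp add: field_simps)
    qed
    then show "r (u *\<^sub>R x) \<le> u * r x"
      using \<open>0 < u\<close> by (simp add: field_simps)
  next
    have "0 \<le> r 0"
      by (rule ge) (simp add: hom)
    moreover have "r 0 \<le> 0"
      using le[of 0 0] hom[of 0 0] by simp
    ultimately show "r 0 = 0"
      by simp
  qed
  moreover have "r x \<le> p x" for x
    using le[of 0 x] by simp
  moreover have "r (- y) \<le> - p y"
    using le[of 1 "- y"] hom[of 0 0] by simp
  ultimately show ?thesis
    by blast
qed

text \<open>
  Zorn's lemma applies because a sublinear function below \<open>p\<close> is bounded below at each \<open>x\<close>
  by \<open>- p (- x)\<close>, so chains have pointwise infima.
\<close>

lemma minimal_sublinear_exists:
  assumes p: "sublinear p"
  shows "\<exists>m. sublinear m \<and> (\<forall>x. m x \<le> p x) \<and>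
    (\<forall>r. sublinear r \<longrightarrow> (\<forall>x. r x \<le> m x) \<longrightarrow> r = m)"
proof -
  define A where "A = {r. sublinear r \<and> (\<forall>x. r x \<le> p x)}"
  define below where "below r r' \<longleftrightarrow> (\<forall>x. r' x \<le> r x)" for r r' :: "'a \<Rightarrow> real"
  have "\<exists>m\<in>A. \<forall>a\<in>A. below m a \<longrightarrow> a = m"
  proof (rule predicate_Zorn)
    show "partial_order_on A (relation_of below A)"
      by (rule partial_order_on_relation_ofI) (auto simp: below_def fun_eq_iff intro: order_trans antisym)
  next
    fix C assume C: "C \<in> Chains (relation_of below A)"
    have chain: "below a b \<or> below b a" if "a \<in> C" "b \<in> C" for a b
      using C that by (auto simp: Chains_def relation_of_def)
    show "\<exists>u\<in>A. \<forall>a\<in>C. below a u"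
    proof (cases "C = {}")
      case True
      then show ?thesis
        using p by (auto simp: A_def)
    next
      case False
      have CA: "r \<in> A" if "r \<in> C" for r
        using C that by (auto simp: Chains_def relation_of_def)
      have sub: "sublinear r" "r x \<le> p x" if "r \<in> C" for r x
        using CA[OF that] by (auto simp: A_def)
      have bdd: "bdd_below ((\<lambda>r. r x) ` C)" for x
      proof (rule bdd_belowI2)
        fix r assume "r \<in> C"
        then show "- p (- x) \<le> r x"
          using sublinear_minus[OF sub(1), of r x] sub(2)[of r "- x"] by linarith
      qed
      define u where "u x = (INF r\<in>C. r x)" for x
      have u_le: "u x \<le> r x" if "r \<in> C" for r x
        unfolding u_def using that by (intro cINF_lower bdd)
      have u_ge: "b \<le> u x" if "\<And>r. r \<in> C \<Longrightarrow> b \<le> r x" for b x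
        unfolding u_def using that False by (intro cINF_greatest)
      have "sublinear u"
      proof (rule sublinearI)
        fix x z
        have "u (x + z) \<le> r x + r' z" if "r \<in> C" "r' \<in> C" for r r'
        proof -
          have "\<exists>r0\<in>C. r0 x \<le> r x \<and> r0 z \<le> r' z"
            using chain[OF that] that by (auto simp: below_def)
          then obtain r0 where r0: "r0 \<in> C" "r0 x \<le> r x" "r0 z \<le> r' z"
            by blast
          have "u (x + z) \<le> r0 (x + z)"
            by (rule u_le[OF r0(1)])
          also have "\<dots> \<le> r0 x + r0 z"
            using sub(1)[OF r0(1)] by (simp add: sublinear_def)
          finally show ?thesis
            using r0 by simp
        qed
        then have "u (x + z) - r' z \<le> u x" if "r' \<in> C" for r'
          using that by (intro u_ge) (simp add: algebra_simps)
        then have "u (x + z) - u x \<le> u z"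
          by (intro u_ge) (simp add: algebra_simps)
        then show "u (x + z) \<le> u x + u z"
          by simp
      next
        fix t :: real and x
        assume "0 < t"
        have "inverse t * u (t *\<^sub>R x) \<le> u x"
        proof (rule u_ge)
          fix r assume r: "r \<in> C"
          then have "u (t *\<^sub>R x) \<le> t * r x"
            using u_le[OF r, of "t *\<^sub>R x"] sub(1)[OF r] \<open>0 < t\<close> by (simp add: sublinear_def)
          then show "inverse t * u (t *\<^sub>R x) \<le> r x"
            using \<open>0 < t\<close> by (simp add: field_simps)
        qed
        then show "u (t *\<^sub>R x) \<le> t * u x"
          using \<open>0 < t\<close> by (simp add: field_simps)
      next
        have "r 0 = 0" if "r \<in> C" for r
          using sub(1)[OF that] unfolding sublinear_def by (metis mult_zero_left order_refl scaleR_zero_left)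
        then show "u 0 = 0"
          using False cINF_const[of C "0::real"] INF_cong[of C C "\<lambda>r. r 0" "\<lambda>_. 0"] by (simp add: u_def)
      qed
      moreover have "u x \<le> p x" for x
        using False u_le sub(2) order_trans by (metis ex_in_conv)
      ultimately show ?thesis
        using u_le by (auto simp: A_def below_def)
    qed
  qed
  then obtain m where m: "m \<in> A" "\<And>a. a \<in> A \<Longrightarrow> below m a \<Longrightarrow> a = m"
    by blast
  have "r = m" if "sublinear r" "\<forall>x. r x \<le> m x" for r
  proof (rule m(2))
    have "r x \<le> p x" for x
      using that(2) m(1) order_trans unfolding A_def by blast
    then show "r \<in> A"
      using that(1) by (simp add: A_def)
    show "below m r"
      using that(2) by (simp add: below_def)
  qed
  then show ?thesis
    using m(1) unfolding A_def by (intro exI[of _ m]) simp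
qed

theorem hahn_banach_sublinear:
  assumes "sublinear p"
  shows "\<exists>\<phi>. linear \<phi> \<and> (\<forall>x. \<phi> x \<le> p x) \<and> \<phi> f = (p f :: real)"
proof -
  obtain r where r: "sublinear r" "\<And>x. r x \<le> p x" "r (- f) \<le> - p f"
    using sublinear_straighten[OF assms, of f] by blast
  obtain m where m: "sublinear m" "\<And>x. m x \<le> r x"
      "\<And>r. sublinear r \<Longrightarrow> (\<forall>x. r x \<le> m x) \<Longrightarrow> r = m"
    using minimal_sublinear_exists[OF r(1)] by blast
  have neg: "m (- y) = - m y" for y
  proof -
    obtain r' where r': "sublinear r'" "\<forall>x. r' x \<le> m x" "r' (- y) \<le> - m y"
      using sublinear_straighten[OF m(1), of y] by blast
    then have "r' = m"
      by (intro m(3))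
    with r'(3) sublinear_minus[OF m(1), of "- y"] show ?thesis
      by simp
  qed
  have add: "m (x + y) \<le> m x + m y" and hom: "0 \<le> t \<Longrightarrow> m (t *\<^sub>R x) = t * m x" for x y t
    using m(1) unfolding sublinear_def by blast+
  have "linear m"
  proof (rule linearI)
    show "m (x + y) = m x + m y" for x y
      using add[of x y] add[of "- x" "- y"] neg[of "x + y"] neg[of x] neg[of y] by simp
    show "m (t *\<^sub>R x) = t *\<^sub>R m x" for t x
      using hom[of t x] hom[of "- t" x] neg[of "t *\<^sub>R x"] by (cases "0 \<le> t") auto
  qed
  moreover have "m x \<le> p x" for x
    using m(2) r(2) order_trans by blast
  moreover have "m f = p f"
    using neg[of f] m(2)[of "- f"] r(3) \<open>m f \<le> p f\<close> by linarith
  ultimately show ?thesis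
    by blast
qed

section \<open>Scalar multiplications and weak topologies\<close>

text \<open>
  The second locale postulates the Hahn-Banach theorem for seminorms, which holds for real
  scalars and, by way of the real part of a functional, for complex ones.
\<close>

locale scaled_space =
  fixes s :: "'k::{real_normed_field,banach} \<Rightarrow> 'y::real_normed_vector \<Rightarrow> 'y"
  assumes vector_space: "vector_space s"
    and scale_of_real: "s (of_real r) y = r *\<^sub>R y"
    and norm_scale: "norm (s c y) = norm c * norm y"

locale hahn_banach_space = scaled_space s
  for s :: "'k::{real_normed_field,banach} \<Rightarrow> 'y::real_normed_vector \<Rightarrow> 'y" +
  assumes dominated_functional: "(\<And>x y. q (x + y) \<le> q x + q y) \<Longrightarrow> (\<And>c x. q (s c x) = norm c * q x) \<Longrightarrow>
    (\<And>x. q x \<le> norm x) \<Longrightarrow> \<exists>\<phi>. bounded_operator s (*) \<phi> \<and> (\<forall>x. norm (\<phi> x) \<le> q x) \<and> norm (\<phi> f) = q f"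

lemma scaled_space_mult: "scaled_space ((*) :: 'k::{real_normed_field,banach} \<Rightarrow> 'k \<Rightarrow> 'k)"
  by unfold_locales (simp_all add: algebra_simps norm_mult scaleR_conv_of_real)

lemma scaled_space_scaleR: "scaled_space (scaleR :: real \<Rightarrow> 'a::real_normed_vector \<Rightarrow> 'a)"
  by unfold_locales (simp_all add: algebra_simps)

lemma scaled_space_ell1: "scaled_space (ell1_scale :: 'k::{real_normed_field,banach} \<Rightarrow> 'k ell1 \<Rightarrow> 'k ell1)"
proof (rule scaled_space.intro)
  show "vector_space (ell1_scale :: 'k \<Rightarrow> 'k ell1 \<Rightarrow> 'k ell1)"
    by (rule vector_space_ell1_scale)
  show "norm (ell1_scale c f) = norm c * norm f" for c :: 'k and f
    by transfer (simp add: norm_mult suminf_mult)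
qed (rule ell1_scale_of_real)

lemma scaled_space_cscale: "scaled_space (cscale :: complex \<Rightarrow> 'a::banach_lattice complexification \<Rightarrow> _)"
  by (intro scaled_space.intro vector_space_cscale cscale_of_real norm_cscale)

lemma bounded_operatorI:
  assumes "scaled_space s" "scaled_space t"
    and add: "\<And>x y. f (x + y) = f x + f y" and scale: "\<And>c x. f (s c x) = t c (f x)"
    and bound: "\<And>x. norm (f x) \<le> K * norm x"
  shows "bounded_operator s t f"
  unfolding bounded_operator_def
proof
  interpret s: scaled_space s by fact
  interpret t: scaled_space t by fact
  show "Vector_Spaces.linear s t f"
    by (simp add: Vector_Spaces.linear_iff s.vector_space t.vector_space add scale)
  show "bounded_linear f"
  proof (rule bounded_linear_intro[of _ K])
    show "f (r *\<^sub>R x) = r *\<^sub>R f x" for r x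
      using scale[of "of_real r" x] by (simp add: s.scale_of_real t.scale_of_real)
    show "norm (f x) \<le> norm x * K" for x
      using bound[of x] by (simp add: mult.commute)
  qed (rule add)
qed

lemma bounded_operatorD:
  assumes "bounded_operator s t f"
  shows "f (x + y) = f x + f y" "f (x - y) = f x - f y" "f (s c x) = t c (f x)"
    "f 0 = 0" "bounded_linear f" "norm (f x) \<le> onorm f * norm x"
proof -
  show bl: "bounded_linear f"
    using assms by (simp add: bounded_operator_def)
  show "f (x + y) = f x + f y" "f (x - y) = f x - f y" "f 0 = 0" "norm (f x) \<le> onorm f * norm x"
    using bl by (simp_all add: linear_simps linear_0 bounded_linear.linear onorm)
  show "f (s c x) = t c (f x)"
    using assms by (simp add: bounded_operator_def Vector_Spaces.linear_iff)
qed

lemma bounded_operator_compose: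
  assumes "bounded_operator s t f" "bounded_operator t u g"
  shows "bounded_operator s u (g \<circ> f)"
  using assms bounded_linear_compose unfolding bounded_operator_def Vector_Spaces.linear_iff o_def by auto

lemma bounded_operator_diff:
  assumes "bounded_operator s t f" "bounded_operator s t g"
  shows "bounded_operator s t (\<lambda>x. f x - g x)"
  using assms bounded_linear_sub unfolding bounded_operator_def Vector_Spaces.linear_iff
  by (auto simp: module.scale_right_diff_distrib module_iff_vector_space)

context hahn_banach_space
begin

lemma norming_functional:
  "\<exists>\<phi>. bounded_operator s (*) \<phi> \<and> (\<forall>x. norm (\<phi> x) \<le> norm x) \<and> norm (\<phi> f) = norm f"
  by (rule dominated_functional) (simp_all add: norm_triangle_ineq norm_scale)

lemma zero_functional: "bounded_operator s (*) (\<lambda>_. 0)"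
  by (rule bounded_operatorI[where K = 0]) (simp_all add: scaled_space_axioms scaled_space_mult)

lemma topspace_weak_topology: "topspace (weak_topology s) = UNIV"
proof -
  have "(\<lambda>_::'y. 0::'k) -` UNIV \<in> {\<phi> -` U | \<phi> U. bounded_operator s (*) \<phi> \<and> open U}"
    by (intro CollectI exI[of _ "\<lambda>_::'y. 0::'k"] exI[of _ UNIV] conjI refl open_UNIV zero_functional)
  then show ?thesis
    unfolding weak_topology_def topology_generated_by_topspace by auto
qed

lemma continuous_map_functional:
  assumes "bounded_operator s (*) \<phi>"
  shows "continuous_map (weak_topology s) euclidean \<phi>"
proof (subst continuous_map_def, intro conjI allI impI)
  fix U :: "'k set" assume "openin euclidean U"
  then have "\<phi> -` U \<in> {\<phi> -` U | \<phi> U. bounded_operator s (*) \<phi> \<and> open U}"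
    using assms by (intro CollectI exI[of _ \<phi>] exI[of _ U] conjI refl) auto
  then have "openin (weak_topology s) (\<phi> -` U)"
    unfolding weak_topology_def by (rule topology_generated_by_Basis)
  then show "openin (weak_topology s) {x \<in> topspace (weak_topology s). \<phi> x \<in> U}"
    by (simp add: topspace_weak_topology vimage_def)
qed simp

lemma Hausdorff_weak_topology: "Hausdorff_space (weak_topology s)"
  unfolding Hausdorff_space_def
proof (intro allI impI, elim conjE)
  fix x y :: 'y assume "x \<noteq> y"
  obtain \<phi> where \<phi>: "bounded_operator s (*) \<phi>" "norm (\<phi> (x - y)) = norm (x - y)"
    using norming_functional by blast
  then have "\<phi> x \<noteq> \<phi> y"
    using \<open>x \<noteq> y\<close> by (auto simp: bounded_operatorD(2))
  then obtain U V where UV: "open U" "open V" "\<phi> x \<in> U" "\<phi> y \<in> V" "U \<inter> V = {}"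
    using hausdorff[OF \<open>\<phi> x \<noteq> \<phi> y\<close>] by blast
  have "openin (weak_topology s) {x \<in> topspace (weak_topology s). \<phi> x \<in> W}" if "open W" for W
    using continuous_map_functional[OF \<phi>(1)] that by (simp add: continuous_map_def)
  then show "\<exists>U V. openin (weak_topology s) U \<and> openin (weak_topology s) V \<and> x \<in> U \<and> y \<in> V \<and> disjnt U V"
    using UV by (intro exI[of _ "\<phi> -` U"] exI[of _ "\<phi> -` V"])
      (auto simp: topspace_weak_topology vimage_def disjnt_def)
qed

text \<open>
  The weak topology is a Hausdorff topology, so \<open>K\<close> is closed and contains the closure of the
  image of the ball.
\<close>

lemma weakly_compact_operatorI:
  assumes "bounded_operator sE s W" "compactin (weak_topology s) K" "W ` cball 0 1 \<subseteq> K"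
  shows "weakly_compact_operator sE s W"
proof -
  have "closedin (weak_topology s) K"
    using compactin_imp_closedin Hausdorff_weak_topology assms(2) by blast
  then have "weak_topology s closure_of (W ` cball 0 1) \<subseteq> K"
    using assms(3) by (rule closure_of_minimal[rotated])
  then show ?thesis
    unfolding weakly_compact_operator_def using assms(1) closed_compactin[OF assms(2)] by simp
qed

end

lemma real_functional_dominated:
  fixes q :: "'a::real_vector \<Rightarrow> real"
  assumes "\<And>x y. q (x + y) \<le> q x + q y" "\<And>c x. q (c *\<^sub>R x) = \<bar>c\<bar> * q x"
  shows "\<exists>\<phi>. linear \<phi> \<and> (\<forall>x. \<bar>\<phi> x\<bar> \<le> q x) \<and> \<phi> f = q f"
proof -
  have "sublinear q"
    unfolding sublinear_def
  proof (intro conjI allI impI)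
    show "q (t *\<^sub>R x) = t * q x" if "0 \<le> t" for t x
      using assms(2)[of t x] that by simp
  qed (rule assms(1))
  from hahn_banach_sublinear[OF this, of f]
  obtain \<phi> where *: "linear \<phi> \<and> (\<forall>x. \<phi> x \<le> q x) \<and> \<phi> f = q f"
    by (rule exE)
  note \<phi> = *[THEN conjunct1] *[THEN conjunct2, THEN conjunct1, rule_format] *[THEN conjunct2, THEN conjunct2]
  have "\<bar>\<phi> x\<bar> \<le> q x" for x
    using \<phi>(2)[of x] \<phi>(2)[of "- x"] assms(2)[of "- 1" x] by (simp add: linear_neg[OF \<phi>(1)])
  with \<phi> show ?thesis
    by (intro exI[of _ \<phi>]) simp
qed

lemma hahn_banach_space_scaleR: "hahn_banach_space (scaleR :: real \<Rightarrow> 'a::real_normed_vector \<Rightarrow> 'a)"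
proof (intro hahn_banach_space.intro scaled_space_scaleR hahn_banach_space_axioms.intro)
  fix q :: "'a \<Rightarrow> real" and f
  assume q: "\<And>x y. q (x + y) \<le> q x + q y" "\<And>c x. q (c *\<^sub>R x) = norm c * q x" "\<And>x. q x \<le> norm x"
  have "\<exists>\<phi>. linear \<phi> \<and> (\<forall>x. \<bar>\<phi> x\<bar> \<le> q x) \<and> \<phi> f = q f"
    by (rule real_functional_dominated) (rule q(1), rule q(2)[unfolded real_norm_def])
  then obtain \<phi> where *: "linear \<phi> \<and> (\<forall>x. \<bar>\<phi> x\<bar> \<le> q x) \<and> \<phi> f = q f"
    by (rule exE)
  note \<phi> = *[THEN conjunct1] *[THEN conjunct2, THEN conjunct1, rule_format] *[THEN conjunct2, THEN conjunct2]
  have "bounded_operator scaleR (*) \<phi>"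
    using \<phi>(1) order_trans[OF \<phi>(2) q(3)]
    by (intro bounded_operatorI[where K = 1]) (auto simp: scaled_space_scaleR scaled_space_mult linear_add linear_scale)
  with \<phi> show "\<exists>\<phi>. bounded_operator scaleR (*) \<phi> \<and> (\<forall>x. norm (\<phi> x) \<le> q x) \<and> norm (\<phi> f) = q f"
    using \<phi>(2)[of f] by (intro exI[of _ \<phi>]) auto
qed

text \<open>
  A dominated real functional \<open>\<phi>\<close> is the real part of the complex functional
  \<open>x \<mapsto> \<phi>(x) - i \<phi>(i x)\<close>, and rotating \<open>x\<close> makes its value real, which gives the bound.
\<close>

lemma hahn_banach_space_cscale:
  "hahn_banach_space (cscale :: complex \<Rightarrow> 'a::banach_lattice complexification \<Rightarrow> _)"
proof (intro hahn_banach_space.intro scaled_space_cscale hahn_banach_space_axioms.intro)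
  fix q :: "'a complexification \<Rightarrow> real" and f
  assume q: "\<And>x y. q (x + y) \<le> q x + q y" "\<And>c x. q (cscale c x) = norm c * q x" "\<And>x. q x \<le> norm x"
  have "q (r *\<^sub>R x) = \<bar>r\<bar> * q x" for r x
    using q(2)[of "of_real r" x] by (simp add: cscale_of_real)
  then have "\<exists>\<phi>. linear \<phi> \<and> (\<forall>x. \<bar>\<phi> x\<bar> \<le> q x) \<and> \<phi> f = q f"
    by (rule real_functional_dominated[rotated]) (rule q(1))
  then obtain \<phi> where *: "linear \<phi> \<and> (\<forall>x. \<bar>\<phi> x\<bar> \<le> q x) \<and> \<phi> f = q f"
    by (rule exE)
  note \<phi> = *[THEN conjunct1] *[THEN conjunct2, THEN conjunct1, rule_format] *[THEN conjunct2, THEN conjunct2]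
  interpret vector_space "cscale :: complex \<Rightarrow> 'a complexification \<Rightarrow> _"
    by (rule vector_space_cscale)
  define \<psi> where "\<psi> x = Complex (\<phi> x) (- \<phi> (cscale \<i> x))" for x
  have add: "\<psi> (x + y) = \<psi> x + \<psi> y" for x y
    by (simp add: \<psi>_def scale_right_distrib linear_add[OF \<phi>(1)] complex_eq_iff)
  have split: "cscale c x = Re c *\<^sub>R x + Im c *\<^sub>R cscale \<i> x" for c x
    by (simp add: cscale_def complexification_ops)
  have scale: "\<psi> (cscale c x) = c * \<psi> x" for c x
  proof -
    have "cscale \<i> (cscale c x) = Re c *\<^sub>R cscale \<i> x - Im c *\<^sub>R x"
      by (simp add: cscale_def complexification_ops)
    then show ?thesis
      by (simp add: \<psi>_def split[of c x] linear_add[OF \<phi>(1)] linear_diff[OF \<phi>(1)] linear_scale[OF \<phi>(1)]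
        complex_eq_iff)
  qed
  have le: "norm (\<psi> x) \<le> q x" for x
  proof (cases "\<psi> x = 0")
    case False
    define c where "c = cnj (\<psi> x) / norm (\<psi> x)"
    have "c * \<psi> x = norm (\<psi> x)"
      using False by (simp add: c_def mult.commute[of "cnj (\<psi> x)"] complex_norm_square[symmetric] power2_eq_square)
    then have "norm (\<psi> x) = Re (\<psi> (cscale c x))"
      by (simp add: scale)
    also have "\<dots> \<le> q (cscale c x)"
      using \<phi>(2)[of "cscale c x"] by (simp add: \<psi>_def)
    also have "\<dots> = q x"
      using False by (simp add: q(2) c_def norm_divide)
    finally show ?thesis .
  qed (use \<phi>(2)[of x] in auto)
  have "bounded_operator cscale (*) \<psi>"
    using add scale order_trans[OF le q(3)]
    by (intro bounded_operatorI[where K = 1]) (auto simp: scaled_space_cscale scaled_space_mult)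
  moreover have "norm (\<psi> f) = q f"
    using le[of f] abs_Re_le_cmod[of "\<psi> f"] \<phi>(3) by (simp add: \<psi>_def)
  ultimately show "\<exists>\<phi>. bounded_operator cscale (*) \<phi> \<and> (\<forall>x. norm (\<phi> x) \<le> q x) \<and> norm (\<phi> f) = q f"
    using le by (intro exI[of _ \<psi>]) simp
qed

section \<open>Step functions in complexifications\<close>

lemma re_im_part_simps [simp]:
  "re_part (z + w) = re_part z + re_part w" "im_part (z + w) = im_part z + im_part w"
  "re_part (z - w) = re_part z - re_part w" "im_part (z - w) = im_part z - im_part w"
  "re_part (r *\<^sub>R z) = r *\<^sub>R re_part z" "im_part (r *\<^sub>R z) = r *\<^sub>R im_part z"
  "re_part (0::'a::banach_lattice complexification) = 0" "im_part (0::'a complexification) = 0"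
  "re_part (cscale c z) = Re c *\<^sub>R re_part z - Im c *\<^sub>R im_part z"
  "im_part (cscale c z) = Re c *\<^sub>R im_part z + Im c *\<^sub>R re_part z"
  by (simp_all add: complexification_ops cscale_def)

lemma modulus_triangle: "modulus (z + w) \<le> modulus z + modulus w"
proof (rule modulus_least)
  fix \<theta>
  show "cos \<theta> *\<^sub>R re_part (z + w) + sin \<theta> *\<^sub>R im_part (z + w) \<le> modulus z + modulus w"
    using add_mono[OF modulus_upper[of \<theta> z] modulus_upper[of \<theta> w]] by (simp add: algebra_simps)
qed

lemma modulus_cscale: "modulus (cscale c z) = cmod c *\<^sub>R modulus z"
proof -
  have le: "modulus (cscale c z) \<le> cmod c *\<^sub>R modulus z" for c and z :: "'a complexification"
  proof (rule modulus_least)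
    fix \<theta>
    obtain \<phi> where \<phi>: "Re c = cmod c * cos \<phi>" "Im c = cmod c * sin \<phi>"
      by (metis Re_rcis Im_rcis rcis_cmod_Arg)
    have "cos \<theta> *\<^sub>R re_part (cscale c z) + sin \<theta> *\<^sub>R im_part (cscale c z) =
        cmod c *\<^sub>R (cos (\<theta> - \<phi>) *\<^sub>R re_part z + sin (\<theta> - \<phi>) *\<^sub>R im_part z)"
      by (simp add: cscale_def \<phi> cos_diff sin_diff algebra_simps)
    also have "\<dots> \<le> cmod c *\<^sub>R modulus z"
      by (intro scaleR_left_mono modulus_upper) simp
    finally show "cos \<theta> *\<^sub>R re_part (cscale c z) + sin \<theta> *\<^sub>R im_part (cscale c z) \<le> cmod c *\<^sub>R modulus z" .
  qed
  interpret vector_space "cscale :: complex \<Rightarrow> 'a complexification \<Rightarrow> _"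
    by (rule vector_space_cscale)
  show ?thesis
  proof (cases "c = 0")
    case True
    then have "modulus (cscale c z) \<le> 0"
      using le[of c z] by simp
    then show ?thesis
      using True modulus_nonneg[of "cscale c z"] by (simp add: antisym)
  next
    case False
    have "modulus z \<le> cmod (inverse c) *\<^sub>R modulus (cscale c z)"
      using le[of "inverse c" "cscale c z"] False by simp
    then have "cmod c *\<^sub>R modulus z \<le> cmod c *\<^sub>R cmod (inverse c) *\<^sub>R modulus (cscale c z)"
      by (rule scaleR_left_mono) simp
    then show ?thesis
      using le[of c z] False by (intro antisym) (auto simp: norm_inverse)
  qed
qed

lemma modulus_le_abs_parts: "modulus z \<le> \<bar>re_part z\<bar> + \<bar>im_part z\<bar>"
proof (rule modulus_least)
  fix \<theta>
  have "cos \<theta> *\<^sub>R re_part z + sin \<theta> *\<^sub>R im_part z \<le> \<bar>cos \<theta>\<bar> *\<^sub>R \<bar>re_part z\<bar> + \<bar>sin \<theta>\<bar> *\<^sub>R \<bar>im_part z\<bar>"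
    by (intro add_mono scaleR_le_abs)
  also have "\<dots> \<le> 1 *\<^sub>R \<bar>re_part z\<bar> + 1 *\<^sub>R \<bar>im_part z\<bar>"
    by (intro add_mono scaleR_right_mono) auto
  finally show "cos \<theta> *\<^sub>R re_part z + sin \<theta> *\<^sub>R im_part z \<le> \<bar>re_part z\<bar> + \<bar>im_part z\<bar>"
    by simp
qed

lemma modulus_real: "modulus (Complexify x 0) = \<bar>x\<bar>"
  using modulus_le_abs_parts[of "Complexify x 0"] abs_re_le_modulus[of "Complexify x 0"]
  by (intro antisym) auto

lemma norm_Complexify_real [simp]: "norm (Complexify x 0) = norm x"
  by (simp add: norm_complexification_def modulus_real norm_abs_lattice)

lemma norm_re_part_le: "norm (re_part z) \<le> norm z" and norm_im_part_le: "norm (im_part z) \<le> norm z"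
  using norm_pos_mono[OF abs_ge_zero abs_re_le_modulus[of z]] norm_pos_mono[OF abs_ge_zero abs_im_le_modulus[of z]]
  by (simp_all add: norm_complexification_def norm_abs_lattice)

lemma norm_le_parts: "norm z \<le> norm (re_part z) + norm (im_part z)"
proof -
  have "norm z \<le> norm (\<bar>re_part z\<bar> + \<bar>im_part z\<bar>)"
    unfolding norm_complexification_def by (intro norm_pos_mono modulus_le_abs_parts modulus_nonneg)
  also have "\<dots> \<le> norm \<bar>re_part z\<bar> + norm \<bar>im_part z\<bar>"
    by (rule norm_triangle_ineq)
  finally show ?thesis
    by (simp add: norm_abs_lattice)
qed

lemma Complexify_tendsto:
  assumes "X \<longlonglongrightarrow> x" "Y \<longlonglongrightarrow> y"
  shows "(\<lambda>n. Complexify (X n) (Y n)) \<longlonglongrightarrow> Complexify x (y::'a::banach_lattice)"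
proof -
  have "(\<lambda>n. norm (X n - x) + norm (Y n - y)) \<longlonglongrightarrow> 0 + 0"
    using assms by (intro tendsto_add tendsto_norm_zero LIM_zero)
  then have "(\<lambda>n. norm (X n - x) + norm (Y n - y)) \<longlonglongrightarrow> 0"
    by simp
  then have "(\<lambda>n. Complexify (X n) (Y n) - Complexify x y) \<longlonglongrightarrow> 0"
    by (rule Lim_null_comparison[rotated])
      (use norm_le_parts[of "Complexify (X _) (Y _) - Complexify x y"] in simp)
  then show ?thesis
    by (rule LIM_zero_cancel)
qed

instance complexification :: (banach_lattice) banach
proof
  fix Z :: "nat \<Rightarrow> 'a complexification"
  assume "Cauchy Z"
  have Cauchy_le: "Cauchy X" if "\<And>m n. norm (X m - X n) \<le> norm (Z m - Z n)" for X :: "nat \<Rightarrow> 'a"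
    using \<open>Cauchy Z\<close> that unfolding Cauchy_iff by (meson le_less_trans)
  have "Cauchy (\<lambda>n. re_part (Z n))" "Cauchy (\<lambda>n. im_part (Z n))"
    using norm_re_part_le[of "Z _ - Z _"] norm_im_part_le[of "Z _ - Z _"] by (auto intro!: Cauchy_le)
  then obtain x y where "(\<lambda>n. re_part (Z n)) \<longlonglongrightarrow> x" "(\<lambda>n. im_part (Z n)) \<longlonglongrightarrow> y"
    unfolding Cauchy_convergent_iff convergent_def by blast
  from Complexify_tendsto[OF this] show "convergent Z"
    by (auto simp: convergent_def)
qed

text \<open>
  The pieces of a positive partition may overlap, so the modulus of a step function is not computed
  piece by piece. It is estimated from below instead: the modulus dominates
  \<open>cos \<phi> Re z + sin \<phi> Im z\<close>, and on a single piece the angle \<open>\<phi>\<close> may be chosen as the argument of the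
  coefficient.
\<close>

lemma coefficient_le_modulus:
  fixes z :: "'a::banach_lattice complexification"
  assumes P: "positive_map P"
    and a: "\<bar>P (re_part z) - a *\<^sub>R P e\<bar> \<le> \<eta> *\<^sub>R P e" and b: "\<bar>P (im_part z) - b *\<^sub>R P e\<bar> \<le> \<eta> *\<^sub>R P e"
  shows "cmod (Complex a b) *\<^sub>R P e \<le> P (modulus z) + (2 * \<eta>) *\<^sub>R P e"
proof -
  have lin: "linear P"
    using P by (simp add: positive_map_def)
  define r where "r = cmod (Complex a b)"
  obtain \<phi> where \<phi>: "a = r * cos \<phi>" "b = r * sin \<phi>"
    unfolding r_def by (metis Re_rcis Im_rcis rcis_cmod_Arg complex.sel)
  have small: "t *\<^sub>R (v - w) \<le> \<eta> *\<^sub>R P e" if "\<bar>t\<bar> \<le> 1" "\<bar>w - v\<bar> \<le> \<eta> *\<^sub>R P e" for t v w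
  proof -
    have "t *\<^sub>R (v - w) \<le> \<bar>t\<bar> *\<^sub>R \<bar>v - w\<bar>"
      by (rule scaleR_le_abs)
    also have "\<dots> \<le> 1 *\<^sub>R \<bar>v - w\<bar>"
      using that(1) by (intro scaleR_right_mono) auto
    finally show ?thesis
      using that(2) by (simp add: abs_minus_commute)
  qed
  have "cos \<phi> *\<^sub>R P (re_part z) + sin \<phi> *\<^sub>R P (im_part z) = P (cos \<phi> *\<^sub>R re_part z + sin \<phi> *\<^sub>R im_part z)"
    by (simp add: linear_add[OF lin] linear_scale[OF lin])
  also have "\<dots> \<le> P (modulus z)"
    by (intro positive_map_mono[OF P] modulus_upper)
  finally have main: "cos \<phi> *\<^sub>R P (re_part z) + sin \<phi> *\<^sub>R P (im_part z) \<le> P (modulus z)" .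
  have "r = r * ((cos \<phi>)\<^sup>2 + (sin \<phi>)\<^sup>2)"
    by simp
  also have "\<dots> = cos \<phi> * a + sin \<phi> * b"
    by (simp only: \<phi> power2_eq_square) (simp only: algebra_simps)
  finally have "r *\<^sub>R P e = (cos \<phi> * a + sin \<phi> * b) *\<^sub>R P e"
    by simp
  also have "\<dots> = (cos \<phi> *\<^sub>R P (re_part z) + sin \<phi> *\<^sub>R P (im_part z)) +
      (cos \<phi> *\<^sub>R (a *\<^sub>R P e - P (re_part z)) + sin \<phi> *\<^sub>R (b *\<^sub>R P e - P (im_part z)))"
    by (simp add: algebra_simps)
  also have "\<dots> \<le> P (modulus z) + (\<eta> *\<^sub>R P e + \<eta> *\<^sub>R P e)"
    by (intro add_mono[OF main add_mono] small a b) auto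
  finally show ?thesis
    by (simp add: r_def flip: scaleR_2)
qed

lemma norm_localized_le:
  fixes z :: "'a::al_space complexification"
  assumes a: "\<bar>P (re_part z) - a *\<^sub>R P e\<bar> \<le> \<eta> *\<^sub>R P e" and b: "\<bar>P (im_part z) - b *\<^sub>R P e\<bar> \<le> \<eta> *\<^sub>R P e"
  shows "norm (Complexify (P (re_part z)) (P (im_part z)) - cscale (Complex a b) (Complexify (P e) 0)) \<le>
    2 * \<eta> * norm_functional (P e)"
  using norm_le_parts[of "Complexify (P (re_part z)) (P (im_part z)) - cscale (Complex a b) (Complexify (P e) 0)"]
    norm_le_of_abs_le[OF a] norm_le_of_abs_le[OF b]
  by (simp add: norm_functional_simps)

lemma sum_list_Complexify: "(\<Sum>i\<leftarrow>xs. Complexify (f i) (g i)) = Complexify (\<Sum>i\<leftarrow>xs. f i) (\<Sum>i\<leftarrow>xs. g i)"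
  for f :: "_ \<Rightarrow> 'a::banach_lattice"
  by (induction xs) (simp_all add: complexification_ops)

lemma partition_Complexify:
  "positive_partition Ps \<Longrightarrow> (\<Sum>P\<leftarrow>Ps. Complexify (P (re_part z)) (P (im_part z))) = z"
  by (simp add: positive_partition_def sum_list_Complexify)

text \<open>
  Every vector is almost a combination of real vectors with complex coefficients, at no cost in
  norm. It reduces norm estimates for complex operators to real arguments.
\<close>

lemma complexification_decomposition:
  fixes z :: "'a::al_space complexification"
  assumes "0 < \<epsilon>"
  shows "\<exists>xs. norm (z - (\<Sum>(c, u)\<leftarrow>xs. cscale c (Complexify u 0))) \<le> \<epsilon> \<and>
    (\<Sum>(c, u)\<leftarrow>xs. cmod c * norm u) \<le> norm z + \<epsilon>"
proof -
  define e where "e = \<bar>re_part z\<bar> + \<bar>im_part z\<bar>"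
  define \<eta> where "\<eta> = \<epsilon> / (2 * norm e + 1)"
  have pos: "0 < 2 * norm e + 1"
    by (simp add: add_nonneg_pos)
  have \<eta>: "0 < \<eta>" "2 * \<eta> * norm e \<le> \<epsilon>"
    using \<open>0 < \<epsilon>\<close> pos by (simp_all add: \<eta>_def field_simps)
  have e0: "0 \<le> e"
    by (simp add: e_def)
  have "\<bar>x\<bar> \<le> e" if "x \<in> {re_part z, im_part z}" for x
    using that by (auto simp: e_def)
  then obtain Ps k where Ps: "positive_partition Ps"
      and k: "\<And>P x. P \<in> set Ps \<Longrightarrow> x \<in> {re_part z, im_part z} \<Longrightarrow> \<bar>P x - k P x *\<^sub>R P e\<bar> \<le> \<eta> *\<^sub>R P e"
    using exists_localizing_partition[of "{re_part z, im_part z}" e \<eta>] \<eta>(1) by auto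
  define a b where "a P = k P (re_part z)" and "b P = k P (im_part z)" for P
  have a: "\<bar>P (re_part z) - a P *\<^sub>R P e\<bar> \<le> \<eta> *\<^sub>R P e" if "P \<in> set Ps" for P
    unfolding a_def by (rule k[OF that]) simp
  have b: "\<bar>P (im_part z) - b P *\<^sub>R P e\<bar> \<le> \<eta> *\<^sub>R P e" if "P \<in> set Ps" for P
    unfolding b_def by (rule k[OF that]) simp
  have Pe: "0 \<le> P e" if "P \<in> set Ps" for P
    using Ps that e0 by (simp add: positive_partition_def positive_map_def)
  let ?xs = "map (\<lambda>P. (Complex (a P) (b P), P e)) Ps"
  have sum_e: "(\<Sum>P\<leftarrow>Ps. 2 * \<eta> * norm_functional (P e)) \<le> \<epsilon>"
    using sum_list_norm_functional_partition[OF Ps, of e] \<eta>(2) e0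
    by (simp add: sum_list_const_mult norm_functional_pos)
  have "norm (z - (\<Sum>(c, u)\<leftarrow>?xs. cscale c (Complexify u 0))) =
      norm (\<Sum>P\<leftarrow>Ps. Complexify (P (re_part z)) (P (im_part z)) - cscale (Complex (a P) (b P)) (Complexify (P e) 0))"
    using partition_Complexify[OF Ps, of z] by (simp add: sum_list_subtractf o_def)
  also have "\<dots> \<le> (\<Sum>P\<leftarrow>Ps. 2 * \<eta> * norm_functional (P e))"
    by (intro order_trans[OF norm_sum_list_le] sum_list_mono norm_localized_le a b)
  finally have 1: "norm (z - (\<Sum>(c, u)\<leftarrow>?xs. cscale c (Complexify u 0))) \<le> \<epsilon>"
    using sum_e by simp
  have "(\<Sum>(c, u)\<leftarrow>?xs. cmod c * norm u) = (\<Sum>P\<leftarrow>Ps. norm_functional (cmod (Complex (a P) (b P)) *\<^sub>R P e))"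
    using Pe by (auto simp: o_def norm_functional_simps norm_functional_pos intro!: arg_cong[where f = sum_list])
  also have "\<dots> \<le> (\<Sum>P\<leftarrow>Ps. norm_functional (P (modulus z)) + 2 * \<eta> * norm_functional (P e))"
  proof (rule sum_list_mono)
    fix P assume "P \<in> set Ps"
    then show "norm_functional (cmod (Complex (a P) (b P)) *\<^sub>R P e) \<le>
        norm_functional (P (modulus z)) + 2 * \<eta> * norm_functional (P e)"
      using norm_functional_mono[OF coefficient_le_modulus[of P z "a P" e \<eta> "b P"]] a b Ps
      by (simp add: norm_functional_simps positive_partition_def)
  qed
  also have "\<dots> \<le> norm z + \<epsilon>"
    using sum_e sum_list_norm_functional_partition[OF Ps, of "modulus z"]
    by (simp add: sum_list_addf norm_functional_pos norm_complexification_def)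
  finally have 2: "(\<Sum>(c, u)\<leftarrow>?xs. cmod c * norm u) \<le> norm z + \<epsilon>" .
  show ?thesis
    using 1 2 by (intro exI[of _ ?xs] conjI)
qed

lemma abs_sum_list_le: "\<bar>\<Sum>i\<leftarrow>xs. f i\<bar> \<le> (\<Sum>i\<leftarrow>xs. \<bar>f i\<bar>)"
  for f :: "_ \<Rightarrow> 'a::lattice_ab_group_add_abs"
  by (induction xs) (auto intro: order_trans[OF abs_triangle_ineq] add_left_mono)

lemma abs_scaleR_le:
  fixes x :: "'a::banach_lattice"
  shows "\<bar>t *\<^sub>R x\<bar> \<le> \<bar>t\<bar> *\<^sub>R \<bar>x\<bar>"
  using scaleR_le_abs[of t x] scaleR_le_abs[of "- t" x] by (intro abs_leI) auto

text \<open>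
  In an \<open>L\<^sub>1\<close>-space \<open>\<tau>\<close> would be \<open>y min(1, g / |y|)\<close>. Here the coefficients of \<open>y\<close> and of \<open>g\<close> on the
  pieces of a localizing partition are truncated instead; the coefficient \<open>\<gamma> P\<close> of \<open>g\<close> is taken from
  below, so that the bound by \<open>g\<close> is exact and only the distance to \<open>y\<close> suffers an error.
\<close>

lemma truncation:
  fixes y :: "'a::al_space complexification"
  assumes g: "0 \<le> g" and "0 < \<epsilon>"
  shows "\<exists>\<tau>. \<bar>re_part \<tau>\<bar> \<le> g \<and> \<bar>im_part \<tau>\<bar> \<le> g \<and> norm (y - \<tau>) \<le> norm (pprt (modulus y - g)) + \<epsilon>"
proof -
  define e where "e = \<bar>re_part y\<bar> + \<bar>im_part y\<bar> + g"
  define \<eta> where "\<eta> = \<epsilon> / (6 * norm e + 1)"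
  have pos: "0 < 6 * norm e + 1"
    by (simp add: add_nonneg_pos)
  have \<eta>: "0 < \<eta>" "6 * \<eta> * norm e \<le> \<epsilon>"
    using \<open>0 < \<epsilon>\<close> pos by (simp_all add: \<eta>_def field_simps)
  have e0: "0 \<le> e"
    using g by (simp add: e_def)
  have "\<bar>x\<bar> \<le> e" if "x \<in> {re_part y, im_part y, g}" for x
    using g that by (auto simp: e_def add.assoc intro: add_increasing add_increasing2 add_nonneg_nonneg)
  then obtain Ps k where Ps: "positive_partition Ps"
      and k: "\<And>P x. P \<in> set Ps \<Longrightarrow> x \<in> {re_part y, im_part y, g} \<Longrightarrow> \<bar>P x - k P x *\<^sub>R P e\<bar> \<le> \<eta> *\<^sub>R P e"
    using exists_localizing_partition[of "{re_part y, im_part y, g}" e \<eta>] \<eta>(1) by auto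
  define a b t where "a P = k P (re_part y)" and "b P = k P (im_part y)" and "t P = k P g" for P
  have a: "\<bar>P (re_part y) - a P *\<^sub>R P e\<bar> \<le> \<eta> *\<^sub>R P e" if "P \<in> set Ps" for P
    unfolding a_def by (rule k[OF that]) simp
  have b: "\<bar>P (im_part y) - b P *\<^sub>R P e\<bar> \<le> \<eta> *\<^sub>R P e" if "P \<in> set Ps" for P
    unfolding b_def by (rule k[OF that]) simp
  have t: "\<bar>P g - t P *\<^sub>R P e\<bar> \<le> \<eta> *\<^sub>R P e" if "P \<in> set Ps" for P
    unfolding t_def by (rule k[OF that]) simp
  have posP: "positive_map P" if "P \<in> set Ps" for P
    using Ps that by (simp add: positive_partition_def)
  have Pe: "0 \<le> P e" and Pg: "0 \<le> P g" if "P \<in> set Ps" for P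
    using posP[OF that] e0 g by (simp_all add: positive_map_def)
  define c where "c P = Complex (a P) (b P)" for P
  define \<gamma> where "\<gamma> P = max 0 (t P - \<eta>)" for P
  define d where "d P = of_real (min (cmod (c P)) (\<gamma> P) / cmod (c P)) * c P" for P
  have \<gamma>0: "0 \<le> \<gamma> P" for P
    by (simp add: \<gamma>_def)
  have d_le: "cmod (d P) \<le> \<gamma> P" for P
    using \<gamma>0[of P] by (cases "c P = 0") (auto simp: d_def norm_mult norm_divide)
  have c_d: "cmod (c P - d P) = max 0 (cmod (c P) - \<gamma> P)" for P
  proof (cases "c P = 0")
    case False
    have "c P - d P = of_real (1 - min (cmod (c P)) (\<gamma> P) / cmod (c P)) * c P"
      by (simp add: d_def algebra_simps)
    then have "cmod (c P - d P) = \<bar>1 - min (cmod (c P)) (\<gamma> P) / cmod (c P)\<bar> * cmod (c P)"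
      by (simp add: norm_mult del: of_real_diff of_real_divide)
    also have "\<dots> = max 0 (cmod (c P) - \<gamma> P)"
      using False by (auto simp: min_def max_def abs_if field_simps)
    finally show ?thesis .
  qed (use \<gamma>0[of P] in \<open>simp add: d_def\<close>)
  have \<gamma>_le: "\<gamma> P *\<^sub>R P e \<le> P g" if "P \<in> set Ps" for P
  proof (cases "0 \<le> t P - \<eta>")
    case True
    have "t P *\<^sub>R P e - P g \<le> \<eta> *\<^sub>R P e"
      using abs_le_D2[OF t[OF that]] by simp
    then have "(t P - \<eta>) *\<^sub>R P e \<le> P g"
      by (simp add: algebra_simps)
    then show ?thesis
      using True by (simp add: \<gamma>_def)
  next
    case False
    then show ?thesis
      using Pg[OF that] by (simp add: \<gamma>_def)
  qed
  have \<gamma>_ge: "P g \<le> \<gamma> P *\<^sub>R P e + (2 * \<eta>) *\<^sub>R P e" if "P \<in> set Ps" for P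
  proof -
    have "P g - t P *\<^sub>R P e \<le> \<eta> *\<^sub>R P e"
      using abs_le_D1[OF t[OF that]] .
    then have "P g \<le> (t P + \<eta>) *\<^sub>R P e"
      by (simp add: algebra_simps)
    also have "\<dots> \<le> (\<gamma> P + 2 * \<eta>) *\<^sub>R P e"
      using Pe[OF that] by (intro scaleR_right_mono) (auto simp: \<gamma>_def)
    finally show ?thesis
      by (simp add: scaleR_left_distrib)
  qed
  have diff_le: "cmod (c P - d P) * norm_functional (P e) \<le>
      norm_functional (P (pprt (modulus y - g))) + 4 * \<eta> * norm_functional (P e)" if P: "P \<in> set Ps" for P
  proof -
    have lin: "linear P"
      using posP[OF P] by (simp add: positive_map_def)
    have "cmod (c P) *\<^sub>R P e \<le> P (modulus y) + (2 * \<eta>) *\<^sub>R P e"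
      unfolding c_def by (intro coefficient_le_modulus posP a b P)
    from add_mono[OF this \<gamma>_ge[OF P]]
    have "cmod (c P) *\<^sub>R P e + P g \<le> P (modulus y) + \<gamma> P *\<^sub>R P e + ((2 * \<eta>) *\<^sub>R P e + (2 * \<eta>) *\<^sub>R P e)"
      by (simp only: ac_simps)
    also have "(2 * \<eta>) *\<^sub>R P e + (2 * \<eta>) *\<^sub>R P e = (4 * \<eta>) *\<^sub>R P e"
      by (simp flip: scaleR_left_distrib)
    finally have sum_le: "cmod (c P) *\<^sub>R P e + P g \<le> P (modulus y) + \<gamma> P *\<^sub>R P e + (4 * \<eta>) *\<^sub>R P e" .
    have "u - v \<le> (m - h) + w" if "u + h \<le> m + v + w" for u v m h w :: 'a
      using that by (simp add: algebra_simps)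
    from this[OF sum_le] have "(cmod (c P) - \<gamma> P) *\<^sub>R P e \<le> (P (modulus y) - P g) + (4 * \<eta>) *\<^sub>R P e"
      unfolding scaleR_left_diff_distrib .
    also have "P (modulus y) - P g \<le> P (pprt (modulus y - g))"
      using positive_map_mono[OF posP[OF P], of "modulus y - g" "pprt (modulus y - g)"]
      by (simp add: linear_diff[OF lin] pprt_def)
    finally have "(cmod (c P) - \<gamma> P) * norm_functional (P e) \<le>
        norm_functional (P (pprt (modulus y - g))) + 4 * \<eta> * norm_functional (P e)"
      using norm_functional_mono[of "(cmod (c P) - \<gamma> P) *\<^sub>R P e" "P (pprt (modulus y - g)) + (4 * \<eta>) *\<^sub>R P e"]
      by (simp add: norm_functional_simps)
    moreover have "0 \<le> norm_functional (P (pprt (modulus y - g)))" "0 \<le> 4 * \<eta> * norm_functional (P e)"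
      using posP[OF P] Pe[OF P] \<eta>(1) by (simp_all add: norm_functional_pos positive_map_def)
    ultimately show ?thesis
      by (auto simp: c_d max_def)
  qed
  define \<tau> where "\<tau> = (\<Sum>P\<leftarrow>Ps. cscale (d P) (Complexify (P e) 0))"
  have \<tau>: "re_part \<tau> = (\<Sum>P\<leftarrow>Ps. Re (d P) *\<^sub>R P e)" "im_part \<tau> = (\<Sum>P\<leftarrow>Ps. Im (d P) *\<^sub>R P e)"
    by (simp_all add: \<tau>_def cscale_def sum_list_Complexify)
  have part: "\<bar>\<Sum>P\<leftarrow>Ps. r P *\<^sub>R P e\<bar> \<le> g" if "\<And>P. \<bar>r P\<bar> \<le> \<gamma> P" for r
  proof -
    have "\<bar>\<Sum>P\<leftarrow>Ps. r P *\<^sub>R P e\<bar> \<le> (\<Sum>P\<leftarrow>Ps. \<bar>r P *\<^sub>R P e\<bar>)"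
      by (rule abs_sum_list_le)
    also have "\<dots> \<le> (\<Sum>P\<leftarrow>Ps. P g)"
    proof (rule sum_list_mono)
      fix P assume P: "P \<in> set Ps"
      have "\<bar>r P *\<^sub>R P e\<bar> \<le> \<bar>r P\<bar> *\<^sub>R P e"
        using abs_scaleR_le[of "r P" "P e"] Pe[OF P] by simp
      also have "\<dots> \<le> \<gamma> P *\<^sub>R P e"
        using that Pe[OF P] by (rule scaleR_right_mono)
      finally show "\<bar>r P *\<^sub>R P e\<bar> \<le> P g"
        using \<gamma>_le[OF P] by simp
    qed
    finally show ?thesis
      using Ps by (simp add: positive_partition_def)
  qed
  have "\<bar>re_part \<tau>\<bar> \<le> g" "\<bar>im_part \<tau>\<bar> \<le> g"
    unfolding \<tau> by (rule part, rule order_trans[OF abs_Re_le_cmod d_le])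
      (rule part, rule order_trans[OF abs_Im_le_cmod d_le])
  moreover have "norm (y - \<tau>) \<le> norm (pprt (modulus y - g)) + \<epsilon>"
  proof -
    let ?y = "\<lambda>P. Complexify (P (re_part y)) (P (im_part y))"
    have "norm (y - \<tau>) = norm (\<Sum>P\<leftarrow>Ps. ?y P - cscale (d P) (Complexify (P e) 0))"
      using partition_Complexify[OF Ps, of y] by (simp add: \<tau>_def sum_list_subtractf)
    also have "\<dots> \<le> (\<Sum>P\<leftarrow>Ps. norm (?y P - cscale (d P) (Complexify (P e) 0)))"
      by (rule norm_sum_list_le)
    also have "\<dots> \<le> (\<Sum>P\<leftarrow>Ps. norm_functional (P (pprt (modulus y - g))) + 6 * \<eta> * norm_functional (P e))"
    proof (rule sum_list_mono)
      fix P assume P: "P \<in> set Ps"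
      have "?y P - cscale (d P) (Complexify (P e) 0) =
          (?y P - cscale (c P) (Complexify (P e) 0)) + cscale (c P - d P) (Complexify (P e) 0)"
        by (simp add: cscale_def complexification_ops algebra_simps)
      also have "norm \<dots> \<le> norm (?y P - cscale (c P) (Complexify (P e) 0)) + norm (cscale (c P - d P) (Complexify (P e) 0))"
        by (rule norm_triangle_ineq)
      also have "norm (?y P - cscale (c P) (Complexify (P e) 0)) \<le> 2 * \<eta> * norm_functional (P e)"
        unfolding c_def by (intro norm_localized_le a b P)
      also have "norm (cscale (c P - d P) (Complexify (P e) 0)) = cmod (c P - d P) * norm_functional (P e)"
        using Pe[OF P] by (simp add: norm_cscale norm_functional_pos)
      finally show "norm (?y P - cscale (d P) (Complexify (P e) 0)) \<le>
          norm_functional (P (pprt (modulus y - g))) + 6 * \<eta> * norm_functional (P e)"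
        using diff_le[OF P] by simp
    qed
    also have "\<dots> = norm (pprt (modulus y - g)) + 6 * \<eta> * norm e"
      using sum_list_norm_functional_partition[OF Ps] e0
      by (simp add: sum_list_addf sum_list_const_mult norm_functional_pos)
    finally show ?thesis
      using \<eta>(2) by simp
  qed
  ultimately show ?thesis
    by blast
qed

section \<open>Truncated operators\<close>

text \<open>
  The box is the image of the square of an order interval under \<open>(x, y) \<mapsto> x + i y\<close>. This map is
  weakly continuous because a complex functional is a sum of functionals of \<open>x\<close> and \<open>y\<close> whose
  real and imaginary parts are real functionals.
\<close>

lemma compactin_order_box:
  fixes g :: "'a::al_space"
  shows "compactin (weak_topology cscale) {z. \<bar>re_part z\<bar> \<le> g \<and> \<bar>im_part z\<bar> \<le> g}"
proof -
  interpret R: hahn_banach_space "scaleR :: real \<Rightarrow> 'a \<Rightarrow> 'a"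
    by (rule hahn_banach_space_scaleR)
  let ?W = "weak_topology (scaleR :: real \<Rightarrow> 'a \<Rightarrow> 'a)"
  let ?f = "\<lambda>p. Complexify (fst p) (snd p) :: 'a complexification"
  have part: "continuous_map ?W euclidean \<psi>" if "bounded_linear \<psi>" for \<psi> :: "'a \<Rightarrow> complex"
  proof -
    have "bounded_linear (\<lambda>x. Re (\<psi> x))" "bounded_linear (\<lambda>x. Im (\<psi> x))"
      by (rule bounded_linear_compose[OF bounded_linear_Re that], rule bounded_linear_compose[OF bounded_linear_Im that])
    then have Re: "continuous_map ?W euclideanreal (\<lambda>x. Re (\<psi> x))"
      and Im: "continuous_map ?W euclideanreal (\<lambda>x. Im (\<psi> x))"
      by (simp_all only: R.continuous_map_functional bounded_operator_real_functional)
    have of_real: "continuous_map euclideanreal euclidean (\<lambda>t. complex_of_real t)"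
      and i_of_real: "continuous_map euclideanreal euclidean (\<lambda>t. \<i> * complex_of_real t)"
      by (auto intro!: continuous_intros)
    have "continuous_map ?W euclidean (\<lambda>x. complex_of_real (Re (\<psi> x)) + \<i> * complex_of_real (Im (\<psi> x)))"
      using continuous_map_add[OF continuous_map_compose[OF Re of_real] continuous_map_compose[OF Im i_of_real]]
      by (simp only: o_def)
    then show ?thesis
      by (simp only: complex_eq[symmetric])
  qed
  have "continuous_map (prod_topology ?W ?W) (weak_topology cscale) ?f"
    unfolding weak_topology_def[of cscale]
  proof (rule continuous_on_generated_topo)
    fix V assume "V \<in> {\<phi> -` U | \<phi> U. bounded_operator cscale (*) (\<phi> :: 'a complexification \<Rightarrow> complex) \<and> open U}"
    then obtain \<phi> U where V: "V = \<phi> -` U" and \<phi>: "bounded_operator cscale (*) (\<phi> :: 'a complexification \<Rightarrow> complex)"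
        and "open U"
      by (elim CollectE exE conjE)
    note bl = bounded_operatorD(5)[OF \<phi>]
    have re: "bounded_linear (\<lambda>x. \<phi> (Complexify x 0))"
    proof (rule bounded_linear_compose[OF bl])
      show "bounded_linear (\<lambda>x. Complexify x 0 :: 'a complexification)"
        by (rule bounded_linear_intro[where K = 1]) (simp_all add: complexification_ops)
    qed
    have im: "bounded_linear (\<lambda>x. \<phi> (Complexify 0 x))"
    proof (rule bounded_linear_compose[OF bl])
      show "bounded_linear (\<lambda>x. Complexify 0 x :: 'a complexification)"
        by (rule bounded_linear_intro[where K = 1])
          (use norm_le_parts[of "Complexify 0 _"] in \<open>simp_all add: complexification_ops\<close>)
    qed
    have "continuous_map (prod_topology ?W ?W) euclidean
        (\<lambda>p. \<phi> (Complexify (fst p) 0) + \<phi> (Complexify 0 (snd p)))"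
      using continuous_map_add[OF continuous_map_compose[OF continuous_map_fst part[OF re]]
        continuous_map_compose[OF continuous_map_snd part[OF im]]]
      by (simp only: o_def)
    moreover have "\<phi> (Complexify (fst p) 0) + \<phi> (Complexify 0 (snd p)) = \<phi> (?f p)" for p
      by (simp add: complexification_ops flip: bounded_operatorD(1)[OF \<phi>])
    ultimately have "continuous_map (prod_topology ?W ?W) euclidean (\<lambda>p. \<phi> (?f p))"
      by simp
    then have "openin (prod_topology ?W ?W) {p \<in> topspace (prod_topology ?W ?W). \<phi> (?f p) \<in> U}"
      using \<open>open U\<close> by (simp add: continuous_map_def)
    moreover have "{p \<in> topspace (prod_topology ?W ?W). \<phi> (?f p) \<in> U} = ?f -` V \<inter> topspace (prod_topology ?W ?W)"
      using V by auto
    ultimately show "openin (prod_topology ?W ?W) (?f -` V \<inter> topspace (prod_topology ?W ?W))"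
      by simp
  next
    interpret C: hahn_banach_space "cscale :: complex \<Rightarrow> 'a complexification \<Rightarrow> _"
      by (rule hahn_banach_space_cscale)
    show "?f ` topspace (prod_topology ?W ?W) \<subseteq> \<Union> {\<phi> -` U | \<phi> U. bounded_operator cscale (*) (\<phi> :: 'a complexification \<Rightarrow> complex) \<and> open U}"
      using C.topspace_weak_topology unfolding weak_topology_def topology_generated_by_topspace by simp
  qed
  moreover have "compactin (prod_topology ?W ?W) ({y. \<bar>y\<bar> \<le> g} \<times> {y. \<bar>y\<bar> \<le> g})"
    by (simp add: compactin_Times compactin_order_interval)
  ultimately have "compactin (weak_topology cscale) (?f ` ({y. \<bar>y\<bar> \<le> g} \<times> {y. \<bar>y\<bar> \<le> g}))"
    by (rule image_compactin[rotated])
  moreover have "?f ` ({y. \<bar>y\<bar> \<le> g} \<times> {y. \<bar>y\<bar> \<le> g}) = {z. \<bar>re_part z\<bar> \<le> g \<and> \<bar>im_part z\<bar> \<le> g}"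
  proof (intro equalityI subsetI)
    fix z :: "'a complexification" assume "z \<in> {z. \<bar>re_part z\<bar> \<le> g \<and> \<bar>im_part z\<bar> \<le> g}"
    then show "z \<in> ?f ` ({y. \<bar>y\<bar> \<le> g} \<times> {y. \<bar>y\<bar> \<le> g})"
      by (intro image_eqI[of _ _ "(re_part z, im_part z)"]) auto
  qed auto
  ultimately show ?thesis
    by simp
qed

lemma linear_sum_list: "linear f \<Longrightarrow> f (\<Sum>i\<leftarrow>xs. g i) = (\<Sum>i\<leftarrow>xs. f (g i))"
  by (induction xs) (simp_all add: linear_0 linear_add)

text \<open>
  Localizing the vectors of \<open>A\<close> gives the contraction \<open>Q = \<Sum> \<xi> P u P\<close> of finite rank, where
  \<open>\<xi> P x = \<integral> P x\<close> and \<open>u P\<close> is the normalized \<open>P e\<close>, with \<open>Q x\<close> close to \<open>x\<close> on \<open>A\<close>. Since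
  \<open>\<Sum> |\<xi> P x| \<le> \<parallel>x\<parallel>\<close>, truncating the vectors \<open>T (u P)\<close> changes \<open>T Q x\<close> by little more than
  \<open>c \<parallel>x\<parallel>\<close>.
\<close>

lemma approximate_truncated_operator:
  fixes T :: "'e::al_space \<Rightarrow> 'f::al_space complexification"
  assumes T: "bounded_linear T" and c: "0 \<le> c" and g: "0 \<le> g"
    and trunc: "\<And>u. 0 \<le> u \<Longrightarrow> norm u \<le> 1 \<Longrightarrow> norm (pprt (modulus (T u) - g)) \<le> c"
    and A: "finite A" and "0 < \<epsilon>"
  shows "\<exists>W. linear W \<and> (\<forall>x. \<bar>re_part (W x)\<bar> \<le> norm x *\<^sub>R g \<and> \<bar>im_part (W x)\<bar> \<le> norm x *\<^sub>R g) \<and>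
    (\<forall>x\<in>A. norm (T x - W x) \<le> c * norm x + \<epsilon>)"
proof -
  define e where "e = (\<Sum>x\<in>A. \<bar>x\<bar>)"
  have e0: "0 \<le> e"
    by (simp add: e_def sum_nonneg)
  have xe: "\<bar>x\<bar> \<le> e" if "x \<in> A" for x
    unfolding e_def sum.remove[OF A that] by (simp add: sum_nonneg)
  define K where "K = onorm T + 1"
  have K: "0 < K" and TK: "norm (T x) \<le> K * norm x" for x
    using onorm_pos_le[OF T] onorm[OF T, of x] mult_right_mono[of "onorm T" K "norm x"]
    by (auto simp: K_def)
  define \<eta> where "\<eta> = \<epsilon> / (4 * K * (norm e + 1))"
  define \<delta> where "\<delta> = \<epsilon> / (2 * (norm e + 1))"
  have ne: "0 < norm e + 1"
    by (simp add: add_nonneg_pos)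
  have pos: "0 < \<eta>" "0 < \<delta>"
    using \<open>0 < \<epsilon>\<close> K ne by (simp_all add: \<eta>_def \<delta>_def)
  have \<eta>: "K * (2 * \<eta> * norm e) \<le> \<epsilon> / 2"
  proof -
    have "K * (2 * (\<epsilon> / (4 * K * n)) * m) = (\<epsilon> / 2) * (m / n)" if "0 < n" for n m
      using K that by (simp add: field_simps)
    from this[OF ne] have "K * (2 * \<eta> * norm e) = (\<epsilon> / 2) * (norm e / (norm e + 1))"
      unfolding \<eta>_def .
    also have "\<dots> \<le> (\<epsilon> / 2) * 1"
      using \<open>0 < \<epsilon>\<close> ne by (intro mult_left_mono) (auto simp: divide_le_eq_1)
    finally show ?thesis by simp
  qed
  have \<delta>: "\<delta> * norm e \<le> \<epsilon> / 2"
  proof -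
    have "\<delta> * norm e = (\<epsilon> / 2) * (norm e / (norm e + 1))"
      by (simp add: \<delta>_def)
    also have "\<dots> \<le> (\<epsilon> / 2) * 1"
      using \<open>0 < \<epsilon>\<close> ne by (intro mult_left_mono) (auto simp: divide_le_eq_1)
    finally show ?thesis by simp
  qed
  obtain Ps a where Ps: "positive_partition Ps"
      and a: "\<And>P x. P \<in> set Ps \<Longrightarrow> x \<in> A \<Longrightarrow> \<bar>P x - a P x *\<^sub>R P e\<bar> \<le> \<eta> *\<^sub>R P e"
    using exists_localizing_partition[OF A xe pos(1)] by blast
  have P: "linear P" "0 \<le> P e" "positive_map P" if "P \<in> set Ps" for P
    using that Ps e0 by (auto simp: positive_partition_def positive_map_def)
  define u where "u P = inverse (norm (P e)) *\<^sub>R P e" for P :: "'e \<Rightarrow> 'e"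
  have u: "0 \<le> u P" "norm (u P) \<le> 1" if "P \<in> set Ps" for P
    using P(2)[OF that] by (cases "P e = 0"; simp add: u_def scaleR_nonneg_nonneg)+
  have Pe: "P e = norm (P e) *\<^sub>R u P" for P :: "'e \<Rightarrow> 'e"
    by (cases "P e = 0") (simp_all add: u_def)
  define \<tau> where "\<tau> P = (SOME \<tau>. \<bar>re_part \<tau>\<bar> \<le> g \<and> \<bar>im_part \<tau>\<bar> \<le> g \<and>
      norm (T (u P) - \<tau>) \<le> norm (pprt (modulus (T (u P)) - g)) + \<delta>)" for P
  have \<tau>: "\<bar>re_part (\<tau> P)\<bar> \<le> g" "\<bar>im_part (\<tau> P)\<bar> \<le> g"
      "norm (T (u P) - \<tau> P) \<le> norm (pprt (modulus (T (u P)) - g)) + \<delta>" for P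
    using someI_ex[OF truncation[OF g pos(2), of "T (u P)"]] unfolding \<tau>_def by blast+
  define \<xi> where "\<xi> P x = norm_functional (P x)" for P :: "'e \<Rightarrow> 'e" and x
  define W where "W x = (\<Sum>P\<leftarrow>Ps. \<xi> P x *\<^sub>R \<tau> P)" for x
  have \<xi>_sum: "(\<Sum>P\<leftarrow>Ps. \<bar>\<xi> P x\<bar>) \<le> norm x" for x
  proof -
    have "(\<Sum>P\<leftarrow>Ps. \<bar>\<xi> P x\<bar>) \<le> (\<Sum>P\<leftarrow>Ps. norm_functional (P \<bar>x\<bar>))"
      unfolding \<xi>_def using P(3) by (intro sum_list_mono positive_map_norm_functional_le) auto
    also have "\<dots> = norm x"
      using sum_list_norm_functional_partition[OF Ps] by (simp add: norm_functional_of_abs)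
    finally show ?thesis .
  qed
  have "linear W"
  proof (rule linearI)
    have "(\<Sum>P\<leftarrow>Qs. \<xi> P (x + y) *\<^sub>R \<tau> P) = (\<Sum>P\<leftarrow>Qs. \<xi> P x *\<^sub>R \<tau> P) + (\<Sum>P\<leftarrow>Qs. \<xi> P y *\<^sub>R \<tau> P)"
      if "set Qs \<subseteq> set Ps" for Qs x y
      using that by (induction Qs)
        (simp_all add: \<xi>_def linear_add[OF P(1)] norm_functional_simps scaleR_left_distrib)
    then show "W (x + y) = W x + W y" for x y
      unfolding W_def by blast
    have "(\<Sum>P\<leftarrow>Qs. \<xi> P (r *\<^sub>R x) *\<^sub>R \<tau> P) = r *\<^sub>R (\<Sum>P\<leftarrow>Qs. \<xi> P x *\<^sub>R \<tau> P)"
      if "set Qs \<subseteq> set Ps" for Qs r x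
      using that by (induction Qs)
        (simp_all add: \<xi>_def linear_scale[OF P(1)] norm_functional_simps scaleR_right_distrib)
    then show "W (r *\<^sub>R x) = r *\<^sub>R W x" for r x
      unfolding W_def by blast
  qed
  moreover have "\<bar>re_part (W x)\<bar> \<le> norm x *\<^sub>R g \<and> \<bar>im_part (W x)\<bar> \<le> norm x *\<^sub>R g" for x
  proof -
    have part: "\<bar>\<Sum>P\<leftarrow>Ps. \<xi> P x *\<^sub>R v P\<bar> \<le> norm x *\<^sub>R g" if "\<And>P. \<bar>v P\<bar> \<le> g" for v :: "_ \<Rightarrow> 'f"
    proof -
      have "\<bar>\<Sum>P\<leftarrow>Ps. \<xi> P x *\<^sub>R v P\<bar> \<le> (\<Sum>P\<leftarrow>Ps. \<bar>\<xi> P x *\<^sub>R v P\<bar>)"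
        by (rule abs_sum_list_le)
      also have "\<dots> \<le> (\<Sum>P\<leftarrow>Ps. \<bar>\<xi> P x\<bar> *\<^sub>R g)"
        using that by (intro sum_list_mono order_trans[OF abs_scaleR_le] scaleR_left_mono) auto
      also have "\<dots> = (\<Sum>P\<leftarrow>Ps. \<bar>\<xi> P x\<bar>) *\<^sub>R g"
        by (induction Ps) (simp_all add: scaleR_left_distrib)
      also have "\<dots> \<le> norm x *\<^sub>R g"
        by (intro scaleR_right_mono \<xi>_sum g)
      finally show ?thesis .
    qed
    have re: "re_part (\<Sum>P\<leftarrow>Qs. \<xi> P x *\<^sub>R \<tau> P) = (\<Sum>P\<leftarrow>Qs. \<xi> P x *\<^sub>R re_part (\<tau> P))"
      and im: "im_part (\<Sum>P\<leftarrow>Qs. \<xi> P x *\<^sub>R \<tau> P) = (\<Sum>P\<leftarrow>Qs. \<xi> P x *\<^sub>R im_part (\<tau> P))" for Qs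
      by (induction Qs) simp_all
    show ?thesis
      unfolding W_def re im using \<tau> by (intro conjI part)
  qed
  moreover have "norm (T x - W x) \<le> c * norm x + \<epsilon>" if x: "x \<in> A" for x
  proof -
    note linT = bounded_linear.linear[OF T]
    define Q where "Q = (\<Sum>P\<leftarrow>Ps. \<xi> P x *\<^sub>R u P)"
    have "norm (P x - \<xi> P x *\<^sub>R u P) \<le> 2 * \<eta> * norm_functional (P e)" if "P \<in> set Ps" for P
    proof -
      let ?d = "P x - a P x *\<^sub>R P e"
      have d: "norm ?d \<le> \<eta> * norm_functional (P e)"
        using norm_le_of_abs_le[OF a[OF that x]] by (simp add: norm_functional_simps)
      have "\<bar>norm_functional ?d\<bar> \<le> norm ?d"
        using norm_functional_abs[of ?d] by (simp add: norm_functional_of_abs)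
      moreover have "\<xi> P x - a P x * norm (P e) = norm_functional ?d"
        using P(2)[OF that] by (simp add: \<xi>_def norm_functional_simps norm_functional_pos)
      ultimately have "\<bar>a P x * norm (P e) - \<xi> P x\<bar> * norm (u P) \<le> \<eta> * norm_functional (P e) * 1"
        using d u(2)[OF that] by (intro mult_mono) auto
      moreover have split: "P x - \<xi> P x *\<^sub>R u P = ?d + (a P x * norm (P e) - \<xi> P x) *\<^sub>R u P"
        using arg_cong[OF Pe[of P], of "scaleR (a P x)"] by (simp add: scaleR_left_diff_distrib)
      ultimately show ?thesis
        unfolding split using d by (intro order_trans[OF norm_triangle_ineq]) simp
    qed
    then have "(\<Sum>P\<leftarrow>Ps. norm (P x - \<xi> P x *\<^sub>R u P)) \<le> (\<Sum>P\<leftarrow>Ps. 2 * \<eta> * norm_functional (P e))"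
      by (rule sum_list_mono)
    also have "\<dots> = 2 * \<eta> * norm e"
      using sum_list_norm_functional_partition[OF Ps, of e] e0
      by (simp add: sum_list_const_mult norm_functional_pos)
    finally have "norm (\<Sum>P\<leftarrow>Ps. P x - \<xi> P x *\<^sub>R u P) \<le> 2 * \<eta> * norm e"
      by (rule order_trans[OF norm_sum_list_le])
    moreover have "(\<Sum>P\<leftarrow>Ps. P x - \<xi> P x *\<^sub>R u P) = x - Q"
      using Ps by (simp add: Q_def sum_list_subtractf positive_partition_def)
    ultimately have "norm (x - Q) \<le> 2 * \<eta> * norm e"
      by simp
    then have "K * norm (x - Q) \<le> K * (2 * \<eta> * norm e)"
      using K by (intro mult_left_mono) auto
    then have 1: "norm (T (x - Q)) \<le> \<epsilon> / 2"
      using TK[of "x - Q"] \<eta> by linarith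
    have "T Q - W x = (\<Sum>P\<leftarrow>Ps. \<xi> P x *\<^sub>R (T (u P) - \<tau> P))"
      by (simp add: Q_def W_def linear_sum_list[OF linT] linear_scale[OF linT] scaleR_right_diff_distrib sum_list_subtractf)
    also have "norm \<dots> \<le> (\<Sum>P\<leftarrow>Ps. \<bar>\<xi> P x\<bar> * (c + \<delta>))"
    proof (rule order_trans[OF norm_sum_list_le sum_list_mono])
      fix P assume "P \<in> set Ps"
      then have "norm (T (u P) - \<tau> P) \<le> c + \<delta>"
        using \<tau>(3)[of P] trunc[OF u] by fastforce
      then show "norm (\<xi> P x *\<^sub>R (T (u P) - \<tau> P)) \<le> \<bar>\<xi> P x\<bar> * (c + \<delta>)"
        by (simp add: mult_left_mono)
    qed
    also have "\<dots> = (\<Sum>P\<leftarrow>Ps. \<bar>\<xi> P x\<bar>) * (c + \<delta>)"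
      by (rule sum_list_mult_const)
    also have "\<dots> \<le> norm x * (c + \<delta>)"
      using c pos by (intro mult_right_mono \<xi>_sum) auto
    also have "\<dots> \<le> c * norm x + \<delta> * norm e"
      using norm_pos_mono[OF abs_ge_zero xe[OF x]] pos(2)
      by (simp add: norm_abs_lattice distrib_left mult.commute mult_left_mono)
    finally have 2: "norm (T Q - W x) \<le> c * norm x + \<epsilon> / 2"
      using \<delta> by linarith
    have split: "T x - W x = T (x - Q) + (T Q - W x)"
      by (simp add: linear_diff[OF linT])
    show ?thesis
      unfolding split using 1 2 by (intro order_trans[OF norm_triangle_ineq]) simp
  qed
  ultimately show ?thesis
    by blast
qed

text \<open>
  An accumulation point of the approximate operators, in the product over all \<open>x\<close> of the weak topologies:
  the boxes that contain the values are weakly compact, and linearity and the norm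
  estimate are closed conditions since they can be tested with functionals. The finite intersection
  property is the preceding lemma.
\<close>

theorem truncated_operator:
  fixes T :: "'e::al_space \<Rightarrow> 'f::al_space complexification"
  assumes T: "bounded_linear T" and c: "0 \<le> c" and g: "0 \<le> g"
    and trunc: "\<And>u. 0 \<le> u \<Longrightarrow> norm u \<le> 1 \<Longrightarrow> norm (pprt (modulus (T u) - g)) \<le> c"
  shows "\<exists>W. linear W \<and> (\<forall>x. \<bar>re_part (W x)\<bar> \<le> norm x *\<^sub>R g \<and> \<bar>im_part (W x)\<bar> \<le> norm x *\<^sub>R g) \<and>
    (\<forall>x. norm (T x - W x) \<le> c * norm x)"
proof -
  interpret C: hahn_banach_space "cscale :: complex \<Rightarrow> 'f complexification \<Rightarrow> _"
    by (rule hahn_banach_space_cscale)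
  let ?weak = "weak_topology (cscale :: complex \<Rightarrow> 'f complexification \<Rightarrow> _)"
  let ?X = "product_topology (\<lambda>_::'e. ?weak) UNIV"
  have topX: "topspace ?X = UNIV"
    by (simp add: C.topspace_weak_topology)
  define box where "box x = {z. \<bar>re_part z\<bar> \<le> norm x *\<^sub>R g \<and> \<bar>im_part z\<bar> \<le> norm x *\<^sub>R g}" for x :: 'e
  define \<Phi> where "\<Phi> = {\<phi> :: 'f complexification \<Rightarrow> complex. bounded_operator cscale (*) \<phi> \<and> (\<forall>z. cmod (\<phi> z) \<le> norm z)}"
  have ev: "continuous_map ?X euclidean (\<lambda>w. \<phi> (w x))" if "\<phi> \<in> \<Phi>" for \<phi> x
  proof -
    have proj: "continuous_map ?X ?weak (\<lambda>w. w x)"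
      by (rule continuous_map_product_projection) simp
    have "continuous_map ?weak euclidean \<phi>"
      using that by (intro C.continuous_map_functional) (simp add: \<Phi>_def)
    from continuous_map_compose[OF proj this] show ?thesis
      by (simp only: o_def)
  qed
  have \<Phi>_op: "bounded_operator cscale (*) \<phi>" and \<Phi>_le: "cmod (\<phi> z) \<le> norm z" if "\<phi> \<in> \<Phi>" for \<phi> z
    using that unfolding \<Phi>_def by blast+
  have \<Phi>_scale: "\<phi> (r *\<^sub>R z) = of_real r * \<phi> z" if "\<phi> \<in> \<Phi>" for \<phi> r z
    using bounded_operatorD(3)[OF \<Phi>_op[OF that], of "of_real r" z] by (simp add: cscale_of_real)
  note \<Phi>_add = bounded_operatorD(1)[OF \<Phi>_op] and \<Phi>_diff = bounded_operatorD(2)[OF \<Phi>_op]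
  have norming: "\<exists>\<phi>\<in>\<Phi>. cmod (\<phi> z) = norm z" for z
    using C.norming_functional[of z] by (auto simp: \<Phi>_def)
  have sep: "z = z'" if "\<And>\<phi>. \<phi> \<in> \<Phi> \<Longrightarrow> \<phi> z = \<phi> z'" for z z'
  proof -
    obtain \<phi> where \<phi>: "\<phi> \<in> \<Phi>" "cmod (\<phi> (z - z')) = norm (z - z')"
      using norming by blast
    then show ?thesis
      using that[OF \<phi>(1)] \<Phi>_diff[OF \<phi>(1), of z z'] by simp
  qed
  have zero_closed: "closedin ?X {w. f w = (0::complex)}" if "continuous_map ?X euclidean f" for f
    using closedin_continuous_map_preimage[OF that, of "{0}"] unfolding topX by simp
  have zero_\<Phi>: "(\<lambda>_. 0) \<in> \<Phi>"
    using C.zero_functional by (simp add: \<Phi>_def)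
  let ?add = "\<lambda>(\<phi>, x, y). {w :: 'e \<Rightarrow> 'f complexification. \<phi> (w (x + y)) - (\<phi> (w x) + \<phi> (w y)) = (0::complex)}"
  let ?scale = "\<lambda>(\<phi>, r, x). {w :: 'e \<Rightarrow> 'f complexification. \<phi> (w (r *\<^sub>R x)) - of_real r * \<phi> (w x) = (0::complex)}"
  have lin_eq: "{w. linear w} = (\<Inter>i\<in>\<Phi> \<times> UNIV. ?add i) \<inter> (\<Inter>i\<in>\<Phi> \<times> UNIV. ?scale i)"
  proof (intro equalityI subsetI)
    fix w :: "'e \<Rightarrow> 'f complexification" assume "w \<in> {w. linear w}"
    then have lin: "linear w"
      by simp
    show "w \<in> (\<Inter>i\<in>\<Phi> \<times> UNIV. ?add i) \<inter> (\<Inter>i\<in>\<Phi> \<times> UNIV. ?scale i)"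
      by (auto simp: linear_add[OF lin] linear_scale[OF lin] \<Phi>_add \<Phi>_scale)
  next
    fix w assume w: "w \<in> (\<Inter>i\<in>\<Phi> \<times> UNIV. ?add i) \<inter> (\<Inter>i\<in>\<Phi> \<times> UNIV. ?scale i)"
    have "linear w"
    proof (rule linearI)
      show "w (x + y) = w x + w y" for x y
      proof (rule sep)
        fix \<phi> assume "\<phi> \<in> \<Phi>"
        then have "w \<in> ?add (\<phi>, x, y)"
          using w by blast
        with \<open>\<phi> \<in> \<Phi>\<close> show "\<phi> (w (x + y)) = \<phi> (w x + w y)"
          by (simp add: \<Phi>_add)
      qed
      show "w (r *\<^sub>R x) = r *\<^sub>R w x" for r x
      proof (rule sep)
        fix \<phi> assume "\<phi> \<in> \<Phi>"
        then have "w \<in> ?scale (\<phi>, r, x)"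
          using w by blast
        with \<open>\<phi> \<in> \<Phi>\<close> show "\<phi> (w (r *\<^sub>R x)) = \<phi> (r *\<^sub>R w x)"
          by (simp add: \<Phi>_scale)
      qed
    qed
    then show "w \<in> {w. linear w}"
      by simp
  qed
  have "closedin ?X (\<Inter>i\<in>\<Phi> \<times> UNIV. ?add i)"
  proof (rule closedin_INT)
    fix i :: "('f complexification \<Rightarrow> complex) \<times> 'e \<times> 'e" assume "i \<in> \<Phi> \<times> UNIV"
    then obtain \<phi> x y where i: "i = (\<phi>, x, y)" and "\<phi> \<in> \<Phi>"
      by auto
    show "closedin ?X (?add i)"
      unfolding i prod.case
      by (intro zero_closed continuous_map_diff continuous_map_add ev \<open>\<phi> \<in> \<Phi>\<close>)
  qed (use zero_\<Phi> in auto)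
  moreover have "closedin ?X (\<Inter>i\<in>\<Phi> \<times> UNIV. ?scale i)"
  proof (rule closedin_INT)
    fix i :: "('f complexification \<Rightarrow> complex) \<times> real \<times> 'e" assume "i \<in> \<Phi> \<times> UNIV"
    then obtain \<phi> r x where i: "i = (\<phi>, r, x)" "\<phi> \<in> \<Phi>"
      by auto
    have "continuous_map euclidean euclidean (\<lambda>z. complex_of_real r * z)"
      by (auto intro!: continuous_intros)
    from continuous_map_compose[OF ev[OF i(2)] this, of x]
    have "continuous_map ?X euclidean (\<lambda>w. complex_of_real r * \<phi> (w x))"
      by (simp only: o_def)
    from zero_closed[OF continuous_map_diff[OF ev[OF i(2)] this]]
    show "closedin ?X (?scale i)"
      unfolding i(1) prod.case .
  qed (use zero_\<Phi> in auto)
  ultimately have closed_lin: "closedin ?X {w. linear w}"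
    unfolding lin_eq by (rule closedin_Int)
  have closed_near: "closedin ?X {w. norm (T x - w x) \<le> b}" for x b
  proof -
    have "{w. norm (T x - w x) \<le> b} = (\<Inter>\<phi>\<in>\<Phi>. {w. \<phi> (T x) - \<phi> (w x) \<in> cball 0 b})"
    proof (intro equalityI subsetI)
      fix w :: "'e \<Rightarrow> 'f complexification" assume "w \<in> {w. norm (T x - w x) \<le> b}"
      then show "w \<in> (\<Inter>\<phi>\<in>\<Phi>. {w. \<phi> (T x) - \<phi> (w x) \<in> cball 0 b})"
        using \<Phi>_le by (auto simp flip: \<Phi>_diff intro: order_trans)
    next
      fix w assume w: "w \<in> (\<Inter>\<phi>\<in>\<Phi>. {w. \<phi> (T x) - \<phi> (w x) \<in> cball 0 b})"
      obtain \<phi> where "\<phi> \<in> \<Phi>" "cmod (\<phi> (T x - w x)) = norm (T x - w x)"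
        using norming by blast
      moreover have "\<phi> (T x) - \<phi> (w x) \<in> cball 0 b"
        using w \<open>\<phi> \<in> \<Phi>\<close> by blast
      ultimately show "w \<in> {w. norm (T x - w x) \<le> b}"
        by (simp add: \<Phi>_diff)
    qed
    moreover have "closedin ?X (\<Inter>\<phi>\<in>\<Phi>. {w. \<phi> (T x) - \<phi> (w x) \<in> cball 0 b})"
    proof (rule closedin_INT)
      fix \<phi> assume "\<phi> \<in> \<Phi>"
      then have "continuous_map ?X euclidean (\<lambda>w. \<phi> (T x) - \<phi> (w x))"
        by (intro continuous_map_diff[OF _ ev]) auto
      from closedin_continuous_map_preimage[OF this, of "cball 0 b"]
      show "closedin ?X {w. \<phi> (T x) - \<phi> (w x) \<in> cball 0 b}"
        unfolding topX by simp
    qed (use zero_\<Phi> in auto)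
    ultimately show ?thesis
      by simp
  qed
  have cpt: "compactin ?X (PiE UNIV box)"
    unfolding compactin_PiE box_def by (intro disjI2 ballI compactin_order_box)
  define Z where "Z = (\<lambda>(x, n::nat). {w. linear w} \<inter> {w. norm (T x - w x) \<le> c * norm x + inverse (real (Suc n))})"
  have closed_Z: "closedin ?X (Z i)" for i
    unfolding Z_def using closed_lin closed_near by (auto simp: split_beta)
  have fin: "PiE UNIV box \<inter> \<Inter>\<F> \<noteq> {}" if "finite \<F>" "\<F> \<subseteq> range Z" for \<F>
  proof -
    have "\<exists>J. finite J \<and> \<F> = Z ` J"
      using finite_subset_image[OF that] by blast
    then obtain J where J: "finite J" "\<F> = Z ` J"
      by blast
    define N where "N = Max (insert 0 (snd ` J))"
    have "0 < inverse (real (Suc N))"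
      by simp
    then have "\<exists>W. linear W \<and> (\<forall>x. \<bar>re_part (W x)\<bar> \<le> norm x *\<^sub>R g \<and> \<bar>im_part (W x)\<bar> \<le> norm x *\<^sub>R g) \<and>
        (\<forall>x\<in>fst ` J. norm (T x - W x) \<le> c * norm x + inverse (real (Suc N)))"
      using J(1) by (intro approximate_truncated_operator[OF T c g trunc]) auto
    then obtain W where W: "linear W" "\<forall>x. \<bar>re_part (W x)\<bar> \<le> norm x *\<^sub>R g \<and> \<bar>im_part (W x)\<bar> \<le> norm x *\<^sub>R g"
        "\<forall>x\<in>fst ` J. norm (T x - W x) \<le> c * norm x + inverse (real (Suc N))"
      by (elim exE conjE)
    have "W \<in> Z i" if "i \<in> J" for i
    proof -
      have "snd i \<le> N"
        unfolding N_def using that J(1) by (intro Max_ge) auto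
      then have "inverse (real (Suc N)) \<le> inverse (real (Suc (snd i)))"
        by (intro le_imp_inverse_le) auto
      moreover have "norm (T (fst i) - W (fst i)) \<le> c * norm (fst i) + inverse (real (Suc N))"
        using W(3) that by blast
      ultimately have "norm (T (fst i) - W (fst i)) \<le> c * norm (fst i) + inverse (real (Suc (snd i)))"
        by linarith
      then show ?thesis
        using W(1) by (simp add: Z_def split_beta)
    qed
    moreover have "W \<in> PiE UNIV box"
      using W(2) by (simp add: box_def PiE_iff)
    ultimately show ?thesis
      using J(2) by blast
  qed
  have "PiE UNIV box \<inter> \<Inter>(range Z) \<noteq> {}"
  proof (rule cpt[unfolded compactin_fip, THEN conjunct2, THEN spec, THEN mp], intro conjI ballI allI impI)
    show "closedin ?X C" if "C \<in> range Z" for C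
      using that closed_Z by auto
    show "PiE UNIV box \<inter> \<Inter>\<F> \<noteq> {}" if "finite \<F> \<and> \<F> \<subseteq> range Z" for \<F>
      using that fin by simp
  qed
  then obtain W where W: "W \<in> PiE UNIV box" "\<And>i. W \<in> Z i"
    by blast
  have "linear W"
    using W(2)[of "(0, 0)"] by (simp add: Z_def)
  moreover have "\<bar>re_part (W x)\<bar> \<le> norm x *\<^sub>R g \<and> \<bar>im_part (W x)\<bar> \<le> norm x *\<^sub>R g" for x
    using PiE_mem[OF W(1), of x] by (simp add: box_def)
  moreover have "norm (T x - W x) \<le> c * norm x" for x
  proof (rule field_le_epsilon)
    fix e :: real assume "0 < e"
    then obtain n where "inverse (real (Suc n)) < e"
      using reals_Archimedean by blast
    moreover have "norm (T x - W x) \<le> c * norm x + inverse (real (Suc n))"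
      using W(2)[of "(x, n)"] by (simp add: Z_def)
    ultimately show "norm (T x - W x) \<le> c * norm x + e"
      by linarith
  qed
  ultimately show ?thesis
    by blast
qed

section \<open>Operators from and into the space of absolutely summable sequences\<close>

lemma summable_ell1: "summable (\<lambda>n. norm (ell1_nth f n))"
  using ell1_nth[of f] by simp

lemma norm_ell1_nth_le: "norm (ell1_nth f n) \<le> norm f"
  using sum_le_suminf[OF summable_ell1[of f], of "{n}"] by (simp add: norm_ell1.rep_eq)

lemma sum_norm_ell1_nth_le: "finite N \<Longrightarrow> (\<Sum>n\<in>N. norm (ell1_nth f n)) \<le> norm f"
  unfolding norm_ell1.rep_eq by (intro sum_le_suminf summable_ell1) auto

lemma Abs_ell1_bounded:
  fixes h :: "nat \<Rightarrow> 'k::real_normed_field"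
  assumes "\<And>N. (\<Sum>n<N. norm (h n)) \<le> B"
  shows "ell1_nth (Abs_ell1 h) = h" "norm (Abs_ell1 h) \<le> B"
proof -
  have sum: "summable (\<lambda>n. norm (h n))"
    using assms by (intro summableI_nonneg_bounded) auto
  then show *: "ell1_nth (Abs_ell1 h) = h"
    by (intro Abs_ell1_inverse) simp
  show "norm (Abs_ell1 h) \<le> B"
    unfolding norm_ell1.rep_eq * by (intro suminf_le_const sum assms)
qed

lemma norm_ell1_le: "(\<And>N. (\<Sum>n<N. norm (ell1_nth f n)) \<le> B) \<Longrightarrow> norm f \<le> B"
  unfolding norm_ell1.rep_eq by (intro suminf_le_const summable_ell1)

instance ell1 :: ("{real_normed_field,banach}") banach
proof
  fix X :: "nat \<Rightarrow> 'a ell1"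
  assume "Cauchy X"
  have "convergent (\<lambda>k. ell1_nth (X k) n)" for n
  proof -
    have "norm (ell1_nth (X k) n - ell1_nth (X l) n) \<le> norm (X k - X l)" for k l
      using norm_ell1_nth_le[of "X k - X l" n] by (simp add: minus_ell1.rep_eq)
    then have "Cauchy (\<lambda>k. ell1_nth (X k) n)"
      using \<open>Cauchy X\<close> unfolding Cauchy_iff by (meson le_less_trans)
    then show ?thesis
      by (simp add: Cauchy_convergent_iff)
  qed
  then obtain g where g: "\<And>n. (\<lambda>k. ell1_nth (X k) n) \<longlonglongrightarrow> g n"
    unfolding convergent_def by metis
  have bound: "(\<Sum>n<N. norm (ell1_nth (X k) n - g n)) \<le> e"
    if "\<And>l. K \<le> l \<Longrightarrow> norm (X k - X l) \<le> e" for N k K e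
  proof (rule LIMSEQ_le_const2)
    show "(\<lambda>l. \<Sum>n<N. norm (ell1_nth (X k) n - ell1_nth (X l) n)) \<longlonglongrightarrow> (\<Sum>n<N. norm (ell1_nth (X k) n - g n))"
      by (intro tendsto_sum tendsto_norm tendsto_diff tendsto_const g)
    show "\<exists>L. \<forall>l\<ge>L. (\<Sum>n<N. norm (ell1_nth (X k) n - ell1_nth (X l) n)) \<le> e"
      using sum_norm_ell1_nth_le[of "{..<N}" "X k - X _"] that
      by (intro exI[of _ K]) (auto simp: minus_ell1.rep_eq intro: order_trans)
  qed
  have ev: "\<exists>K. \<forall>k\<ge>K. \<forall>l\<ge>K. norm (X k - X l) \<le> e" if "0 < e" for e
    using \<open>Cauchy X\<close> that unfolding Cauchy_iff by (meson less_imp_le)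
  obtain K where K: "\<And>k l. K \<le> k \<Longrightarrow> K \<le> l \<Longrightarrow> norm (X k - X l) \<le> 1"
    using ev[of 1] by auto
  define h where "h = Abs_ell1 g"
  have "(\<Sum>n<N. norm (g n)) \<le> 1 + norm (X K)" for N
  proof -
    have "(\<Sum>n<N. norm (g n)) \<le> (\<Sum>n<N. norm (ell1_nth (X K) n - g n) + norm (ell1_nth (X K) n))"
      by (intro sum_mono) (metis add.commute norm_minus_commute norm_triangle_sub)
    also have "\<dots> \<le> 1 + norm (X K)"
      unfolding sum.distrib by (intro add_mono bound[of K] sum_norm_ell1_nth_le K) auto
    finally show ?thesis .
  qed
  from Abs_ell1_bounded(1)[OF this] have h: "ell1_nth h = g"
    by (simp add: h_def)
  have "X \<longlonglongrightarrow> h"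
  proof (rule LIMSEQ_I)
    fix r :: real assume "0 < r"
    then obtain L where L: "\<And>k l. L \<le> k \<Longrightarrow> L \<le> l \<Longrightarrow> norm (X k - X l) \<le> r / 2"
      using ev[of "r / 2"] by auto
    have "norm (X k - h) \<le> r / 2" if "L \<le> k" for k
    proof (rule norm_ell1_le)
      show "(\<Sum>n<N. norm (ell1_nth (X k - h) n)) \<le> r / 2" for N
        using bound[of L k "r / 2" N] L that by (simp add: minus_ell1.rep_eq h)
    qed
    then show "\<exists>no. \<forall>n\<ge>no. norm (X n - h) < r"
      using \<open>0 < r\<close> by (intro exI[of _ L]) force
  qed
  then show "convergent X"
    by (auto simp: convergent_def)
qed

definition ell1_unit :: "nat \<Rightarrow> 'k::real_normed_field ell1" where
  "ell1_unit m = Abs_ell1 (\<lambda>n. if n = m then 1 else 0)"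

lemma ell1_nth_unit: "ell1_nth (ell1_unit m :: 'k::real_normed_field ell1) = (\<lambda>n. if n = m then 1 else 0)"
  and norm_ell1_unit_le: "norm (ell1_unit m :: 'k ell1) \<le> 1"
proof -
  have *: "(\<Sum>n<N. norm (if n = m then 1 else 0 :: 'k)) \<le> 1" for N
    by (simp add: if_distrib[of norm] sum.delta cong: if_cong)
  show "ell1_nth (ell1_unit m :: 'k ell1) = (\<lambda>n. if n = m then 1 else 0)" "norm (ell1_unit m :: 'k ell1) \<le> 1"
    unfolding ell1_unit_def using Abs_ell1_bounded[OF *] by auto
qed

lemma ell1_nth_sum: "ell1_nth (\<Sum>i\<in>I. f i) n = (\<Sum>i\<in>I. ell1_nth (f i) n)"
  by (induction I rule: infinite_finite_induct) (simp_all add: zero_ell1.rep_eq plus_ell1.rep_eq)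

lemma ell1_partial_sums:
  fixes f :: "'k::real_normed_field ell1"
  shows "(\<lambda>N. \<Sum>m<N. ell1_scale (ell1_nth f m) (ell1_unit m)) \<longlonglongrightarrow> f"
proof -
  have "norm (f - (\<Sum>m<N. ell1_scale (ell1_nth f m) (ell1_unit m))) \<le> (\<Sum>k. norm (ell1_nth f (k + N)))" for N
  proof (rule norm_ell1_le)
    fix M
    have nth: "ell1_nth (f - (\<Sum>m<N. ell1_scale (ell1_nth f m) (ell1_unit m))) n = (if n < N then 0 else ell1_nth f n)" for n
      by (simp add: minus_ell1.rep_eq ell1_nth_sum ell1_scale.rep_eq ell1_nth_unit if_distrib sum.delta cong: if_cong)
    have "(\<Sum>n<M. norm (ell1_nth (f - (\<Sum>m<N. ell1_scale (ell1_nth f m) (ell1_unit m))) n)) =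
        (\<Sum>n\<in>{N..<M}. norm (ell1_nth f n))"
      unfolding nth by (intro sum.mono_neutral_cong_right) auto
    also have "\<dots> \<le> (\<Sum>n\<in>{N..<M + N}. norm (ell1_nth f n))"
      by (intro sum_mono2) auto
    also have "\<dots> = (\<Sum>k<M. norm (ell1_nth f (k + N)))"
      using sum.shift_bounds_nat_ivl[of "\<lambda>n. norm (ell1_nth f n)" 0 N M] by (simp add: atLeast0LessThan)
    also have "\<dots> \<le> (\<Sum>k. norm (ell1_nth f (k + N)))"
      by (intro sum_le_suminf summable_ignore_initial_segment summable_ell1) auto
    finally show "(\<Sum>n<M. norm (ell1_nth (f - (\<Sum>m<N. ell1_scale (ell1_nth f m) (ell1_unit m))) n)) \<le>
        (\<Sum>k. norm (ell1_nth f (k + N)))" .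
  qed
  then have "(\<lambda>N. (\<Sum>m<N. ell1_scale (ell1_nth f m) (ell1_unit m)) - f) \<longlonglongrightarrow> 0"
    by (intro Lim_null_comparison[OF _ suminf_exist_split2[OF summable_ell1[of f]]])
      (simp add: norm_minus_commute)
  then show ?thesis
    by (rule LIM_zero_cancel)
qed

lemma bounded_operator_sum:
  "bounded_operator s t f \<Longrightarrow> f (\<Sum>i\<in>I. g i) = (\<Sum>i\<in>I. f (g i))"
  by (induction I rule: infinite_finite_induct) (simp_all add: bounded_operatorD(1,4))

text \<open>
  The unit ball of the sequence space is the closed absolutely convex hull of the unit vectors.
\<close>

lemma ell1_operator_bound:
  fixes B :: "'k::{real_normed_field,banach} ell1 \<Rightarrow> 'y::real_normed_vector"
  assumes B: "bounded_operator ell1_scale t B" and t: "scaled_space t"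
    and unit: "\<And>m. norm (B (ell1_unit m)) \<le> b"
  shows "norm (B f) \<le> b * norm f"
proof -
  interpret t: scaled_space t by fact
  have b: "0 \<le> b"
    using unit[of 0] norm_ge_zero order_trans by blast
  have "norm (B (\<Sum>m<N. ell1_scale (ell1_nth f m) (ell1_unit m))) \<le> b * norm f" for N
  proof -
    have "norm (B (\<Sum>m<N. ell1_scale (ell1_nth f m) (ell1_unit m))) \<le>
        (\<Sum>m<N. norm (ell1_nth f m) * norm (B (ell1_unit m)))"
      unfolding bounded_operator_sum[OF B] bounded_operatorD(3)[OF B] t.norm_scale[symmetric] by (rule norm_sum)
    also have "\<dots> \<le> (\<Sum>m<N. norm (ell1_nth f m) * b)"
      by (intro sum_mono mult_left_mono unit) auto
    also have "\<dots> \<le> b * norm f"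
      using sum_norm_ell1_nth_le[of "{..<N}" f] b
      by (simp add: mult.commute mult_left_mono flip: sum_distrib_left)
    finally show ?thesis .
  qed
  moreover have "(\<lambda>N. norm (B (\<Sum>m<N. ell1_scale (ell1_nth f m) (ell1_unit m)))) \<longlonglongrightarrow> norm (B f)"
    by (intro tendsto_norm bounded_linear.tendsto[OF bounded_operatorD(5)[OF B]] ell1_partial_sums)
  ultimately show ?thesis
    by (intro LIMSEQ_le_const2) auto
qed

lemma ell1_synthesis:
  fixes s :: "'k::{real_normed_field,banach} \<Rightarrow> 'y::banach \<Rightarrow> 'y"
  assumes s: "scaled_space s" and x: "\<And>n. norm (x n) \<le> 1"
  shows "\<exists>V. bounded_operator ell1_scale s V \<and> (\<forall>f. norm (V f) \<le> norm f) \<and> (\<forall>m. V (ell1_unit m) = x m)"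
proof -
  interpret s: scaled_space s by fact
  interpret vector_space s by (rule s.vector_space)
  define V where "V f = (\<Sum>n. s (ell1_nth f n) (x n))" for f
  have le: "norm (s (ell1_nth f n) (x n)) \<le> norm (ell1_nth f n)" for f n
    using mult_left_mono[OF x, of "norm (ell1_nth f n)" n] by (simp add: s.norm_scale)
  have sumnorm: "summable (\<lambda>n. norm (s (ell1_nth f n) (x n)))" for f
    by (rule summable_comparison_test'[OF summable_ell1[of f], of 0]) (use le in simp)
  then have sum: "summable (\<lambda>n. s (ell1_nth f n) (x n))" for f
    by (rule summable_norm_cancel)
  have bound: "norm (V f) \<le> 1 * norm f" for f
  proof -
    have "norm (V f) \<le> (\<Sum>n. norm (s (ell1_nth f n) (x n)))"
      unfolding V_def by (rule summable_norm[OF sumnorm])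
    also have "\<dots> \<le> (\<Sum>n. norm (ell1_nth f n))"
      by (intro suminf_le sumnorm summable_ell1 le)
    finally show ?thesis
      by (simp add: norm_ell1.rep_eq)
  qed
  have blin: "bounded_linear (s c)" for c
  proof (rule bounded_linear_intro[of _ "norm c"])
    show "s c (r *\<^sub>R y) = r *\<^sub>R s c y" for r y
      by (simp flip: s.scale_of_real add: scale_left_commute)
  qed (simp_all add: scale_right_distrib s.norm_scale mult.commute)
  have "bounded_operator ell1_scale s V"
  proof (rule bounded_operatorI[OF scaled_space_ell1 s])
    show "V (f + g) = V f + V g" for f g
      unfolding V_def by (simp add: plus_ell1.rep_eq scale_left_distrib suminf_add[OF sum sum])
    show "V (ell1_scale c f) = s c (V f)" for c f
      unfolding V_def bounded_linear.suminf[OF blin sum] by (simp add: ell1_scale.rep_eq)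
  qed (rule bound)
  moreover have "V (ell1_unit m) = x m" for m
  proof -
    have "V (ell1_unit m) = (\<Sum>n\<in>{m}. s (ell1_nth (ell1_unit m) n) (x n))"
      unfolding V_def by (rule suminf_finite) (auto simp: ell1_nth_unit)
    then show ?thesis
      by (simp add: ell1_nth_unit)
  qed
  ultimately show ?thesis
    using bound by (intro exI[of _ V]) simp
qed

lemma ell1_analysis:
  fixes s :: "'k::{real_normed_field,banach} \<Rightarrow> 'y::real_normed_vector \<Rightarrow> 'y"
  assumes s: "scaled_space s" and \<phi>: "\<And>n. bounded_operator s (*) (\<phi> n)"
    and sum: "\<And>y N. (\<Sum>n<N. norm (\<phi> n y)) \<le> K * norm y"
  shows "\<exists>U. bounded_operator s ell1_scale U \<and> (\<forall>y. norm (U y) \<le> K * norm y) \<and> (\<forall>y n. ell1_nth (U y) n = \<phi> n y)"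
proof -
  define U where "U y = Abs_ell1 (\<lambda>n. \<phi> n y)" for y
  have nth: "ell1_nth (U y) n = \<phi> n y" and bound: "norm (U y) \<le> K * norm y" for y n
    using Abs_ell1_bounded[OF sum] by (simp_all add: U_def)
  have "bounded_operator s ell1_scale U"
  proof (rule bounded_operatorI[OF s scaled_space_ell1])
    show "U (x + y) = U x + U y" for x y
      by (rule ell1_nth_inject[THEN iffD1]) (simp add: fun_eq_iff nth plus_ell1.rep_eq bounded_operatorD(1)[OF \<phi>])
    show "U (s c x) = ell1_scale c (U x)" for c x
      by (rule ell1_nth_inject[THEN iffD1]) (simp add: fun_eq_iff nth ell1_scale.rep_eq bounded_operatorD(3)[OF \<phi>])
  qed (rule bound)
  then show ?thesis
    using nth bound by (intro exI[of _ U]) simp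
qed

text \<open>
  Solving \<open>A f = g\<close> is finding a fixed point of the contraction \<open>f \<mapsto> g - (A f - f)\<close>.
\<close>

lemma ell1_near_identity_invertible:
  fixes A :: "'k::{real_normed_field,banach} ell1 \<Rightarrow> 'k ell1"
  assumes A: "bounded_operator ell1_scale ell1_scale A" and \<eta>: "0 \<le> \<eta>" "\<eta> < 1"
    and near: "\<And>f. norm (A f - f) \<le> \<eta> * norm f"
  shows "\<exists>B. bounded_operator ell1_scale ell1_scale B \<and> (\<forall>f. B (A f) = f) \<and> (\<forall>f. norm (B f) \<le> norm f / (1 - \<eta>))"
proof -
  have lower: "(1 - \<eta>) * norm f \<le> norm (A f)" for f
    using near[of f] norm_triangle_ineq2[of f "A f"] by (simp add: norm_minus_commute left_diff_distrib)
  have inj: "f = g" if "A f = A g" for f g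
    using lower[of "f - g"] that \<eta>(2) by (simp add: bounded_operatorD(2)[OF A] mult_le_0_iff)
  have surj: "\<exists>f. A f = g" for g
  proof -
    have "\<exists>!f. g - (A f - f) = f"
    proof (rule banach_fix_type[OF \<eta>], intro allI)
      fix f h
      have "g - (A f - f) - (g - (A h - h)) = - (A (f - h) - (f - h))"
        by (simp add: bounded_operatorD(2)[OF A])
      then show "dist (g - (A f - f)) (g - (A h - h)) \<le> \<eta> * dist f h"
        using near[of "f - h"] by (simp only: dist_norm norm_minus_cancel)
    qed
    then show ?thesis
      by (auto simp: algebra_simps)
  qed
  define B where "B g = (SOME f. A f = g)" for g
  have AB: "A (B g) = g" for g
    unfolding B_def by (rule someI_ex[OF surj])
  have BA: "B (A f) = f" for f
    by (rule inj) (rule AB)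
  have bound: "norm (B f) \<le> norm f / (1 - \<eta>)" for f
    using lower[of "B f"] \<eta>(2) by (simp add: AB pos_le_divide_eq mult.commute)
  have "bounded_operator ell1_scale ell1_scale B"
  proof (rule bounded_operatorI[OF scaled_space_ell1 scaled_space_ell1])
    show "B (f + g) = B f + B g" for f g
      by (rule inj) (simp add: AB bounded_operatorD(1)[OF A])
    show "B (ell1_scale c f) = ell1_scale c (B f)" for c f
      by (rule inj) (simp add: AB bounded_operatorD(3)[OF A])
    show "norm (B f) \<le> inverse (1 - \<eta>) * norm f" for f
      using bound[of f] by (simp add: divide_inverse mult.commute)
  qed
  then show ?thesis
    using BA bound by (intro exI[of _ B]) simp
qed

section \<open>Factorizations of the identity of the sequence space\<close>

text \<open>
  Kupka's proof of Rosenthal's lemma. Split the natural numbers into infinitely many infinite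
  sets \<open>M p\<close>. If the restriction of the matrix to some \<open>M p\<close> has small row sums off the diagonal,
  its enumeration is the required sequence. Otherwise each \<open>M p\<close> has a row \<open>k p\<close> with a sum greater
  than \<open>\<epsilon>\<close> over entries of \<open>M p\<close> other than \<open>k p\<close>; these entries are lost when rows and columns
  are restricted to the numbers \<open>k p\<close>, so the row sums drop by \<open>\<epsilon>\<close>. This can happen only \<open>j\<close> times.
\<close>

lemma rosenthal_lemma_aux:
  fixes a :: "nat \<Rightarrow> nat \<Rightarrow> real"
  assumes "0 < \<epsilon>" "\<And>m n. 0 \<le> a m n" "\<And>m N. finite N \<Longrightarrow> (\<Sum>n\<in>N. a m n) \<le> real j * \<epsilon>"
  shows "\<exists>\<sigma>::nat \<Rightarrow> nat. inj \<sigma> \<and> (\<forall>m N. finite N \<longrightarrow> m \<notin> N \<longrightarrow> (\<Sum>n\<in>N. a (\<sigma> m) (\<sigma> n)) \<le> \<epsilon>)"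
  using assms(2,3)
proof (induction j arbitrary: a)
  case 0
  have le: "(\<Sum>n\<in>N. a m n) \<le> \<epsilon>" if "finite N" for m N
    using 0(2)[OF that, of m] \<open>0 < \<epsilon>\<close> by simp
  show ?case
    by (rule exI[of _ "\<lambda>n. n"], intro conjI allI impI) (simp, rule le)
next
  case (Suc j)
  define M where "M p = range (\<lambda>i. prod_encode (p, i))" for p
  show ?case
  proof (cases "\<exists>p. \<forall>m\<in>M p. \<forall>N. finite N \<longrightarrow> N \<subseteq> M p - {m} \<longrightarrow> (\<Sum>n\<in>N. a m n) \<le> \<epsilon>")
    case True
    then obtain p where "\<forall>m\<in>M p. \<forall>N. finite N \<longrightarrow> N \<subseteq> M p - {m} \<longrightarrow> (\<Sum>n\<in>N. a m n) \<le> \<epsilon>"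
      by (rule exE)
    note p = this[rule_format]
    let ?\<sigma> = "\<lambda>i. prod_encode (p, i)"
    have inj: "inj ?\<sigma>"
      by (auto intro: injI)
    have "(\<Sum>n\<in>N. a (?\<sigma> m) (?\<sigma> n)) \<le> \<epsilon>" if "finite N" "m \<notin> N" for m N
    proof -
      have "(\<Sum>n\<in>N. a (?\<sigma> m) (?\<sigma> n)) = (\<Sum>n\<in>?\<sigma> ` N. a (?\<sigma> m) n)"
        by (subst sum.reindex) (use inj in \<open>auto simp: inj_def inj_on_def\<close>)
      also have "\<dots> \<le> \<epsilon>"
        using that by (intro p) (auto simp: M_def)
      finally show ?thesis .
    qed
    then show ?thesis
      by (intro exI[of _ ?\<sigma>] conjI allI impI inj)
  next
    case False
    define bad where "bad p m N \<longleftrightarrow> m \<in> M p \<and> finite N \<and> N \<subseteq> M p - {m} \<and> \<epsilon> < (\<Sum>n\<in>N. a m n)" for p m N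
    have "\<forall>p. \<exists>m N. bad p m N"
      using False unfolding bad_def not_less[symmetric] by blast
    then obtain k N where "\<And>p. bad p (k p) (N p)"
      by metis
    then have kN: "k p \<in> M p" "finite (N p)" "N p \<subseteq> M p - {k p}" "\<epsilon> < (\<Sum>n\<in>N p. a (k p) n)" for p
      by (simp_all add: bad_def)
    have disj: "M p \<inter> M q = {}" if "p \<noteq> q" for p q
      using that by (auto simp: M_def)
    have injk: "inj k"
      using disj kN(1) by (intro injI) (metis IntI empty_iff)
    have "\<exists>\<sigma>::nat \<Rightarrow> nat. inj \<sigma> \<and> (\<forall>m Q. finite Q \<longrightarrow> m \<notin> Q \<longrightarrow> (\<Sum>n\<in>Q. a (k (\<sigma> m)) (k (\<sigma> n))) \<le> \<epsilon>)"
    proof (rule Suc.IH)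
      fix p and Q :: "nat set" assume "finite Q"
      have notin: "k q \<notin> N p" for q
        using disj[of p q] kN(1)[of q] kN(3)[of p] by (cases "p = q") auto
      have "(\<Sum>q\<in>Q. a (k p) (k q)) + (\<Sum>n\<in>N p. a (k p) n) = (\<Sum>n\<in>k ` Q. a (k p) n) + (\<Sum>n\<in>N p. a (k p) n)"
        using injk by (subst sum.reindex) (auto simp: inj_on_def inj_def)
      also have "\<dots> = (\<Sum>n\<in>k ` Q \<union> N p. a (k p) n)"
        using \<open>finite Q\<close> kN(2) notin by (intro sum.union_disjoint[symmetric]) auto
      also have "\<dots> \<le> real (Suc j) * \<epsilon>"
        using \<open>finite Q\<close> kN(2) by (intro Suc.prems) auto
      finally show "(\<Sum>q\<in>Q. a (k p) (k q)) \<le> real j * \<epsilon>"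
        using kN(4)[of p] by (simp add: algebra_simps)
    qed (rule Suc.prems)
    then obtain \<sigma> :: "nat \<Rightarrow> nat" where \<sigma>: "inj \<sigma>"
        "\<forall>m Q. finite Q \<longrightarrow> m \<notin> Q \<longrightarrow> (\<Sum>n\<in>Q. a (k (\<sigma> m)) (k (\<sigma> n))) \<le> \<epsilon>"
      by (elim exE conjE)
    show ?thesis
      by (rule exI[of _ "k \<circ> \<sigma>"], rule conjI[OF inj_compose[OF injk \<sigma>(1)]])
        (unfold o_def, rule \<sigma>(2))
  qed
qed

lemma rosenthal_lemma:
  fixes a :: "nat \<Rightarrow> nat \<Rightarrow> real"
  assumes "0 < \<epsilon>" "\<And>m n. 0 \<le> a m n" "\<And>m N. finite N \<Longrightarrow> (\<Sum>n\<in>N. a m n) \<le> K"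
  shows "\<exists>\<sigma>::nat \<Rightarrow> nat. inj \<sigma> \<and> (\<forall>m N. finite N \<longrightarrow> m \<notin> N \<longrightarrow> (\<Sum>n\<in>N. a (\<sigma> m) (\<sigma> n)) \<le> \<epsilon>)"
proof -
  obtain j where "K / \<epsilon> \<le> real j"
    using real_arch_simple by blast
  then have "K \<le> real j * \<epsilon>"
    using \<open>0 < \<epsilon>\<close> by (simp add: pos_divide_le_eq)
  then show ?thesis
    using assms(3) by (intro rosenthal_lemma_aux[OF assms(1,2), where j = j]) (rule order_trans)
qed

text \<open>
  Along the subsequence of Rosenthal's lemma, \<open>U\<^sub>0 T V\<close> has entries \<open>1\<close> on the diagonal and columns
  with sums at most \<open>\<eta>\<close> off the diagonal, hence an inverse \<open>B\<close> of norm at most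
  \<open>1 / (1 - \<eta>)\<close>; then \<open>U = B U\<^sub>0\<close> completes the factorization.
\<close>

theorem factorization_of_biorthogonal_bound:
  fixes T :: "'x::banach \<Rightarrow> 'y::real_normed_vector" and sE :: "'k::{real_normed_field,banach} \<Rightarrow> 'x \<Rightarrow> 'x"
  assumes sE: "scaled_space sE" and sF: "scaled_space sF" and T: "bounded_operator sE sF T"
    and x: "\<And>n::nat. norm (x n) \<le> 1" and \<phi>: "\<And>n. bounded_operator sF (*) (\<phi> n)"
    and sum: "\<And>N y. finite N \<Longrightarrow> (\<Sum>n\<in>N. norm (\<phi> n y)) \<le> norm y"
    and c: "0 < c" "\<And>n. c \<le> norm (\<phi> n (T (x n)))" and \<eta>: "0 < \<eta>" "\<eta> < 1"
  shows "\<exists>v\<in>ell1_factorization_values sE sF T. c * (1 - \<eta>) \<le> v"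
proof -
  have "(\<Sum>n\<in>N. norm (\<phi> n (T (x m)))) \<le> onorm T" if "finite N" for m N
  proof -
    have "norm (T (x m)) \<le> onorm T * 1"
      using x[of m] onorm_pos_le[OF bounded_operatorD(5)[OF T]]
      by (intro order_trans[OF bounded_operatorD(6)[OF T] mult_left_mono])
    then show ?thesis
      using sum[OF that, of "T (x m)"] by simp
  qed
  then obtain \<sigma> :: "nat \<Rightarrow> nat" where \<sigma>: "inj \<sigma>"
      "\<And>m N. finite N \<Longrightarrow> m \<notin> N \<Longrightarrow> (\<Sum>n\<in>N. norm (\<phi> (\<sigma> n) (T (x (\<sigma> m))))) \<le> \<eta> * c"
    using rosenthal_lemma[OF mult_pos_pos[OF \<eta>(1) c(1)], of "\<lambda>m n. norm (\<phi> n (T (x m)))" "onorm T"]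
    by (simp del: sum_norm_le) blast
  define d where "d n = \<phi> (\<sigma> n) (T (x (\<sigma> n)))" for n
  have d: "c \<le> norm (d n)" "d n \<noteq> 0" for n
    using c(1) c(2)[of "\<sigma> n"] by (auto simp: d_def)
  define \<psi> where "\<psi> n y = \<phi> (\<sigma> n) y / d n" for n y
  have norm_\<psi>: "norm (\<psi> n y) \<le> norm (\<phi> (\<sigma> n) y) / c" for n y
    unfolding \<psi>_def norm_divide using d c(1) by (intro divide_left_mono) auto
  have \<psi>: "bounded_operator sF (*) (\<psi> n)" for n
  proof (rule bounded_operatorI[OF sF scaled_space_mult])
    show "norm (\<psi> n y) \<le> (1 / c) * norm y" for y
      using norm_\<psi>[of n y] sum[of "{\<sigma> n}" y] c(1) divide_right_mono[of "norm (\<phi> (\<sigma> n) y)" "norm y" c] by simp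
  qed (simp_all add: \<psi>_def bounded_operatorD(1,3)[OF \<phi>] add_divide_distrib)
  have "(\<Sum>n<N. norm (\<psi> n y)) \<le> (1 / c) * norm y" for N y
  proof -
    have "(\<Sum>n<N. norm (\<psi> n y)) \<le> (\<Sum>n<N. norm (\<phi> (\<sigma> n) y) / c)"
      by (intro sum_mono norm_\<psi>)
    also have "\<dots> = (\<Sum>n\<in>\<sigma> ` {..<N}. norm (\<phi> n y)) / c"
      using inj_on_subset[OF \<sigma>(1)] by (simp add: sum.reindex sum_divide_distrib)
    also have "\<dots> \<le> norm y / c"
      using c(1) by (intro divide_right_mono sum) auto
    finally show ?thesis by simp
  qed
  from ell1_analysis[OF sF \<psi> this] obtain U0 where U0: "bounded_operator sF ell1_scale U0"
      "\<And>y. norm (U0 y) \<le> (1 / c) * norm y" "\<And>y n. ell1_nth (U0 y) n = \<psi> n y"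
    by blast
  from ell1_synthesis[OF sE, of "\<lambda>m. x (\<sigma> m)"] x obtain V where V: "bounded_operator ell1_scale sE V"
      "\<And>f. norm (V f) \<le> norm f" "\<And>m. V (ell1_unit m) = x (\<sigma> m)"
    by blast
  define A where "A = U0 \<circ> (T \<circ> V)"
  have A: "bounded_operator ell1_scale ell1_scale A"
    unfolding A_def by (intro bounded_operator_compose[OF bounded_operator_compose[OF V(1) T] U0(1)])
  have id_op: "bounded_operator ell1_scale ell1_scale (\<lambda>f::'k ell1. f)"
    by (rule bounded_operatorI[OF scaled_space_ell1 scaled_space_ell1, where K = 1]) auto
  have near: "norm (A f - f) \<le> \<eta> * norm f" for f
  proof (rule ell1_operator_bound[OF bounded_operator_diff[OF A id_op] scaled_space_ell1])
    fix m
    show "norm (A (ell1_unit m) - ell1_unit m) \<le> \<eta>"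
    proof (rule norm_ell1_le)
      fix N
      have nth: "ell1_nth (A (ell1_unit m) - ell1_unit m) n = (if n = m then 0 else \<psi> n (T (x (\<sigma> m))))" for n
        using d(2)[of m] by (simp add: minus_ell1.rep_eq ell1_nth_unit A_def U0(3) V(3)) (simp add: \<psi>_def d_def)
      have "(\<Sum>n<N. norm (ell1_nth (A (ell1_unit m) - ell1_unit m) n)) = (\<Sum>n\<in>{..<N} - {m}. norm (\<psi> n (T (x (\<sigma> m)))))"
        unfolding nth by (intro sum.mono_neutral_cong_right) auto
      also have "\<dots> \<le> (\<Sum>n\<in>{..<N} - {m}. norm (\<phi> (\<sigma> n) (T (x (\<sigma> m)))) / c)"
        by (intro sum_mono norm_\<psi>)
      also have "\<dots> = (\<Sum>n\<in>{..<N} - {m}. norm (\<phi> (\<sigma> n) (T (x (\<sigma> m))))) / c"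
        by (simp add: sum_divide_distrib)
      also have "\<dots> \<le> (\<eta> * c) / c"
        using c(1) by (intro divide_right_mono \<sigma>(2)) auto
      finally show "(\<Sum>n<N. norm (ell1_nth (A (ell1_unit m) - ell1_unit m) n)) \<le> \<eta>"
        using c(1) by simp
    qed
  qed
  from ell1_near_identity_invertible[OF A less_imp_le[OF \<eta>(1)] \<eta>(2) near]
  obtain B where B: "bounded_operator ell1_scale ell1_scale B" "\<And>f. B (A f) = f"
      "\<And>f. norm (B f) \<le> norm f / (1 - \<eta>)"
    by blast
  define U where "U = B \<circ> U0"
  have U: "bounded_operator sF ell1_scale U"
    unfolding U_def by (rule bounded_operator_compose[OF U0(1) B(1)])
  have UTV: "U \<circ> T \<circ> V = id"
    using B(2) by (simp add: U_def A_def fun_eq_iff)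
  have "norm (U y) \<le> 1 / (c * (1 - \<eta>)) * norm y" for y
  proof -
    have "norm (U y) \<le> norm (U0 y) / (1 - \<eta>)"
      unfolding U_def o_def by (rule B(3))
    also have "\<dots> \<le> (1 / c * norm y) / (1 - \<eta>)"
      using \<eta>(2) by (intro divide_right_mono U0(2)) auto
    finally show ?thesis
      by simp
  qed
  then have onU: "onorm U \<le> 1 / (c * (1 - \<eta>))"
    using c(1) \<eta>(2) by (intro onorm_bound) auto
  have onV: "onorm V \<le> 1"
    using V(2) by (intro onorm_bound) auto
  have "U (T (V (ell1_unit 0))) \<noteq> 0"
  proof
    assume "U (T (V (ell1_unit 0))) = 0"
    then have "ell1_unit 0 = (0 :: 'k ell1)"
      using UTV by (simp add: fun_eq_iff)
    then have "ell1_nth (ell1_unit 0 :: 'k ell1) 0 = 0"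
      by (simp add: zero_ell1.rep_eq)
    then show False
      by (simp add: ell1_nth_unit)
  qed
  then have "onorm U \<noteq> 0" "onorm V \<noteq> 0"
    using onorm_eq_0[OF bounded_operatorD(5)[OF U]] onorm_eq_0[OF bounded_operatorD(5)[OF V(1)]]
      bounded_operatorD(4)[OF U] bounded_operatorD(4)[OF T] by auto
  then have pos: "0 < onorm U" "0 < onorm V"
    using onorm_pos_le[OF bounded_operatorD(5)[OF U]] onorm_pos_le[OF bounded_operatorD(5)[OF V(1)]] by auto
  have "c * (1 - \<eta>) * 1 \<le> inverse (onorm U) * inverse (onorm V)"
  proof (rule mult_mono)
    show "c * (1 - \<eta>) \<le> inverse (onorm U)"
      using le_imp_inverse_le[OF onU pos(1)] by simp
    show "1 \<le> inverse (onorm V)"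
      using le_imp_inverse_le[OF onV pos(2)] by simp
  qed (use pos in auto)
  moreover have "inverse (onorm U) * inverse (onorm V) \<in> ell1_factorization_values sE sF T"
    unfolding ell1_factorization_values_def using U V(1) UTV
    by (intro CollectI exI[of _ U] exI[of _ V] conjI refl)
  ultimately show ?thesis
    by (intro bexI[of _ "inverse (onorm U) * inverse (onorm V)"]) simp_all
qed

section \<open>Disjoint sequences\<close>

lemma sum_le_suminf_nonneg:
  fixes x :: "nat \<Rightarrow> 'a::banach_lattice"
  assumes "summable x" "\<And>n. 0 \<le> x n"
  shows "(\<Sum>n<N. x n) \<le> suminf x"
proof (rule le_limit)
  show "(\<lambda>_. \<Sum>n<N. x n) \<longlonglongrightarrow> (\<Sum>n<N. x n)"
    by simp
  show "(\<lambda>n. \<Sum>i<n + N. x i) \<longlonglongrightarrow> suminf x"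
    using LIMSEQ_ignore_initial_segment[OF summable_LIMSEQ[OF assms(1)]] .
  show "(\<Sum>n<N. x n) \<le> (\<Sum>i<n + N. x i)" for n
    by (intro sum_mono2 assms(2)) auto
qed

text \<open>
  Where \<open>b > t a\<close>, also \<open>r b > a\<close>.
\<close>

lemma disjoint_of_ratio:
  fixes a b :: "'a::banach_lattice"
  assumes "1 \<le> t" "1 \<le> t * r" "0 \<le> a" "0 \<le> b"
  shows "inf (pprt (b - t *\<^sub>R a)) (pprt (a - r *\<^sub>R b)) = 0"
proof -
  define X where "X = b - t *\<^sub>R a"
  have "t *\<^sub>R (a - r *\<^sub>R b) = t *\<^sub>R a - (t * r) *\<^sub>R b"
    by (simp add: scaleR_right_diff_distrib)
  also have "\<dots> \<le> t *\<^sub>R a - 1 *\<^sub>R b"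
    using assms by (intro diff_left_mono scaleR_right_mono) auto
  also have "\<dots> = - X"
    by (simp add: X_def)
  finally have "inverse t *\<^sub>R t *\<^sub>R (a - r *\<^sub>R b) \<le> inverse t *\<^sub>R (- X)"
    using assms(1) by (intro scaleR_left_mono) auto
  also have "\<dots> \<le> inverse t *\<^sub>R pprt (- X)"
    using assms(1) by (intro scaleR_left_mono) (auto simp: pprt_def)
  also have "\<dots> \<le> 1 *\<^sub>R pprt (- X)"
    using assms(1) by (intro scaleR_right_mono) (auto simp: inverse_le_1_iff)
  finally have "a - r *\<^sub>R b \<le> pprt (- X)"
    using assms(1) by simp
  then have "pprt (a - r *\<^sub>R b) \<le> pprt (- X)"
    by (simp add: pprt_def)
  then have "inf (pprt X) (pprt (a - r *\<^sub>R b)) \<le> inf (pprt X) (pprt (- X))"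
    by (intro inf_mono order_refl)
  also have "\<dots> = 0"
    by (rule inf_pprt_pprt_neg)
  finally show ?thesis
    unfolding X_def by (intro antisym) auto
qed

text \<open>
  From \<open>a n\<close> subtract large multiples of the earlier vectors, as in the assumption, and in
  addition small multiples of the later ones, all at once through the convergent sum
  \<open>s = \<Sum> 2\<^sup>-\<^sup>m a m\<close>. Two of the resulting positive parts are disjoint because the multiples satisfy
  \<open>4\<^sup>m 2\<^sup>-\<^sup>n\<^sup>-\<^sup>m \<ge> 1\<close> for \<open>n < m\<close>, and the loss \<open>2\<^sup>-\<^sup>n \<parallel>s\<parallel>\<close> in norm is negligible from some
  index \<open>n0\<close> on.
\<close>

lemma disjoint_sequence:
  fixes a :: "nat \<Rightarrow> 'a::al_space"
  assumes pos: "\<And>n. 0 \<le> a n" and bound: "\<And>n. norm (a n) \<le> M"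
    and escape: "\<And>n. c < norm (pprt (a n - 4 ^ n *\<^sub>R (\<Sum>j<n. a j)))" and "c' < c"
  shows "\<exists>D n0. (\<forall>n. 0 \<le> D n \<and> D n \<le> a (n + n0) \<and> c' \<le> norm (D n)) \<and>
    (\<forall>m n. m \<noteq> n \<longrightarrow> inf (D m) (D n) = 0)"
proof -
  define x where "x n = (1/2::real) ^ n *\<^sub>R a n" for n
  have x0: "0 \<le> x n" for n
    using pos by (simp add: x_def scaleR_nonneg_nonneg)
  have sum_x: "summable x"
  proof (rule summable_comparison_test'[of "\<lambda>n. (1/2::real) ^ n * M" 0])
    show "summable (\<lambda>n. (1/2::real) ^ n * M)"
      by (intro summable_mult2 summable_geometric) simp
    show "norm (x n) \<le> (1/2) ^ n * M" for n
      using bound[of n] by (simp add: x_def mult_left_mono)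
  qed
  define s where "s = suminf x"
  have x_le: "x n \<le> s" for n
  proof -
    have "x n \<le> (\<Sum>i<Suc n. x i)"
      using sum_nonneg[of "{..<n}" x] x0 by simp
    also have "\<dots> \<le> s"
      unfolding s_def by (intro sum_le_suminf_nonneg sum_x x0)
    finally show ?thesis .
  qed
  have s0: "0 \<le> s"
    using x_le[of 0] x0[of 0] by simp
  define E where "E n = pprt ((a n - 4 ^ n *\<^sub>R (\<Sum>j<n. a j)) - (1/2) ^ n *\<^sub>R s)" for n
  have E_le: "E n \<le> pprt (a n - w)" if "w \<le> 4 ^ n *\<^sub>R (\<Sum>j<n. a j) + (1/2) ^ n *\<^sub>R s" for n w
    unfolding E_def diff_diff_eq using that by (intro pprt_mono diff_left_mono)
  have sum0: "0 \<le> (4::real) ^ n *\<^sub>R (\<Sum>j<n. a j)" for n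
    using pos by (intro scaleR_nonneg_nonneg sum_nonneg) auto
  have s0': "0 \<le> (1/2::real) ^ n *\<^sub>R s" for n
    using s0 by (intro scaleR_nonneg_nonneg) auto
  have E_le_a: "E n \<le> a n" for n
    using E_le[of 0 n] sum0[of n] s0'[of n] pos[of n] by simp
  have disj: "inf (E m) (E n) = 0" if "n < m" for m n
  proof -
    have "(4::real) ^ m *\<^sub>R a n \<le> 4 ^ m *\<^sub>R (\<Sum>j<m. a j)"
      using sum_mono2[of "{..<m}" "{n}" a] pos that by (intro scaleR_left_mono) auto
    then have "E m \<le> pprt (a m - 4 ^ m *\<^sub>R a n)"
      using s0'[of m] by (intro E_le) (simp add: add_increasing2)
    moreover have "E n \<le> pprt (a n - (1/2) ^ (n + m) *\<^sub>R a m)"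
    proof (rule E_le)
      have "(1/2::real) ^ (n + m) *\<^sub>R a m = (1/2) ^ n *\<^sub>R x m"
        by (simp add: x_def power_add)
      also have "\<dots> \<le> (1/2) ^ n *\<^sub>R s"
        by (intro scaleR_left_mono x_le) simp
      finally show "(1/2::real) ^ (n + m) *\<^sub>R a m \<le> 4 ^ n *\<^sub>R (\<Sum>j<n. a j) + (1/2) ^ n *\<^sub>R s"
        using sum0[of n] by (simp add: add_increasing)
    qed
    ultimately have "inf (E m) (E n) \<le> inf (pprt (a m - 4 ^ m *\<^sub>R a n)) (pprt (a n - (1/2) ^ (n + m) *\<^sub>R a m))"
      by (rule inf_mono)
    also have "\<dots> = 0"
    proof (rule disjoint_of_ratio)
      have "(2::real) ^ (n + m) \<le> 2 ^ (2 * m)"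
        using that by (intro power_increasing) auto
      also have "\<dots> = 4 ^ m"
        by (simp add: power_mult)
      finally show "1 \<le> (4::real) ^ m * (1/2) ^ (n + m)"
        by (simp add: power_one_over field_simps)
    qed (use pos in auto)
    finally show ?thesis
      by (intro antisym) (auto simp: E_def)
  qed
  have "(\<lambda>n. (1/2::real) ^ n * norm s) \<longlonglongrightarrow> 0 * norm s"
    by (intro tendsto_mult LIMSEQ_power_zero tendsto_const) simp
  then have "\<forall>\<^sub>F n in sequentially. (1/2::real) ^ n * norm s < c - c'"
    using \<open>c' < c\<close> by (intro order_tendstoD(2)) auto
  then obtain n0 where n0: "\<And>n. n0 \<le> n \<Longrightarrow> (1/2::real) ^ n * norm s < c - c'"
    by (auto simp: eventually_sequentially)
  have E_norm: "c' \<le> norm (E n)" if "n0 \<le> n" for n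
  proof -
    have "pprt (a n - 4 ^ n *\<^sub>R (\<Sum>j<n. a j)) \<le> E n + (1/2) ^ n *\<^sub>R s"
      using pprt_diff_ge[OF s0'[of n], of "a n - 4 ^ n *\<^sub>R (\<Sum>j<n. a j)"] by (simp add: E_def diff_le_eq)
    then have "norm (pprt (a n - 4 ^ n *\<^sub>R (\<Sum>j<n. a j))) \<le> norm (E n + (1/2) ^ n *\<^sub>R s)"
      by (intro norm_pos_mono) auto
    also have "\<dots> \<le> norm (E n) + (1/2) ^ n * norm s"
      by (rule order_trans[OF norm_triangle_ineq]) simp
    finally show ?thesis
      using escape[of n] n0[OF that] by linarith
  qed
  have "inf (E (m + n0)) (E (n + n0)) = 0" if "m \<noteq> n" for m n
    using disj[of "n + n0" "m + n0"] disj[of "m + n0" "n + n0"] that by (auto simp: neq_iff inf_commute)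
  then show ?thesis
    using E_le_a E_norm by (intro exI[of _ "\<lambda>n. E (n + n0)"] exI[of _ n0]) (simp add: E_def)
qed

lemma inf_sum_eq_0:
  fixes b :: "'i \<Rightarrow> 'a::lattice_ab_group_add"
  assumes "finite N" "0 \<le> d" "\<And>n. n \<in> N \<Longrightarrow> 0 \<le> b n" "\<And>n. n \<in> N \<Longrightarrow> inf d (b n) = 0"
  shows "inf d (\<Sum>n\<in>N. b n) = 0"
  using assms
proof (induction N)
  case (insert n N)
  have nonneg: "0 \<le> b n" "0 \<le> sum b N"
    using insert.prems by (auto intro: sum_nonneg)
  have "inf d (b n + sum b N) \<le> inf d (b n) + inf d (sum b N)"
    by (intro inf_add_le nonneg insert.prems(1))
  also have "inf d (b n) = 0"
    using insert.prems(3) by simp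
  also have "inf d (sum b N) = 0"
    using insert.prems by (intro insert.IH) auto
  finally have "inf d (b n + sum b N) \<le> 0"
    by simp
  moreover have "0 \<le> inf d (b n + sum b N)"
    using nonneg insert.prems(1) by simp
  ultimately show ?case
    using insert.hyps by simp
qed (simp add: inf.absorb2)

lemma sum_disjoint_le:
  fixes b :: "'i \<Rightarrow> 'a::lattice_ab_group_add"
  assumes "finite N" "0 \<le> a" "\<And>n. n \<in> N \<Longrightarrow> 0 \<le> b n" "\<And>n. n \<in> N \<Longrightarrow> b n \<le> a"
    and "\<And>m n. m \<in> N \<Longrightarrow> n \<in> N \<Longrightarrow> m \<noteq> n \<Longrightarrow> inf (b m) (b n) = 0"
  shows "(\<Sum>n\<in>N. b n) \<le> a"
  using assms
proof (induction N)
  case (insert n N)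
  have "inf (b n) (\<Sum>n\<in>N. b n) = 0"
    using insert by (intro inf_sum_eq_0) auto
  then have "b n + (\<Sum>n\<in>N. b n) = sup (b n) (\<Sum>n\<in>N. b n)"
    using add_eq_inf_sup[of "b n" "\<Sum>n\<in>N. b n"] by simp
  also have "\<dots> \<le> a"
    using insert by (intro sup_least) auto
  finally show ?case
    using insert by simp
qed simp

lemma sum_band_proj_le:
  fixes a :: "'a::al_space"
  assumes N: "finite N" and a: "0 \<le> a" and D: "\<And>n. 0 \<le> D n" "\<And>m n. m \<noteq> n \<Longrightarrow> inf (D m) (D n) = 0"
  shows "(\<Sum>n\<in>N. band_proj (D n) a) \<le> a"
proof (rule le_limit)
  show "(\<lambda>k. \<Sum>n\<in>N. inf a (real k *\<^sub>R D n)) \<longlonglongrightarrow> (\<Sum>n\<in>N. band_proj (D n) a)"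
    by (intro tendsto_sum band_proj_tendsto D a)
  show "(\<Sum>n\<in>N. inf a (real k *\<^sub>R D n)) \<le> a" for k
  proof (rule sum_disjoint_le[OF N a])
    fix m n :: 'b assume "m \<noteq> n"
    have "inf (real k *\<^sub>R D m) (real k *\<^sub>R D n) = 0"
      using scaleR_inf[of "real k" "D m" "D n"] D(2)[OF \<open>m \<noteq> n\<close>] by (cases "k = 0") auto
    then have "inf (inf a (real k *\<^sub>R D m)) (inf a (real k *\<^sub>R D n)) \<le> 0"
      by (metis inf_mono inf_le2)
    then show "inf (inf a (real k *\<^sub>R D m)) (inf a (real k *\<^sub>R D n)) = 0"
      by (rule antisym) (simp add: a D(1) scaleR_nonneg_nonneg)
  qed (simp_all add: a D(1) scaleR_nonneg_nonneg)
qed simp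

section \<open>Factorizations of operators that cannot be truncated\<close>

text \<open>
  Instances of \<open>m\<close> are the absolute value of an AL-space and the modulus of its complexification.
\<close>

locale lattice_normed_space = hahn_banach_space s
  for s :: "'k::{real_normed_field,banach} \<Rightarrow> 'y::real_normed_vector \<Rightarrow> 'y" +
  fixes m :: "'y \<Rightarrow> 'f::al_space"
  assumes m_nonneg: "0 \<le> m y" and norm_m: "norm (m y) = norm y"
    and m_triangle: "m (y + z) \<le> m y + m z" and m_scale: "m (s c y) = norm c *\<^sub>R m y"
begin

text \<open>
  In an \<open>L\<^sub>1\<close>-space \<open>\<phi>\<close> would be integration against the conjugate sign of \<open>f\<close> over the set where
  \<open>D\<close> is positive. The seminorm \<open>\<integral> |y|\<close> over this set yields such a functional by the Hahn-Banach
  theorem.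
\<close>

lemma band_functional:
  assumes D: "0 \<le> D"
  shows "\<exists>\<phi>. bounded_operator s (*) \<phi> \<and> (\<forall>y. norm (\<phi> y) \<le> norm (band_proj D (m y))) \<and>
    norm (\<phi> f) = norm (band_proj D (m f))"
proof (rule dominated_functional)
  note lin = linear_band_proj[OF D]
  have nonneg: "0 \<le> band_proj D (m y)" for y
    using D m_nonneg by (rule band_proj_nonneg)
  show "norm (band_proj D (m (x + y))) \<le> norm (band_proj D (m x)) + norm (band_proj D (m y))" for x y
  proof -
    have "0 \<le> band_proj D (m x + m y - m (x + y))"
      using m_triangle[of x y] by (intro band_proj_nonneg D) simp
    then have "band_proj D (m (x + y)) \<le> band_proj D (m x) + band_proj D (m y)"
      by (simp add: linear_diff[OF lin] linear_add[OF lin])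
    then have "norm (band_proj D (m (x + y))) \<le> norm (band_proj D (m x) + band_proj D (m y))"
      by (intro norm_pos_mono nonneg)
    then show ?thesis
      by (rule order_trans[OF _ norm_triangle_ineq])
  qed
  show "norm (band_proj D (m (s c x))) = norm c * norm (band_proj D (m x))" for c x
    by (simp add: m_scale linear_scale[OF lin])
  show "norm (band_proj D (m x)) \<le> norm x" for x
    using norm_pos_mono[OF nonneg band_proj_le[OF D m_nonneg]] by (simp add: norm_m)
qed

text \<open>
  The bands generated by the disjoint vectors \<open>D n \<le> |T x\<^sub>n|\<close> make the functionals \<open>\<phi> n\<close>
  summable with total bound \<open>\<parallel>y\<parallel>\<close>, and \<open>|\<phi> n (T x\<^sub>n)|\<close> is at least \<open>\<parallel>D n\<parallel>\<close>.
\<close>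

theorem factorization_of_escaping_operator:
  fixes sE :: "'k \<Rightarrow> 'x::banach \<Rightarrow> 'x"
  assumes sE: "scaled_space sE" and T: "bounded_operator sE s T" and c: "0 < c'" "c' < c"
    and escape: "\<And>g. 0 \<le> g \<Longrightarrow> \<exists>x. norm x \<le> 1 \<and> c < norm (pprt (m (T x) - g))"
  shows "\<exists>v\<in>ell1_factorization_values sE s T. c' \<le> v"
proof -
  define good where "good x n y \<longleftrightarrow> norm y \<le> 1 \<and> c < norm (pprt (m (T y) - 4 ^ n *\<^sub>R (\<Sum>j<n. m (T (x j)))))"
    for x and n :: nat and y
  have "\<exists>x. \<forall>n. good x n (x n)"
  proof (rule dependent_wellorder_choice)
    show "good f n y = good g n y" if "\<And>j. j < n \<Longrightarrow> f j = g j" for f g n y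
      using that by (simp add: good_def)
    show "\<exists>y. good f n y" for f n
      unfolding good_def by (intro escape scaleR_nonneg_nonneg sum_nonneg m_nonneg) simp
  qed
  then obtain x where "\<And>n. good x n (x n)"
    by blast
  then have x: "norm (x n) \<le> 1"
      "c < norm (pprt (m (T (x n)) - 4 ^ n *\<^sub>R (\<Sum>j<n. m (T (x j)))))" for n
    by (simp_all add: good_def)
  \<comment> \<open>The two losses, in making the sequence disjoint and in inverting the perturbed identity, lead from \<open>c\<close> to \<open>c1\<close> and from \<open>c1\<close> to \<open>c'\<close>.\<close>
  define c1 where "c1 = (c + c') / 2"
  have c1: "c' < c1" "c1 < c" "0 < c1"
    using c by (simp_all add: c1_def field_simps)
  have Tx: "norm (m (T (x n))) \<le> onorm T" for n
  proof -
    have "norm (T (x n)) \<le> onorm T * 1"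
      using x(1)[of n] onorm_pos_le[OF bounded_operatorD(5)[OF T]]
      by (intro order_trans[OF bounded_operatorD(6)[OF T] mult_left_mono])
    then show ?thesis
      by (simp add: norm_m)
  qed
  have "\<exists>D n0. (\<forall>n. 0 \<le> D n \<and> D n \<le> m (T (x (n + n0))) \<and> c1 \<le> norm (D n)) \<and>
      (\<forall>m n. m \<noteq> n \<longrightarrow> inf (D m) (D n) = 0)"
    by (rule disjoint_sequence[OF m_nonneg Tx x(2) c1(2)])
  then obtain D n0 where D: "\<forall>n. 0 \<le> D n \<and> D n \<le> m (T (x (n + n0))) \<and> c1 \<le> norm (D n)"
      "\<forall>m n. m \<noteq> n \<longrightarrow> inf (D m) (D n) = 0"
    by (elim exE conjE)
  note D = D(1)[rule_format, THEN conjunct1] D(1)[rule_format, THEN conjunct2, THEN conjunct1]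
    D(1)[rule_format, THEN conjunct2, THEN conjunct2] D(2)[rule_format]
  have "\<forall>n. \<exists>\<phi>. bounded_operator s (*) \<phi> \<and> (\<forall>y. norm (\<phi> y) \<le> norm (band_proj (D n) (m y))) \<and>
      norm (\<phi> (T (x (n + n0)))) = norm (band_proj (D n) (m (T (x (n + n0)))))"
    by (rule allI, rule band_functional, rule D(1))
  from choice[OF this] obtain \<phi> where "\<forall>n. bounded_operator s (*) (\<phi> n) \<and>
      (\<forall>y. norm (\<phi> n y) \<le> norm (band_proj (D n) (m y))) \<and>
      norm (\<phi> n (T (x (n + n0)))) = norm (band_proj (D n) (m (T (x (n + n0)))))"
    by (rule exE)
  then have \<phi>: "bounded_operator s (*) (\<phi> n)" "norm (\<phi> n y) \<le> norm (band_proj (D n) (m y))"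
      "norm (\<phi> n (T (x (n + n0)))) = norm (band_proj (D n) (m (T (x (n + n0)))))" for n y
    by simp_all
  have sum: "(\<Sum>n\<in>N. norm (\<phi> n y)) \<le> norm y" if "finite N" for N y
  proof -
    have "(\<Sum>n\<in>N. norm (\<phi> n y)) \<le> (\<Sum>n\<in>N. norm_functional (band_proj (D n) (m y)))"
      using band_proj_nonneg[OF D(1) m_nonneg] \<phi>(2) by (intro sum_mono) (simp add: norm_functional_pos)
    also have "\<dots> = norm_functional (\<Sum>n\<in>N. band_proj (D n) (m y))"
      by (rule linear_sum[OF linear_norm_functional, symmetric])
    also have "\<dots> \<le> norm_functional (m y)"
      by (intro norm_functional_mono sum_band_proj_le that m_nonneg D)
    finally show ?thesis
      by (simp add: norm_functional_pos m_nonneg norm_m)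
  qed
  have lower: "c1 \<le> norm (\<phi> n (T (x (n + n0))))" for n
  proof -
    note lin = linear_band_proj[OF D(1)[of n]]
    have "0 \<le> band_proj (D n) (m (T (x (n + n0))) - D n)"
      using D(2)[of n] by (intro band_proj_nonneg D) simp
    then have "D n \<le> band_proj (D n) (m (T (x (n + n0))))"
      by (simp add: linear_diff[OF lin] band_proj_self[OF D(1)])
    from order_trans[OF D(3) norm_pos_mono[OF D(1) this]] show ?thesis
      unfolding \<phi>(3) .
  qed
  have "\<exists>v\<in>ell1_factorization_values sE s T. c1 * (1 - (1 - c' / c1)) \<le> v"
    using c c1 x(1) by (intro factorization_of_biorthogonal_bound[OF sE scaled_space_axioms T _ \<phi>(1) sum c1(3) lower])
      (auto simp: field_simps)
  then show ?thesis
    using c1(3) by simp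
qed

end

section \<open>Factorizations bound the weak essential norm from below\<close>

lemma tail_functional:
  fixes N :: nat
  shows "\<exists>\<tau>. bounded_operator ell1_scale (*) (\<tau> :: 'k::{real_normed_field,banach} ell1 \<Rightarrow> 'k) \<and>
    (\<forall>f. norm (\<tau> f) \<le> (\<Sum>k. norm (ell1_nth f (k + N)))) \<and> (\<forall>f. norm (\<tau> f) \<le> norm f) \<and>
    (\<forall>n\<ge>N. \<tau> (ell1_unit n) = 1)"
proof -
  define \<tau> where "\<tau> f = (\<Sum>k. ell1_nth f (k + N))" for f :: "'k ell1"
  have sumn: "summable (\<lambda>k. norm (ell1_nth f (k + N)))" for f :: "'k ell1"
    using summable_ignore_initial_segment[OF summable_ell1[of f], of N] by simp
  then have sum: "summable (\<lambda>k. ell1_nth f (k + N))" for f :: "'k ell1"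
    by (rule summable_norm_cancel)
  have tail: "norm (\<tau> f) \<le> (\<Sum>k. norm (ell1_nth f (k + N)))" for f
    unfolding \<tau>_def by (rule summable_norm[OF sumn])
  have tail_le: "(\<Sum>k. norm (ell1_nth f (k + N))) \<le> norm f" for f :: "'k ell1"
    using suminf_split_initial_segment[OF summable_ell1[of f], of N] sum_nonneg[of "{..<N}" "\<lambda>n. norm (ell1_nth f n)"]
    by (simp add: norm_ell1.rep_eq)
  have bound: "norm (\<tau> f) \<le> norm f" for f
    using tail tail_le order_trans by blast
  have "bounded_operator ell1_scale (*) \<tau>"
  proof (rule bounded_operatorI[OF scaled_space_ell1 scaled_space_mult])
    show "\<tau> (f + g) = \<tau> f + \<tau> g" for f g
      unfolding \<tau>_def by (simp add: plus_ell1.rep_eq suminf_add[OF sum sum])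
    show "\<tau> (ell1_scale c f) = c * \<tau> f" for c f
      unfolding \<tau>_def by (simp add: ell1_scale.rep_eq suminf_mult[OF sum])
    show "norm (\<tau> f) \<le> 1 * norm f" for f
      using bound by simp
  qed
  moreover have "\<tau> (ell1_unit n) = 1" if "N \<le> n" for n
  proof -
    have "\<tau> (ell1_unit n) = (\<Sum>k\<in>{n - N}. ell1_nth (ell1_unit n) (k + N))"
      unfolding \<tau>_def using that by (intro suminf_finite) (auto simp: ell1_nth_unit)
    then show ?thesis
      using that by (simp add: ell1_nth_unit)
  qed
  ultimately show ?thesis
    using tail bound by (intro exI[of _ \<tau>]) simp
qed

context hahn_banach_space
begin

text \<open>
  The weak closures of the tails of \<open>W (x n)\<close> have the finite intersection property in a compact set.
\<close>

lemma weak_cluster_point: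
  assumes "weakly_compact_operator sE s W" and x: "\<And>n::nat. norm (x n) \<le> 1"
  shows "\<exists>y0. \<forall>\<phi> N \<epsilon>. bounded_operator s (*) \<phi> \<longrightarrow> 0 < \<epsilon> \<longrightarrow> (\<exists>n\<ge>N. norm (\<phi> (W (x n)) - \<phi> y0) < (\<epsilon>::real))"
proof -
  let ?weak = "weak_topology s"
  define K where "K = ?weak closure_of (W ` cball 0 1)"
  have K: "compactin ?weak K"
    using assms(1) by (simp add: weakly_compact_operator_def K_def)
  have WK: "W (x n) \<in> K" for n
  proof -
    have "W ` cball 0 1 \<subseteq> K"
      unfolding K_def by (rule closure_of_subset) (simp add: topspace_weak_topology)
    moreover have "x n \<in> cball 0 1"
      using x by simp
    ultimately show ?thesis
      by blast
  qed
  define C where "C N = ?weak closure_of ((\<lambda>n. W (x n)) ` {N..})" for N :: nat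
  have in_C: "W (x n) \<in> C N" if "N \<le> n" for n N
  proof -
    have "(\<lambda>n. W (x n)) ` {N..} \<subseteq> C N"
      unfolding C_def by (rule closure_of_subset) (simp add: topspace_weak_topology)
    then show ?thesis
      using that by auto
  qed
  have "K \<inter> \<Inter>(range C) \<noteq> {}"
  proof (rule K[unfolded compactin_fip, THEN conjunct2, THEN spec, THEN mp], intro conjI ballI allI impI)
    show "closedin ?weak B" if "B \<in> range C" for B
      using that by (auto simp: C_def)
    fix \<F> assume "finite \<F> \<and> \<F> \<subseteq> range C"
    then have "\<exists>J. finite J \<and> \<F> = C ` J"
      using finite_subset_image[of \<F> C UNIV] by blast
    then obtain J where J: "finite J" "\<F> = C ` J"
      by blast
    have "j \<le> Max (insert 0 J)" if "j \<in> J" for j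
      using J(1) that by (intro Max_ge) auto
    then have "W (x (Max (insert 0 J))) \<in> K \<inter> \<Inter>\<F>"
      using WK in_C J(2) by auto
    then show "K \<inter> \<Inter>\<F> \<noteq> {}"
      by blast
  qed
  then obtain y0 where y0: "\<And>N. y0 \<in> C N"
    by blast
  have "\<exists>n\<ge>N. norm (\<phi> (W (x n)) - \<phi> y0) < \<epsilon>" if \<phi>: "bounded_operator s (*) \<phi>" and "0 < \<epsilon>" for \<phi> N and \<epsilon> :: real
  proof -
    let ?O = "{y \<in> topspace ?weak. \<phi> y \<in> ball (\<phi> y0) \<epsilon>}"
    have openO: "openin ?weak ?O"
      by (rule openin_continuous_map_preimage[OF continuous_map_functional[OF \<phi>]]) simp
    have "y0 \<in> ?O"
      using \<open>0 < \<epsilon>\<close> by (simp add: topspace_weak_topology)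
    from y0[of N, unfolded C_def in_closure_of, THEN conjunct2, THEN spec, THEN mp, OF conjI[OF this openO]]
    obtain y where "y \<in> (\<lambda>n. W (x n)) ` {N..}" "y \<in> ?O"
      by (elim exE conjE)
    then show ?thesis
      by (auto simp: dist_norm norm_minus_commute)
  qed
  then show ?thesis
    by (intro exI[of _ y0] allI impI)
qed

text \<open>
  The sum functional of a tail on which \<open>U y0\<close> is small, \<open>y0\<close> being a weak cluster point, separates
  \<open>T\<close> from \<open>W\<close> on some normalized image of a unit vector.
\<close>

theorem factorization_value_le:
  assumes T: "bounded_operator sE s T" and W: "weakly_compact_operator sE s W"
    and v: "v \<in> ell1_factorization_values sE s T"
  shows "v \<le> onorm (\<lambda>x. T x - W x)"
proof -
  obtain U V where U: "bounded_operator s (ell1_scale :: 'k \<Rightarrow> _) U" and V: "bounded_operator (ell1_scale :: 'k \<Rightarrow> _) sE V"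
      and UTV: "U \<circ> T \<circ> V = id" and v_eq: "v = inverse (onorm U) * inverse (onorm V)"
    using v unfolding ell1_factorization_values_def by blast
  have W': "bounded_operator sE s W"
    using W by (simp add: weakly_compact_operator_def)
  define R where "R = onorm (\<lambda>x. T x - W x)"
  have blTW: "bounded_linear (\<lambda>x. T x - W x)"
    by (rule bounded_operatorD(5)[OF bounded_operator_diff[OF T W']])
  have R: "0 \<le> R" "norm (T x - W x) \<le> R * norm x" for x
    unfolding R_def by (rule onorm_pos_le[OF blTW], rule onorm[OF blTW])
  have pos: "0 \<le> onorm U" "0 \<le> onorm V"
    by (rule onorm_pos_le[OF bounded_operatorD(5)[OF U]], rule onorm_pos_le[OF bounded_operatorD(5)[OF V]])
  show ?thesis
  proof (cases "onorm U = 0 \<or> onorm V = 0")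
    case True
    then show ?thesis
      using R(1) by (auto simp: v_eq R_def)
  next
    case False
    then have pos: "0 < onorm U" "0 < onorm V"
      using pos by auto
    define x where "x n = inverse (onorm V) *\<^sub>R V (ell1_unit n)" for n
    have Ve: "norm (V (ell1_unit n)) \<le> onorm V" for n
      using bounded_operatorD(6)[OF V, of "ell1_unit n"] mult_left_mono[OF norm_ell1_unit_le[of n, where 'k = 'k] less_imp_le[OF pos(2)]]
      by simp
    have xn: "norm (x n) \<le> 1" for n
      using Ve[of n] pos(2) by (simp add: x_def field_simps)
    obtain y0 where y0: "\<forall>\<phi> N \<epsilon>. bounded_operator s (*) \<phi> \<longrightarrow> 0 < \<epsilon> \<longrightarrow> (\<exists>n\<ge>N. norm (\<phi> (W (x n)) - \<phi> y0) < (\<epsilon>::real))"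
      using weak_cluster_point[OF W, of x] xn by blast
    have "inverse (onorm V) \<le> onorm U * R"
    proof (rule field_le_epsilon)
      fix e :: real assume "0 < e"
      have "(\<lambda>N. \<Sum>k. norm (ell1_nth (U y0) (k + N))) \<longlonglongrightarrow> 0"
        by (rule suminf_exist_split2[OF summable_ell1])
      then have "\<forall>\<^sub>F N in sequentially. (\<Sum>k. norm (ell1_nth (U y0) (k + N))) < e / 2"
        using \<open>0 < e\<close> by (intro order_tendstoD(2)) auto
      then obtain N where N: "(\<Sum>k. norm (ell1_nth (U y0) (k + N))) < e / 2"
        by (auto simp: eventually_sequentially)
      obtain \<tau> where \<tau>: "bounded_operator ell1_scale (*) \<tau>" "\<And>f. norm (\<tau> f) \<le> (\<Sum>k. norm (ell1_nth f (k + N)))"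
          "\<And>f. norm (\<tau> f) \<le> norm f" "\<And>n. N \<le> n \<Longrightarrow> \<tau> (ell1_unit n) = (1::'k)"
        using tail_functional[of N, where 'k = 'k] by blast
      have \<tau>U: "bounded_operator s (*) (\<tau> \<circ> U)"
        by (rule bounded_operator_compose[OF U \<tau>(1)])
      obtain n where n: "N \<le> n" "norm ((\<tau> \<circ> U) (W (x n)) - (\<tau> \<circ> U) y0) < e / 2"
        using y0 \<tau>U \<open>0 < e\<close> by (meson half_gt_zero)
      have "norm (\<tau> (U y0)) < e / 2"
        using \<tau>(2)[of "U y0"] N by linarith
      then have small: "norm (\<tau> (U (W (x n)))) < e"
        using n(2) norm_triangle_sub[of "\<tau> (U (W (x n)))" "\<tau> (U y0)"] by simp
      note blUT = bounded_linear.linear[OF bounded_operatorD(5)[OF \<tau>U]] bounded_linear.linear[OF bounded_operatorD(5)[OF T]]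
      have "(\<tau> \<circ> U) (T (x n)) = inverse (onorm V) *\<^sub>R \<tau> ((U \<circ> T \<circ> V) (ell1_unit n))"
        by (simp add: x_def linear_scale[OF blUT(2)] linear_scale[OF blUT(1), unfolded o_def])
      also have "\<dots> = of_real (inverse (onorm V))"
        unfolding UTV using \<tau>(4)[OF n(1)] by (simp add: scaleR_conv_of_real)
      finally have "inverse (onorm V) = norm (\<tau> (U (T (x n))))"
        using pos(2) by (simp add: norm_inverse del: of_real_inverse)
      also have "\<tau> (U (T (x n))) = \<tau> (U (T (x n) - W (x n))) + \<tau> (U (W (x n)))"
        by (simp add: bounded_operatorD(2)[OF U] bounded_operatorD(2)[OF \<tau>(1)])
      also have "norm \<dots> \<le> norm (U (T (x n) - W (x n))) + e"
        using small \<tau>(3)[of "U (T (x n) - W (x n))"] by (intro order_trans[OF norm_triangle_ineq]) simp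
      also have "norm (U (T (x n) - W (x n))) \<le> onorm U * (R * 1)"
        using R xn[of n] pos(1)
        by (intro order_trans[OF bounded_operatorD(6)[OF U]] mult_left_mono order_trans[OF R(2)]) auto
      finally show "inverse (onorm V) \<le> onorm U * R + e"
        by simp
    qed
    then have "v \<le> inverse (onorm U) * (onorm U * R)"
      unfolding v_eq using pos(1) by (intro mult_left_mono) auto
    also have "\<dots> = R"
      using pos(1) by simp
    finally show ?thesis
      unfolding R_def .
  qed
qed

lemma zero_weakly_compact:
  assumes "scaled_space sE"
  shows "weakly_compact_operator sE s (\<lambda>_. 0)"
proof (rule weakly_compact_operatorI[where K = "{0}"])
  interpret vector_space s
    by (rule vector_space)
  show "bounded_operator sE s (\<lambda>_. 0)"
    by (rule bounded_operatorI[OF assms scaled_space_axioms, where K = 0]) auto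
  show "compactin (weak_topology s) {0}"
    by (intro finite_imp_compactin) (auto simp: topspace_weak_topology)
qed auto

text \<open>
  The alternative for each \<open>c\<close> excludes that a number lies strictly between the two sides.
\<close>

theorem weak_essential_norm_eqI:
  fixes sE :: "'k \<Rightarrow> 'a::real_normed_vector \<Rightarrow> 'a"
  assumes sE: "scaled_space sE" and T: "bounded_operator sE s T"
    and dich: "\<And>c. 0 < c \<Longrightarrow> (\<exists>W. weakly_compact_operator sE s W \<and> onorm (\<lambda>x. T x - W x) \<le> c) \<or>
      (\<forall>c'. 0 < c' \<longrightarrow> c' < c \<longrightarrow> (\<exists>v\<in>ell1_factorization_values sE s T. c' \<le> v))"
  shows "weak_essential_norm sE s T = sup0 (ell1_factorization_values sE s T)"
proof -
  let ?V = "ell1_factorization_values sE s T"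
  let ?w = "weak_essential_norm sE s T"
  have bl: "bounded_linear (\<lambda>x. T x - W x)" if "weakly_compact_operator sE s W" for W
    using that by (intro bounded_operatorD(5)[OF bounded_operator_diff[OF T]]) (simp add: weakly_compact_operator_def)
  have w_le: "?w \<le> onorm (\<lambda>x. T x - W x)" if "weakly_compact_operator sE s W" for W
    unfolding weak_essential_norm_def using that onorm_pos_le[OF bl]
    by (intro cINF_lower bdd_belowI2[of _ 0]) auto
  have w_ge: "b \<le> ?w" if "\<And>W. weakly_compact_operator sE s W \<Longrightarrow> b \<le> onorm (\<lambda>x. T x - W x)" for b
    unfolding weak_essential_norm_def using that zero_weakly_compact[OF sE] by (intro cINF_greatest) auto
  have v_le: "v \<le> ?w" if "v \<in> ?V" for v
    using factorization_value_le[OF T _ that] by (rule w_ge)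
  have "sup0 ?V \<le> ?w"
    using v_le w_ge[of 0] onorm_pos_le[OF bl] by (auto simp: sup0_def intro: cSup_least)
  moreover have "?w \<le> sup0 ?V"
  proof (rule ccontr)
    assume "\<not> ?w \<le> sup0 ?V"
    then have less: "sup0 ?V < ?w"
      by simp
    have v_sup: "v \<le> sup0 ?V" if "v \<in> ?V" for v
      using that v_le by (auto simp: sup0_def intro!: cSup_upper bdd_aboveI[of _ ?w])
    have sup0: "0 \<le> sup0 ?V"
    proof (cases "?V = {}")
      case False
      then obtain v where v: "v \<in> ?V"
        by blast
      then obtain U :: "'y \<Rightarrow> 'k ell1" and V :: "'k ell1 \<Rightarrow> 'a" where UV: "bounded_operator s ell1_scale U"
          "bounded_operator ell1_scale sE V" "v = inverse (onorm U) * inverse (onorm V)"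
        unfolding ell1_factorization_values_def by blast
      have "0 \<le> v"
        unfolding UV(3) using onorm_pos_le[OF bounded_operatorD(5)[OF UV(1)]] onorm_pos_le[OF bounded_operatorD(5)[OF UV(2)]]
        by simp
      then show ?thesis
        using v_sup[OF v] by simp
    qed (simp add: sup0_def)
    obtain c where c: "sup0 ?V < c" "c < ?w"
      using dense[OF less] by blast
    obtain c' where c': "sup0 ?V < c'" "c' < c"
      using dense[OF c(1)] by blast
    have "0 < c"
      using sup0 c(1) by simp
    from dich[OF this] show False
    proof
      assume "\<exists>W. weakly_compact_operator sE s W \<and> onorm (\<lambda>x. T x - W x) \<le> c"
      then show False
        using w_le c(2) by (elim exE conjE) (meson not_less order_trans)
    next
      assume "\<forall>c'. 0 < c' \<longrightarrow> c' < c \<longrightarrow> (\<exists>v\<in>?V. c' \<le> v)"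
      from this[rule_format, of c'] obtain v where "v \<in> ?V" "c' \<le> v"
        using c' sup0 by auto
      then show False
        using v_sup[of v] c'(1) by simp
    qed
  qed
  ultimately show ?thesis
    by simp
qed

end

section \<open>The weak essential norm of operators between AL-spaces\<close>

text \<open>
  The truncated operator is constructed with values in the complexification, and its real part
  is within the same distance of \<open>T\<close>.
\<close>

lemma weak_essential_norm_real:
  fixes T :: "'e::al_space \<Rightarrow> 'f::al_space"
  assumes T: "bounded_operator scaleR scaleR T"
  shows "weak_essential_norm scaleR scaleR T = sup0 (ell1_factorization_values scaleR scaleR T)"
proof -
  interpret F: hahn_banach_space "scaleR :: real \<Rightarrow> 'f \<Rightarrow> 'f"
    by (rule hahn_banach_space_scaleR)
  interpret F: lattice_normed_space "scaleR :: real \<Rightarrow> 'f \<Rightarrow> 'f" abs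
  proof
    show "\<bar>c *\<^sub>R y\<bar> = norm c *\<^sub>R \<bar>y\<bar>" for c :: real and y :: 'f
    proof (rule antisym)
      show "\<bar>c *\<^sub>R y\<bar> \<le> norm c *\<^sub>R \<bar>y\<bar>"
        using abs_scaleR_le by simp
      show "norm c *\<^sub>R \<bar>y\<bar> \<le> \<bar>c *\<^sub>R y\<bar>"
      proof (cases "c = 0")
        case False
        have "\<bar>c\<bar> *\<^sub>R \<bar>inverse c *\<^sub>R c *\<^sub>R y\<bar> \<le> \<bar>c\<bar> *\<^sub>R \<bar>inverse c\<bar> *\<^sub>R \<bar>c *\<^sub>R y\<bar>"
          by (intro scaleR_left_mono abs_scaleR_le) simp
        then show ?thesis
          using False by simp
      qed simp
    qed
  qed (simp_all add: norm_abs_lattice abs_triangle_ineq)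
  note linT = bounded_linear.linear[OF bounded_operatorD(5)[OF T]]
  show ?thesis
  proof (rule F.weak_essential_norm_eqI[OF scaled_space_scaleR T])
    fix c :: real assume "0 < c"
    show "(\<exists>W. weakly_compact_operator scaleR scaleR W \<and> onorm (\<lambda>x. T x - W x) \<le> c) \<or>
      (\<forall>c'. 0 < c' \<longrightarrow> c' < c \<longrightarrow> (\<exists>v\<in>ell1_factorization_values scaleR scaleR T. c' \<le> v))"
    proof (cases "\<exists>g\<ge>0. \<forall>u. norm u \<le> 1 \<longrightarrow> norm (pprt (\<bar>T u\<bar> - g)) \<le> c")
      case True
      then obtain g where g: "0 \<le> g" "\<And>u. norm u \<le> 1 \<Longrightarrow> norm (pprt (\<bar>T u\<bar> - g)) \<le> c"
        by blast
      let ?T = "\<lambda>x. Complexify (T x) 0"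
      have "bounded_linear ?T"
        using bounded_operatorD(6)[OF T]
        by (intro bounded_linear_intro[of _ "onorm T"])
          (simp_all add: complexification_ops linear_add[OF linT] linear_scale[OF linT] mult.commute)
      then have "\<exists>W. linear W \<and> (\<forall>x. \<bar>re_part (W x)\<bar> \<le> norm x *\<^sub>R g \<and> \<bar>im_part (W x)\<bar> \<le> norm x *\<^sub>R g) \<and>
          (\<forall>x. norm (?T x - W x) \<le> c * norm x)"
        using g \<open>0 < c\<close> by (intro truncated_operator) (simp_all add: modulus_real)
      then obtain W where W: "linear W" "\<forall>x. \<bar>re_part (W x)\<bar> \<le> norm x *\<^sub>R g \<and> \<bar>im_part (W x)\<bar> \<le> norm x *\<^sub>R g"
          "\<forall>x. norm (?T x - W x) \<le> c * norm x"
        by (elim exE conjE)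
      let ?W = "\<lambda>x. re_part (W x)"
      have "norm (?W x) \<le> norm g * norm x" for x
        using norm_le_of_abs_le[of "?W x" "norm x *\<^sub>R g"] W(2) g(1)
        by (simp add: norm_functional_simps norm_functional_pos mult.commute)
      then have op: "bounded_operator scaleR scaleR ?W"
        by (intro bounded_operatorI[where K = "norm g"] scaled_space_scaleR)
          (simp_all add: linear_add[OF W(1)] linear_scale[OF W(1)])
      have "?W ` cball 0 1 \<subseteq> {y. \<bar>y\<bar> \<le> g}"
      proof (intro image_subsetI, simp)
        fix x :: 'e assume "norm x \<le> 1"
        then have "norm x *\<^sub>R g \<le> 1 *\<^sub>R g"
          by (intro scaleR_right_mono g)
        then show "\<bar>?W x\<bar> \<le> g"
          using W(2) order_trans by auto
      qed
      then have "weakly_compact_operator scaleR scaleR ?W"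
        by (intro F.weakly_compact_operatorI[OF op compactin_order_interval])
      moreover have "onorm (\<lambda>x. T x - ?W x) \<le> c"
      proof (rule onorm_bound)
        show "norm (T x - ?W x) \<le> c * norm x" for x
          using norm_re_part_le[of "?T x - W x"] W(3)[rule_format, of x] by simp
      qed (use \<open>0 < c\<close> in simp)
      ultimately show ?thesis
        by (intro disjI1 exI[of _ ?W] conjI)
    next
      case False
      then have esc: "\<exists>x. norm x \<le> 1 \<and> c < norm (pprt (\<bar>T x\<bar> - g))" if "0 \<le> g" for g
        using that by (meson not_less)
      show ?thesis
        by (intro disjI2 allI impI F.factorization_of_escaping_operator[OF scaled_space_scaleR T _ _ esc])
    qed
  qed
qed

text \<open>
  Truncation is applied to the restriction of \<open>S\<close> to real arguments, and the result is extended
  complex linearly. The extension need not have modulus below the same \<open>g\<close>, but a larger box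
  serves for weak compactness; the distance to \<open>S\<close> is not affected, by the decomposition of complex
  vectors into real ones with complex coefficients.
\<close>

lemma weak_essential_norm_complex:
  fixes S :: "'e::al_space complexification \<Rightarrow> 'f::al_space complexification"
  assumes S: "bounded_operator cscale cscale S"
  shows "weak_essential_norm cscale cscale S = sup0 (ell1_factorization_values cscale cscale S)"
proof -
  interpret F: hahn_banach_space "cscale :: complex \<Rightarrow> 'f complexification \<Rightarrow> _"
    by (rule hahn_banach_space_cscale)
  interpret F: lattice_normed_space "cscale :: complex \<Rightarrow> 'f complexification \<Rightarrow> _" modulus
    by unfold_locales (simp_all add: norm_complexification_def modulus_triangle modulus_cscale)
  note linS = bounded_linear.linear[OF bounded_operatorD(5)[OF S]]
  show ?thesis
  proof (rule F.weak_essential_norm_eqI[OF scaled_space_cscale S])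
    fix c :: real assume "0 < c"
    show "(\<exists>W. weakly_compact_operator cscale cscale W \<and> onorm (\<lambda>x. S x - W x) \<le> c) \<or>
      (\<forall>c'. 0 < c' \<longrightarrow> c' < c \<longrightarrow> (\<exists>v\<in>ell1_factorization_values cscale cscale S. c' \<le> v))"
    proof (cases "\<exists>g\<ge>0. \<forall>u. norm u \<le> 1 \<longrightarrow> norm (pprt (modulus (S u) - g)) \<le> c")
      case True
      then obtain g where g: "0 \<le> g" "\<And>u. norm u \<le> 1 \<Longrightarrow> norm (pprt (modulus (S u) - g)) \<le> c"
        by blast
      let ?T = "\<lambda>x. S (Complexify x 0)"
      have "bounded_linear (\<lambda>x. Complexify x 0 :: 'e complexification)"
        by (rule bounded_linear_intro[where K = 1]) (simp_all add: complexification_ops)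
      then have "bounded_linear ?T"
        by (rule bounded_linear_compose[OF bounded_operatorD(5)[OF S]])
      then have "\<exists>W. linear W \<and> (\<forall>x. \<bar>re_part (W x)\<bar> \<le> norm x *\<^sub>R g \<and> \<bar>im_part (W x)\<bar> \<le> norm x *\<^sub>R g) \<and>
          (\<forall>x. norm (?T x - W x) \<le> c * norm x)"
        using g \<open>0 < c\<close> by (intro truncated_operator) simp_all
      then obtain W where W: "linear W" "\<forall>x. \<bar>re_part (W x)\<bar> \<le> norm x *\<^sub>R g \<and> \<bar>im_part (W x)\<bar> \<le> norm x *\<^sub>R g"
          "\<forall>x. norm (?T x - W x) \<le> c * norm x"
        by (elim exE conjE)
      define V where "V z = W (re_part z) + cscale \<i> (W (im_part z))" for z
      let ?box = "\<lambda>h. {z :: 'f complexification. \<bar>re_part z\<bar> \<le> h \<and> \<bar>im_part z\<bar> \<le> h}"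
      have V_box: "V z \<in> ?box (norm z *\<^sub>R (g + g))" for z
      proof -
        have part: "\<bar>re_part (W x)\<bar> \<le> norm z *\<^sub>R g" "\<bar>im_part (W x)\<bar> \<le> norm z *\<^sub>R g" if "norm x \<le> norm z" for x
          using W(2) scaleR_right_mono[OF that g(1)] order_trans by blast+
        have "\<bar>re_part (V z)\<bar> \<le> \<bar>re_part (W (re_part z))\<bar> + \<bar>im_part (W (im_part z))\<bar>"
          using abs_triangle_ineq4[of "re_part (W (re_part z))" "im_part (W (im_part z))"] by (simp add: V_def)
        also have "\<dots> \<le> norm z *\<^sub>R g + norm z *\<^sub>R g"
          by (intro add_mono part norm_re_part_le norm_im_part_le)
        finally have 1: "\<bar>re_part (V z)\<bar> \<le> norm z *\<^sub>R (g + g)"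
          by (simp only: scaleR_right_distrib)
        have "\<bar>im_part (V z)\<bar> \<le> \<bar>im_part (W (re_part z))\<bar> + \<bar>re_part (W (im_part z))\<bar>"
          using abs_triangle_ineq[of "im_part (W (re_part z))" "re_part (W (im_part z))"] by (simp add: V_def)
        also have "\<dots> \<le> norm z *\<^sub>R g + norm z *\<^sub>R g"
          by (intro add_mono part norm_re_part_le norm_im_part_le)
        finally have "\<bar>im_part (V z)\<bar> \<le> norm z *\<^sub>R (g + g)"
          by (simp only: scaleR_right_distrib)
        with 1 show ?thesis
          by simp
      qed
      have norm_V: "norm (V z) \<le> (2 * norm (g + g)) * norm z" for z
      proof -
        have "norm (re_part (V z)) \<le> norm z * norm (g + g)" "norm (im_part (V z)) \<le> norm z * norm (g + g)"
          using V_box[of z] norm_le_of_abs_le[of "re_part (V z)" "norm z *\<^sub>R (g + g)"]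
            norm_le_of_abs_le[of "im_part (V z)" "norm z *\<^sub>R (g + g)"] norm_functional_pos[of "g + g"] g(1)
          by (simp_all add: linear_scale[OF linear_norm_functional] del: norm_scaleR)
        then show ?thesis
          using norm_le_parts[of "V z"] by (simp add: mult.commute)
      qed
      have op: "bounded_operator cscale cscale V"
      proof (rule bounded_operatorI[OF scaled_space_cscale scaled_space_cscale])
        show "V (z + w) = V z + V w" for z w
          by (rule complexification.expand) (simp add: V_def linear_add[OF W(1)])
        show "V (cscale k z) = cscale k (V z)" for k z
          by (rule complexification.expand)
            (simp add: V_def linear_add[OF W(1)] linear_diff[OF W(1)] linear_scale[OF W(1)] algebra_simps)
      qed (rule norm_V)
      have "V ` cball 0 1 \<subseteq> ?box (g + g)"
      proof (intro image_subsetI)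
        fix z :: "'e complexification" assume "z \<in> cball 0 1"
        then have "norm z *\<^sub>R (g + g) \<le> 1 *\<^sub>R (g + g)"
          using g(1) by (intro scaleR_right_mono) auto
        then show "V z \<in> ?box (g + g)"
          using V_box[of z] order_trans by auto
      qed
      then have "weakly_compact_operator cscale cscale V"
        by (intro F.weakly_compact_operatorI[OF op compactin_order_box])
      moreover have "onorm (\<lambda>z. S z - V z) \<le> c"
      proof (rule onorm_bound)
        have diff: "bounded_operator cscale cscale (\<lambda>z. S z - V z)"
          by (rule bounded_operator_diff[OF S op])
        define R where "R = onorm (\<lambda>z. S z - V z)"
        have R: "0 \<le> R" "norm (S z - V z) \<le> R * norm z" for z
          unfolding R_def using bounded_operatorD(6)[OF diff] onorm_pos_le[OF bounded_operatorD(5)[OF diff]] by auto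
        have V_real: "V (Complexify u 0) = W u" for u
          by (rule complexification.expand) (simp add: V_def linear_0[OF W(1)])
        show "norm (S z - V z) \<le> c * norm z" for z
        proof (rule field_le_epsilon)
          fix e :: real assume "0 < e"
          define \<epsilon> where "\<epsilon> = e / (R + c)"
          have Rc: "0 < R + c"
            using \<open>0 < c\<close> R(1) by simp
          then have \<epsilon>: "0 < \<epsilon>" "R * \<epsilon> + c * \<epsilon> = e"
            unfolding distrib_right[symmetric] using \<open>0 < e\<close> by (simp_all add: \<epsilon>_def)
          obtain xs where xs:
              "norm (z - (\<Sum>(k, u)\<leftarrow>xs. cscale k (Complexify u 0))) \<le> \<epsilon>"
              "(\<Sum>(k, u)\<leftarrow>xs. cmod k * norm u) \<le> norm z + \<epsilon>"
            using complexification_decomposition[OF \<epsilon>(1), of z] by (elim exE conjE)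
          let ?z = "\<Sum>(k, u)\<leftarrow>xs. cscale k (Complexify u 0)"
          have "S ?z - V ?z = (\<Sum>(k, u)\<leftarrow>xs. cscale k (S (Complexify u 0) - W u))"
            using linear_sum_list[OF bounded_linear.linear[OF bounded_operatorD(5)[OF diff]], of "\<lambda>(k, u). cscale k (Complexify u 0)" xs]
            by (simp add: case_prod_unfold bounded_operatorD(3)[OF diff] V_real)
          also have "norm \<dots> \<le> (\<Sum>(k, u)\<leftarrow>xs. cmod k * norm u * c)"
          proof (rule order_trans[OF norm_sum_list_le sum_list_mono])
            have "norm (cscale k (S (Complexify u 0) - W u)) \<le> cmod k * norm u * c" for k u
              using mult_left_mono[OF W(3)[rule_format, of u] norm_ge_zero[of k]]
              by (simp add: norm_cscale ac_simps)
            then show "norm (case p of (k, u) \<Rightarrow> cscale k (S (Complexify u 0) - W u)) \<le>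
                (case p of (k, u) \<Rightarrow> cmod k * norm u * c)" for p
              by (simp add: case_prod_unfold)
          qed
          also have "\<dots> = (\<Sum>(k, u)\<leftarrow>xs. cmod k * norm u) * c"
            by (simp add: case_prod_unfold sum_list_mult_const)
          also have "\<dots> \<le> (norm z + \<epsilon>) * c"
            using xs(2) \<open>0 < c\<close> by (intro mult_right_mono) auto
          finally have 1: "norm (S ?z - V ?z) \<le> (norm z + \<epsilon>) * c" .
          have 2: "norm (S (z - ?z) - V (z - ?z)) \<le> R * \<epsilon>"
            using R xs(1) by (intro order_trans[OF R(2)] mult_left_mono)
          have "S z - V z = (S (z - ?z) - V (z - ?z)) + (S ?z - V ?z)"
            by (simp add: bounded_operatorD(2)[OF S] bounded_operatorD(2)[OF op])
          then have "norm (S z - V z) \<le> R * \<epsilon> + (norm z + \<epsilon>) * c"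
            using norm_triangle_mono[OF 2 1] by simp
          also have "\<dots> = c * norm z + (R * \<epsilon> + c * \<epsilon>)"
            by (simp add: algebra_simps)
          finally show "norm (S z - V z) \<le> c * norm z + e"
            unfolding \<epsilon>(2) .
        qed
      qed (use \<open>0 < c\<close> in simp)
      ultimately show ?thesis
        by (intro disjI1 exI[of _ V] conjI)
    next
      case False
      then have esc: "\<exists>x. norm x \<le> 1 \<and> c < norm (pprt (modulus (S x) - g))" if "0 \<le> g" for g
        using that by (meson not_less)
      show ?thesis
        by (intro disjI2 allI impI F.factorization_of_escaping_operator[OF scaled_space_cscale S _ _ esc])
    qed
  qed
qed

theorem theorem1p4:
  fixes T :: "'e::al_space \<Rightarrow> 'f::al_space"
    and S :: "'e complexification \<Rightarrow> 'f complexification"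
  shows "(bounded_operator scaleR scaleR T \<longrightarrow>
            weak_essential_norm scaleR scaleR T = sup0 (ell1_factorization_values scaleR scaleR T)) \<and>
         (bounded_operator cscale cscale S \<longrightarrow>
            weak_essential_norm cscale cscale S = sup0 (ell1_factorization_values cscale cscale S))"
  using weak_essential_norm_real weak_essential_norm_complex by blast

end
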